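(* Let $p\in\mathbb{C}$ with $\Re(p)>0$, $\nu\ge0$, $b_1,b_2,b_3,c_1\in\mathbb{C}$ with $\Re(c_1)>\Re(b_1)>0$, $|\arg(1-x)|<\pi$, $|\arg(1-y)|<\pi$, and let $\mu$ be a free parameter. Write $C=\dfrac{\Gamma(c_1)}{\Gamma(b_1)\Gamma(c_1-b_1)}$. Then each of the following integral representations holds: (i) $$F_{1,p,\nu}(b_1,b_2,b_3;c_1;x,y)=C\sqrt{2p}\int_0^1 t^{b_1-\frac32}(1-t)^{c_1-b_1-\frac32}(1-xt)^{-b_2}(1-yt)^{-b_3}\,e^{\frac{p}{t(1-t)}}\,G^{2,0}_{1,2}\!\left(\frac{2p}{t(1-t)}\,\bigg|\,\begin{array}{c}\frac12\\ \nu+\frac12,\,-\nu-\frac12\end{array}\right)dt;$$ (ii) $$F_{1,p,\nu}(b_1,b_2,b_3;c_1;x,y)=C\sqrt{2p}\,\frac{\cos\pi(\nu+\frac12)}{\pi}\int_0^1 t^{b_1-\frac32}(1-t)^{c_1-b_1-\frac32}(1-xt)^{-b_2}(1-yt)^{-b_3}\,e^{\frac{-p}{t(1-t)}}\,G^{2,1}_{1,2}\!\left(\frac{2p}{t(1-t)}\,\bigg|\,\begin{array}{c}\frac12\\ \nu+\frac12,\,-\nu-\frac12\end{array}\right)dt;$$ (iii) $$F_{1,p,\nu}(b_1,b_2,b_3;c_1;x,y)=C\,2^{\mu-\frac12}p^{-\mu+\frac12}\int_0^1 t^{b_1+\mu-\frac32}(1-t)^{c_1-b_1+\mu-\frac32}(1-xt)^{-b_2}(1-yt)^{-b_3}\,G^{2,0}_{0,2}\!\left(\frac{p^2}{4t^2(1-t)^2}\,\bigg|\,\begin{array}{c}-\\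 \frac{2\mu+2\nu+1}{4},\,\frac{2\mu-2\nu-1}{4}\end{array}\right)dt;$$ (iv) $$F_{1,p,\nu}(b_1,b_2,b_3;c_1;x,y)=C\,(2p)^{-\mu+\frac12}\,\frac{\cos\pi(\nu+\frac12)}{\pi}\int_0^1 t^{b_1+\mu-\frac32}(1-t)^{c_1-b_1+\mu-\frac32}(1-xt)^{-b_2}(1-yt)^{-b_3}\,e^{\frac{-p}{t(1-t)}}\,G^{2,1}_{1,2}\!\left(\frac{2p}{t(1-t)}\,\bigg|\,\begin{array}{c}\frac{2\mu+1}{2}\\ \frac{2\mu+2\nu+1}{2},\,\frac{2\mu-2\nu-1}{2}\end{array}\right)dt;$$ (v) $$F_{1,p,\nu}(b_1,b_2,b_3;c_1;x,y)=C\,\frac{p^{-\mu+\frac12}2^{2\mu-\frac32}}{\pi^{3/2}}\int_0^1 t^{b_1+\mu-\frac32}(1-t)^{c_1-b_1+\mu-\frac32}(1-xt)^{-b_2}(1-yt)^{-b_3}\,G^{4,0}_{0,4}\!\left(\frac{p^4}{(4t)^4(1-t)^4}\,\bigg|\,\begin{array}{c}-\\ \frac{2\mu+2\nu+1}{8},\,\frac{2\mu+2\nu+5}{8},\,\frac{2\mu-2\nu-1}{8},\,\frac{2\mu-2\nu+3}{8}\end{array}\right)dt.$$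
   Context: $K_\alpha$ is the modified Bessel function of the second kind of order $\alpha$. $(\lambda)_n$ is the Pochhammer symbol $\lambda(\lambda+1)\cdots(\lambda+n-1)$, $(\lambda)_0=1$, and $B(\alpha,\beta)=\Gamma(\alpha)\Gamma(\beta)/\Gamma(\alpha+\beta)$. For $\Re(p)>0$, $\nu\ge0$, $$B_{p,\nu}(u,v)=\sqrt{\frac{2p}{\pi}}\int_0^1 t^{u-\frac32}(1-t)^{v-\frac32}K_{\nu+\frac12}\!\left(\frac{p}{t(1-t)}\right)dt .$$ The extended Appell function is defined for $|x|<1$, $|y|<1$ by $$F_{1,p,\nu}(b_1,b_2,b_3;c_1;x,y)=\sum_{m,n=0}^\infty\frac{(b_2)_m(b_3)_n\,B_{p,\nu}(b_1+m+n,c_1-b_1)}{B(b_1,c_1-b_1)}\frac{x^m}{m!}\frac{y^n}{n!},$$ and for $|\arg(1-x)|<\pi$, $|\arg(1-y)|<\pi$, $\Re(c_1)>\Re(b_1)>0$ it is given by the integral $$\frac{\Gamma(c_1)}{\Gamma(b_1)\Gamma(c_1-b_1)}\sqrt{\frac{2p}{\pi}}\int_0^1 t^{b_1-\frac32}(1-t)^{c_1-b_1-\frac32}(1-xt)^{-b_2}(1-yt)^{-b_3}K_{\nu+\frac12}\!\left(\frac{p}{t(1-t)}\right)dt.$$ The Meijer $G$-function is, for nonnegative integers with $1\le M\le Q$, $0\le N\le P\le Q$, $$G^{M,N}_{P,Q}\!\left(z\,\bigg|\,\begin{array}{c}\alpha_1,\dots,\alpha_P\\ \beta_1,\dots,\beta_Q\end{array}\right)=\frac{1}{2\pi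 i}\int_{-i\infty}^{+i\infty}\frac{\prod_{j=1}^M\Gamma(\beta_j-\zeta)\prod_{j=1}^N\Gamma(1-\alpha_j+\zeta)}{\prod_{j=M+1}^Q\Gamma(1-\beta_j+\zeta)\prod_{j=N+1}^P\Gamma(\alpha_j-\zeta)}z^\zeta\,d\zeta,\qquad z\ne0,$$ where, as usual, the contour separates the poles of the $\Gamma(\beta_j-\zeta)$, $1\le j\le M$, from those of the $\Gamma(1-\alpha_j+\zeta)$, $1\le j\le N$. The integral converges for $|\arg z|<\pi\kappa$, where $\kappa=M+N-\frac12(P+Q)$ is supposed positive. A dash denotes an empty list of parameters.
   Formalization: In (iii) the constant is divided by √π (as printed it is off by √π, e.g. for b₂=b₃=0, p>0, real b₁, c₁); (ii) and (iv) are stated for non-integer ν, since for integer ν the poles coincide and G is undefined; in (v) the argument of G is taken with arg equal to 4 arg p. *)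

theory Defs
  imports "HOL-Complex_Analysis.Complex_Analysis"
begin

section \<open>Modified Bessel functions\<close>

definition bessel_I :: "real \<Rightarrow> complex \<Rightarrow> complex" where
  "bessel_I \<alpha> z =
     (\<Sum>k. rGamma (of_real \<alpha> + of_nat k + 1) / fact k * (z / 2) powr (of_real \<alpha> + 2 * of_nat k))"

definition bessel_K_quotient :: "real \<Rightarrow> complex \<Rightarrow> complex" where
  "bessel_K_quotient \<alpha> z =
     of_real (pi / 2) * (bessel_I (- \<alpha>) z - bessel_I \<alpha> z) / of_real (sin (\<alpha> * pi))"

definition bessel_K :: "real \<Rightarrow> complex \<Rightarrow> complex" where
  "bessel_K \<alpha> z =
     (if \<alpha> \<in> \<int> then Lim (at \<alpha>) (\<lambda>a. bessel_K_quotient a z) else bessel_K_quotient \<alpha> z)"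

section \<open>Extended beta and Appell functions\<close>

definition ext_beta :: "complex \<Rightarrow> real \<Rightarrow> complex \<Rightarrow> complex \<Rightarrow> complex" where
  "ext_beta p \<nu> u v = csqrt (2 * p / of_real pi) *
     (LINT t:{0<..<1}|lborel.
        of_real t powr (u - 3/2) * (1 - of_real t) powr (v - 3/2) *
        bessel_K (\<nu> + 1/2) (p / of_real (t * (1 - t))))"

definition ext_appell_F1_series ::
  "complex \<Rightarrow> real \<Rightarrow> complex \<Rightarrow> complex \<Rightarrow> complex \<Rightarrow> complex \<Rightarrow> complex \<Rightarrow> complex \<Rightarrow> complex" where
  "ext_appell_F1_series p \<nu> b1 b2 b3 c1 x y =
     (\<Sum>\<^sub>\<infinity>(m, n)\<in>(UNIV :: (nat \<times> nat) set).
        pochhammer b2 m * pochhammer b3 n * ext_beta p \<nu> (b1 + of_nat m + of_nat n) (c1 - b1) /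
        Beta b1 (c1 - b1) * (x ^ m / fact m) * (y ^ n / fact n))"

definition ext_appell_F1_integral ::
  "complex \<Rightarrow> real \<Rightarrow> complex \<Rightarrow> complex \<Rightarrow> complex \<Rightarrow> complex \<Rightarrow> complex \<Rightarrow> complex \<Rightarrow> complex" where
  "ext_appell_F1_integral p \<nu> b1 b2 b3 c1 x y =
     Gamma c1 / (Gamma b1 * Gamma (c1 - b1)) * csqrt (2 * p / of_real pi) *
     (LINT t:{0<..<1}|lborel.
        of_real t powr (b1 - 3/2) * (1 - of_real t) powr (c1 - b1 - 3/2) *
        (1 - x * of_real t) powr (- b2) * (1 - y * of_real t) powr (- b3) *
        bessel_K (\<nu> + 1/2) (p / of_real (t * (1 - t))))"

text \<open>
  The double series is the definition in the unit bidisc; elsewhere in the domain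
  \<open>|arg (1 - x)| < \<pi>\<close>, \<open>|arg (1 - y)| < \<pi>\<close> the function is given by its Euler-type integral. That
  the two agree inside the bidisc is a theorem, not part of the definition.
\<close>

definition ext_appell_F1 ::
  "complex \<Rightarrow> real \<Rightarrow> complex \<Rightarrow> complex \<Rightarrow> complex \<Rightarrow> complex \<Rightarrow> complex \<Rightarrow> complex \<Rightarrow> complex" where
  "ext_appell_F1 p \<nu> b1 b2 b3 c1 x y =
     (if norm x < 1 \<and> norm y < 1 then ext_appell_F1_series p \<nu> b1 b2 b3 c1 x y
      else ext_appell_F1_integral p \<nu> b1 b2 b3 c1 x y)"

section \<open>The Meijer G-function\<close>

text \<open>
  The parameters \<open>\<alpha>\<^sub>1, \<dots>, \<alpha>\<^sub>P\<close> and \<open>\<beta>\<^sub>1, \<dots>, \<beta>\<^sub>Q\<close> are lists, so \<open>\<alpha>\<^sub>j\<close> is \<open>\<alpha>s ! (j - 1)\<close> and \<open>P\<close>, \<open>Q\<close> are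
  their lengths.

  The Mellin--Barnes integral is meaningful for \<open>|arg z| < \<pi>\<kappa>\<close>, and \<open>\<kappa>\<close> may exceed 1: in general \<open>z\<close>
  is a point of the Riemann surface of the logarithm, and \<open>z\<^sup>\<zeta>\<close> depends on \<open>arg z\<close>, not only on the
  complex number \<open>z\<close>. The function is therefore defined first in terms of \<open>l = log z\<close>, whose imaginary
  part is \<open>arg z\<close>.
\<close>

definition meijer_integrand ::
  "nat \<Rightarrow> nat \<Rightarrow> complex list \<Rightarrow> complex list \<Rightarrow> complex \<Rightarrow> complex \<Rightarrow> complex" where
  "meijer_integrand M N \<alpha>s \<beta>s l \<zeta> =
     (\<Prod>j<M. Gamma (\<beta>s ! j - \<zeta>)) * (\<Prod>j<N. Gamma (1 - \<alpha>s ! j + \<zeta>)) /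
     ((\<Prod>j=M..<length \<beta>s. Gamma (1 - \<beta>s ! j + \<zeta>)) *
      (\<Prod>j=N..<length \<alpha>s. Gamma (\<alpha>s ! j - \<zeta>))) *
     exp (\<zeta> * l)"

definition meijer_poles_\<beta> :: "nat \<Rightarrow> complex list \<Rightarrow> complex set" where
  "meijer_poles_\<beta> M \<beta>s = {\<zeta>. \<exists>j<M. \<beta>s ! j - \<zeta> \<in> \<int>\<^sub>\<le>\<^sub>0}"

definition meijer_poles_\<alpha> :: "nat \<Rightarrow> complex list \<Rightarrow> complex set" where
  "meijer_poles_\<alpha> N \<alpha>s = {\<zeta>. \<exists>j<N. 1 - \<alpha>s ! j + \<zeta> \<in> \<int>\<^sub>\<le>\<^sub>0}"

text \<open>
  A contour from \<open>-\<i>\<infinity>\<close> to \<open>+\<i>\<infinity>\<close> runs along the imaginary axis up to \<open>-\<i>R\<close>, then along a path \<open>g\<close> to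
  \<open>\<i>R\<close>, then along the imaginary axis again. It separates \<open>A\<close> (on its left) from \<open>B\<close> (on its right)
  if, in the complement of the contour, points of \<open>A\<close> can be joined to the far left of the plane and
  points of \<open>B\<close> to the far right. In particular no point of \<open>A\<close> or \<open>B\<close> is on the contour.
\<close>

definition barnes_trace :: "real \<Rightarrow> (real \<Rightarrow> complex) \<Rightarrow> complex set" where
  "barnes_trace R g = path_image g \<union> {z. Re z = 0 \<and> \<bar>Im z\<bar> \<ge> R}"

definition barnes_contour :: "complex set \<Rightarrow> complex set \<Rightarrow> real \<Rightarrow> (real \<Rightarrow> complex) \<Rightarrow> bool" where
  "barnes_contour A B R g \<longleftrightarrow>
     R > 0 \<and> valid_path g \<and> pathstart g = - \<i> * of_real R \<and> pathfinish g = \<i> * of_real R \<and>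
     (\<forall>a\<in>A. \<forall>\<^sub>F X in at_top. connected_component (- barnes_trace R g) a (of_real (- X))) \<and>
     (\<forall>b\<in>B. \<forall>\<^sub>F X in at_top. connected_component (- barnes_trace R g) b (of_real X))"

definition barnes_integral :: "real \<Rightarrow> (real \<Rightarrow> complex) \<Rightarrow> (complex \<Rightarrow> complex) \<Rightarrow> complex" where
  "barnes_integral R g f =
     \<i> * (LINT s:{..-R}|lborel. f (\<i> * of_real s)) + contour_integral g f +
     \<i> * (LINT s:{R..}|lborel. f (\<i> * of_real s))"

text \<open>
  The value does not depend on the contour. If some pole of a \<open>\<Gamma>(\<beta>\<^sub>j - \<zeta>)\<close> is also a pole of a
  \<open>\<Gamma>(1 - \<alpha>\<^sub>k + \<zeta>)\<close>, there is no separating contour and the function is undefined.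
\<close>

definition meijer_G_Log ::
  "nat \<Rightarrow> nat \<Rightarrow> complex list \<Rightarrow> complex list \<Rightarrow> complex \<Rightarrow> complex" where
  "meijer_G_Log M N \<alpha>s \<beta>s l =
     (THE v. \<exists>R g. barnes_contour (meijer_poles_\<alpha> N \<alpha>s) (meijer_poles_\<beta> M \<beta>s) R g \<and>
        v = 1 / (2 * of_real pi * \<i>) * barnes_integral R g (meijer_integrand M N \<alpha>s \<beta>s l))"

definition meijer_G ::
  "nat \<Rightarrow> nat \<Rightarrow> complex list \<Rightarrow> complex list \<Rightarrow> complex \<Rightarrow> complex" where
  "meijer_G M N \<alpha>s \<beta>s z = meijer_G_Log M N \<alpha>s \<beta>s (Ln z)"

text \<open>
  The argument \<open>w\<^sup>n\<close> with \<open>arg (w\<^sup>n) = n arg w\<close> is passed to \<^const>\<open>meijer_G_Log\<close> as \<open>n * Ln w\<close>. As long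
  as \<open>|n arg w| < \<pi>\<close> this is the same as using the principal branch at \<open>w\<^sup>n\<close>.
\<close>

lemma meijer_G_Log_power:
  assumes "w \<noteq> 0" "\<bar>real n * Arg w\<bar> < pi"
  shows "meijer_G_Log M N \<alpha>s \<beta>s (of_nat n * Ln w) = meijer_G M N \<alpha>s \<beta>s (w ^ n)"
proof -
  have "exp (of_nat n * Ln w) = w ^ n"
    using assms(1) by (simp add: exp_of_nat_mult)
  moreover have "Im (of_nat n * Ln w) = real n * Arg w"
    using assms(1) by (simp add: Arg_eq_Im_Ln)
  ultimately have "Ln (w ^ n) = of_nat n * Ln w"
    using assms(2) by (intro Ln_unique) auto
  then show ?thesis
    by (simp add: meijer_G_def)
qed

text \<open>
  For the \<open>G\<^sup>2\<^sup>,\<^sup>1\<close> with these parameters, the two families of poles are disjoint exactly for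
  non-integral \<open>\<nu>\<close>. For \<open>\<nu> \<in> \<nat>\<close> the function is undefined (and \<open>cos (\<pi>(\<nu> + 1/2)) = 0\<close>).
\<close>

lemma meijer_poles_disjoint_iff:
  fixes \<mu> :: complex and \<nu> :: real
  assumes "\<nu> \<ge> 0"
  shows "meijer_poles_\<alpha> 1 [(2*\<mu> + 1)/2] \<inter>
         meijer_poles_\<beta> 2 [(2*\<mu> + 2 * of_real \<nu> + 1)/2, (2*\<mu> - 2 * of_real \<nu> - 1)/2] = {}
         \<longleftrightarrow> \<nu> \<notin> \<nat>" (is "?A \<inter> ?B = {} \<longleftrightarrow> _")
proof -
  have A: "\<zeta> \<in> ?A \<longleftrightarrow> (\<exists>k::nat. \<zeta> = \<mu> - 1/2 - of_nat k)" for \<zeta>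
  proof -
    have "\<zeta> \<in> ?A \<longleftrightarrow> 1 - (2*\<mu> + 1)/2 + \<zeta> \<in> \<int>\<^sub>\<le>\<^sub>0"
      by (simp add: meijer_poles_\<alpha>_def)
    also have "\<dots> \<longleftrightarrow> (\<exists>k::nat. 1 - (2*\<mu> + 1)/2 + \<zeta> = - of_nat k)"
      by (auto elim!: nonpos_Ints_cases')
    also have "\<dots> \<longleftrightarrow> (\<exists>k::nat. \<zeta> = \<mu> - 1/2 - of_nat k)"
      by (intro ex_cong1) (auto simp: field_simps)
    finally show ?thesis .
  qed
  have B: "\<zeta> \<in> ?B \<longleftrightarrow> (\<exists>k::nat. \<zeta> = \<mu> + of_real \<nu> + 1/2 + of_nat k \<or>
                              \<zeta> = \<mu> - of_real \<nu> - 1/2 + of_nat k)" for \<zeta>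
  proof -
    have "\<zeta> \<in> ?B \<longleftrightarrow> (2*\<mu> + 2 * of_real \<nu> + 1)/2 - \<zeta> \<in> \<int>\<^sub>\<le>\<^sub>0 \<or> (2*\<mu> - 2 * of_real \<nu> - 1)/2 - \<zeta> \<in> \<int>\<^sub>\<le>\<^sub>0"
      by (auto simp: meijer_poles_\<beta>_def less_2_cases_iff)
    also have "\<dots> \<longleftrightarrow> (\<exists>k::nat. (2*\<mu> + 2 * of_real \<nu> + 1)/2 - \<zeta> = - of_nat k \<or>
                              (2*\<mu> - 2 * of_real \<nu> - 1)/2 - \<zeta> = - of_nat k)"
      by (auto elim!: nonpos_Ints_cases')
    also have "\<dots> \<longleftrightarrow> (\<exists>k::nat. \<zeta> = \<mu> + of_real \<nu> + 1/2 + of_nat k \<or>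
                              \<zeta> = \<mu> - of_real \<nu> - 1/2 + of_nat k)"
      by (intro ex_cong1) (auto simp: field_simps)
    finally show ?thesis .
  qed
  show ?thesis
  proof
    assume disj: "?A \<inter> ?B = {}"
    show "\<nu> \<notin> \<nat>"
    proof
      assume "\<nu> \<in> \<nat>"
      then obtain n :: nat where n: "\<nu> = of_nat n"
        by (elim Nats_cases)
      have "\<mu> - 1/2 - of_nat n \<in> ?A"
        unfolding A by blast
      moreover have "\<mu> - 1/2 - of_nat n \<in> ?B"
        unfolding B by (intro exI[of _ 0]) (simp add: n)
      ultimately show False
        using disj by blast
    qed
  next
    assume \<nu>: "\<nu> \<notin> \<nat>"
    show "?A \<inter> ?B = {}"
    proof (rule ccontr)
      assume "?A \<inter> ?B \<noteq> {}"
      then obtain j k :: nat where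
        "\<mu> - 1/2 - of_nat j = \<mu> + of_real \<nu> + 1/2 + of_nat k \<or>
         \<mu> - 1/2 - of_nat j = \<mu> - of_real \<nu> - 1/2 + of_nat k"
        unfolding disjoint_iff A B by metis
      then have "- 1/2 - real j = \<nu> + 1/2 + real k \<or> - 1/2 - real j = - \<nu> - 1/2 + real k"
        by (auto simp: complex_eq_iff)
      then have "\<nu> = real (j + k)"
        using assms by auto
      then show False
        using \<nu> by simp
    qed
  qed
qed

end

theory Submission
  imports Defs
begin

text \<open>
  All five integrands are constant multiples of the integrand of the Euler-type integral, because each
  \<open>G\<close>-function is an elementary multiple of \<open>K\<^sub>\<alpha>(z)\<close> with \<open>\<alpha> = \<nu> + 1/2\<close> and \<open>z = p / (t (1 - t))\<close>.
  To evaluate \<open>G\<close>, an arbitrary separating contour is compared with a vertical line: closing both on the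
  right or on the left, the winding numbers around the poles are read off from the separation property,
  and the residue theorem expresses the contour integral by the integral along the line and finitely many
  residues. In particular the value does not depend on the contour. Moving the line to the right gives a residue
  series when all poles are simple; it is the series of \<open>I\<^bsub>-\<alpha>\<^esub> - I\<^bsub>\<alpha>\<^esub>\<close>, up to Kummer's second formula.
  The exceptional \<open>\<alpha>\<close> follow because integrals along a line on the left of the poles are continuous in \<open>\<alpha>\<close>;
  the same integral gives the continuity of \<open>K\<^sub>\<alpha>(z)\<close> and its decay along rays, hence integrability.
\<close>


section \<open>Decay of the Gamma function on vertical lines\<close>

text \<open>The angles are tight. With |arg z| < pi/2, the argument z^2/4 has an angle below pi,
  exactly the total decay rate of two Gamma factors. In the quotient with one Gamma function below,
  the reciprocal costs pi/2 and leaves just pi/2 for arg(2z). Hence every estimate for Gamma is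
  needed with an arbitrarily small loss in the rate. The residues cannot be avoided by a clever
  choice of line: for |\<alpha>| >= 1/2 the two families of poles of G^{2,1} interlace, and no
  vertical line separates them. Double poles occur for integral \<alpha> if the lower parameters
  differ by \<alpha>, and already for integral 2\<alpha> if they differ by 2\<alpha>. Passing to the
  limit in \<alpha> needs a majorant that is uniform in \<alpha>. On a line to the left of all poles
  that come from lower parameters, the arguments of the two Gamma factors keep positive real parts,
  and such a majorant exists. At the ends of the unit interval no exponential asymptotics of K is
  needed: the line may be moved arbitrarily far to the left, which gives decay of every polynomial
  order, enough against any powers of t and 1 - t.\<close>

lemma norm_Gamma_vertical_mono:
  fixes x y t :: real
  assumes "0 < x" "x \<le> y"
  shows "norm (Gamma (Complex x t)) * Gamma y \<le> norm (Gamma (Complex y t)) * Gamma x"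
proof -
  have nrm: "norm (Gamma_series (Complex u t) n) * Gamma_series v n
     = fact n * exp (u * ln n) * (fact n * exp (v * ln n)) *
       (\<Prod>k\<le>n. inverse (norm (Complex (u + k) t)) * inverse (v + real k))" if "u > 0" "v > 0" for u v :: real and n
  proof -
    have "norm (pochhammer (Complex u t) (n+1)) = (\<Prod>k\<le>n. norm (Complex (u + k) t))"
      by (simp add: pochhammer_Suc_prod prod_norm [symmetric] atMost_atLeast0 Complex_eq add_ac del: pochhammer_Suc)
    moreover have "pochhammer v (n+1) = (\<Prod>k\<le>n. v + real k)"
      by (simp add: pochhammer_Suc_prod atMost_atLeast0)
    moreover have "norm (exp (Complex u t * of_real (ln (real n)))) = exp (u * ln n)"
      by simp
    ultimately show ?thesis
      by (simp add: Gamma_series_def norm_divide norm_inverse norm_mult prod.distrib prod_inversef[unfolded o_def] divide_inverse mult_ac del: pochhammer_Suc)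
  qed
  \<comment> \<open>In Euler's limit formula |Gamma(x + it)| / Gamma(x) is a limit of products of
    factors (x + k) / |x + k + it|, each increasing in x. So decay on one vertical line carries over
    to all lines between it and the imaginary axis.\<close>
  have le: "norm (Gamma_series (Complex x t) n) * Gamma_series y n \<le>
        norm (Gamma_series (Complex y t) n) * Gamma_series x n" for n
  proof -
    have "(\<Prod>k\<le>n. inverse (norm (Complex (x + k) t)) * inverse (y + real k)) \<le>
          (\<Prod>k\<le>n. inverse (norm (Complex (y + k) t)) * inverse (x + real k))"
    proof (intro prod_mono conjI)
      fix k :: nat
      define a b where "a = x + real k" and "b = y + real k"
      have ab: "a > 0" "a \<le> b" using assms by (auto simp: a_def b_def)
      have "a * cmod (Complex b t) \<le> b * cmod (Complex a t)"
      proof (rule power2_le_imp_le)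
        have "a\<^sup>2 * t\<^sup>2 \<le> b\<^sup>2 * t\<^sup>2" using ab by (intro mult_right_mono power_mono) auto
        then show "(a * cmod (Complex b t))\<^sup>2 \<le> (b * cmod (Complex a t))\<^sup>2"
          by (simp add: power_mult_distrib cmod_power2 algebra_simps)
      qed (use ab in auto)
      moreover have "cmod (Complex a t) > 0" "cmod (Complex b t) > 0" using ab by (auto simp: complex_eq_iff)
      ultimately show "inverse (norm (Complex (x + k) t)) * inverse (y + real k) \<le>
          inverse (norm (Complex (y + k) t)) * inverse (x + real k)"
        using ab unfolding a_def[symmetric] b_def[symmetric]
        by (simp add: field_simps)
    qed (use assms in auto)
    then show ?thesis using assms
      by (subst (1 2) nrm) (auto intro!: mult_left_mono simp: mult.commute mult.left_commute)
  qed
  have "(\<lambda>n. norm (Gamma_series (Complex x t) n) * Gamma_series y n) \<longlonglongrightarrow> norm (Gamma (Complex x t)) * Gamma y"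
    by (intro tendsto_intros)
  moreover have "(\<lambda>n. norm (Gamma_series (Complex y t) n) * Gamma_series x n) \<longlonglongrightarrow> norm (Gamma (Complex y t)) * Gamma x"
    by (intro tendsto_intros)
  ultimately show ?thesis
    by (rule LIMSEQ_le) (use le in auto)
qed

text \<open>For Re w = 1/2 the point 1 - w is the conjugate of w, so the reflection formula reads
  |Gamma(w)|^2 = pi / cosh(pi t). This line is the source of the rate pi/2 in all later
  bounds.\<close>

lemma norm_Gamma_half_le:
  fixes t :: real
  shows "norm (Gamma (Complex (1/2) t)) \<le> sqrt (2 * pi) * exp (- (pi / 2) * \<bar>t\<bar>)"
proof (rule power2_le_imp_le)
  let ?w = "Complex (1/2) t"
  have cj: "1 - ?w = cnj ?w" by (simp add: complex_eq_iff)
  have gc: "Gamma (cnj ?w) = cnj (Gamma ?w)"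
  proof -
    have "rGamma_series (cnj ?w) = (\<lambda>n. cnj (rGamma_series ?w n))"
    proof
      fix n
      have "cnj (pochhammer ?w (n+1)) = pochhammer (cnj ?w) (n+1)"
        by (simp add: pochhammer_prod)
      then show "rGamma_series (cnj ?w) n = cnj (rGamma_series ?w n)"
        by (simp add: rGamma_series_def exp_cnj del: pochhammer_Suc)
    qed
    then have "(\<lambda>n. cnj (rGamma_series ?w n)) \<longlonglongrightarrow> rGamma (cnj ?w)"
      using rGamma_series_LIMSEQ[of "cnj ?w"] by simp
    moreover have "(\<lambda>n. cnj (rGamma_series ?w n)) \<longlonglongrightarrow> cnj (rGamma ?w)"
      by (intro tendsto_intros)
    ultimately have "rGamma (cnj ?w) = cnj (rGamma ?w)" using LIMSEQ_unique by blast
    then show ?thesis by (simp add: Gamma_def)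
  qed
  have "of_real ((norm (Gamma ?w))\<^sup>2) = Gamma ?w * Gamma (1 - ?w)"
    by (simp only: cj gc complex_norm_square)
  also have "\<dots> = of_real pi / sin (of_real pi * ?w)"
    by (rule Gamma_reflection_complex)
  also have "sin (of_real pi * ?w) = of_real (cosh (pi * t))"
  proof -
    have "of_real pi * ?w = of_real (pi / 2) + \<i> * of_real (pi * t)"
      by (simp add: complex_eq_iff)
    then have "sin (of_real pi * ?w) = cos (\<i> * of_real (pi * t))"
      by (simp only: sin_add sin_of_real cos_of_real) simp
    also have "\<dots> = of_real (cosh (pi * t))"
      by (simp add: cos_exp_eq cosh_def scaleR_conv_of_real add_divide_distrib exp_of_real[symmetric] del: exp_of_real)
    finally show ?thesis .
  qed
  finally have "of_real ((norm (Gamma ?w))\<^sup>2) = complex_of_real (pi / cosh (pi * t))"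
    by simp
  then have "(norm (Gamma ?w))\<^sup>2 = pi / cosh (pi * t)" using of_real_eq_iff by blast
  also have "\<dots> \<le> pi / (exp (pi * \<bar>t\<bar>) / 2)"
    by (intro divide_left_mono) (auto simp: cosh_def abs_if field_simps intro!: add_pos_pos)
  also have "\<dots> = (sqrt (2 * pi) * exp (- (pi / 2) * \<bar>t\<bar>))\<^sup>2"
    by (simp add: power_mult_distrib exp_minus field_simps flip: exp_of_nat_mult)
  finally show "(norm (Gamma ?w))\<^sup>2 \<le> (sqrt (2 * pi) * exp (- (pi / 2) * \<bar>t\<bar>))\<^sup>2" .
qed auto

text \<open>This is x <= exp x at x = \<epsilon> u / (n + 1), raised to the n-th power. Dividing by
  n + 1 instead of n keeps n = 0 legitimate.\<close>

lemma power_le_exp: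
  fixes u \<epsilon> :: real
  assumes "u \<ge> 0" "\<epsilon> > 0"
  shows "u ^ n \<le> (real (Suc n) / \<epsilon>) ^ n * exp (\<epsilon> * u)"
proof -
  let ?N = "real (Suc n)"
  have "\<epsilon> * u / ?N \<le> exp (\<epsilon> * u / ?N)" using exp_ge_add_one_self[of "\<epsilon> * u / ?N"] by linarith
  then have "(\<epsilon> * u / ?N) ^ n \<le> exp (\<epsilon> * u / ?N) ^ n"
    using assms by (intro power_mono) auto
  also have "\<dots> = exp (n * (\<epsilon> * u / ?N))" by (simp only: exp_of_nat_mult)
  also have "\<dots> \<le> exp (\<epsilon> * u)"
    using assms by (simp add: field_simps)
  finally have "(?N / \<epsilon>) ^ n * (\<epsilon> * u / ?N) ^ n \<le> (?N / \<epsilon>) ^ n * exp (\<epsilon> * u)"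
    using assms by (intro mult_left_mono) auto
  then show ?thesis using assms by (simp flip: power_mult_distrib)
qed

text \<open>The bound on Re w = 1/2 is shifted to an abscissa n + 1/2 >= m by the functional
  equation. The Pochhammer product grows polynomially in t and is absorbed by exp(\<epsilon> |t|).
  Monotonicity of |Gamma(x + it)| / Gamma(x) then covers all abscissae from x0 to m.\<close>

lemma norm_Gamma_le_exp_right:
  fixes x0 m \<epsilon> :: real
  assumes "0 < x0" "0 < \<epsilon>"
  shows "\<exists>C>0. \<forall>w. x0 \<le> Re w \<and> Re w \<le> m \<longrightarrow> norm (Gamma w) \<le> C * exp (- (pi/2 - \<epsilon>) * \<bar>Im w\<bar>)"
proof -
  define n where "n = nat \<lceil>m\<rceil>"
  define y where "y = real n + 1/2"
  have y: "m \<le> y" "y > 0" unfolding y_def n_def by linarith+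
  have "compact (Gamma ` {x0..m})"
    using assms by (intro compact_continuous_image continuous_intros) (auto elim!: nonpos_Ints_cases)
  then obtain M where "\<forall>g\<in>Gamma ` {x0..m}. \<bar>g\<bar> \<le> M" "M > 0"
    using compact_imp_bounded[of "Gamma ` {x0..m}"] unfolding bounded_pos real_norm_def by blast
  then have M: "\<And>x. x0 \<le> x \<Longrightarrow> x \<le> m \<Longrightarrow> \<bar>Gamma x\<bar> \<le> M" "M > 0"
    by auto
  define K where "K = (real (Suc n) / \<epsilon>) ^ n * exp (\<epsilon> * n) * sqrt (2 * pi)"
  have K: "norm (Gamma (Complex y t)) \<le> K * exp (- (pi/2 - \<epsilon>) * \<bar>t\<bar>)" for t
  proof -
    let ?h = "Complex (1/2) t"
    have "?h \<notin> \<int>\<^sub>\<le>\<^sub>0" by (auto elim!: nonpos_Ints_cases simp: complex_eq_iff)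
    then have "Gamma (?h + of_nat n) = pochhammer ?h n * Gamma ?h"
      by (simp add: pochhammer_Gamma Gamma_eq_zero_iff)
    moreover have "?h + of_nat n = Complex y t" by (simp add: y_def complex_eq_iff)
    ultimately have "norm (Gamma (Complex y t)) = norm (pochhammer ?h n) * norm (Gamma ?h)"
      by (simp add: norm_mult)
    moreover have "norm (pochhammer ?h n) \<le> (real n + \<bar>t\<bar>) ^ n"
    proof -
      have "norm (pochhammer ?h n) = (\<Prod>k<n. norm (?h + of_nat k))"
        by (simp add: pochhammer_prod prod_norm atLeast0LessThan)
      also have "\<dots> \<le> (\<Prod>k<n. real n + \<bar>t\<bar>)"
      proof (intro prod_mono conjI)
        fix k assume "k \<in> {..<n}"
        then have k: "real k + 1 \<le> n" by auto
        have "norm (?h + of_nat k) \<le> \<bar>1/2 + real k\<bar> + \<bar>t\<bar>"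
          using cmod_le[of "?h + of_nat k"] by simp
        then show "norm (?h + of_nat k) \<le> real n + \<bar>t\<bar>" using k by simp
      qed auto
      finally show ?thesis by simp
    qed
    moreover have "(real n + \<bar>t\<bar>) ^ n \<le> (real (Suc n) / \<epsilon>) ^ n * exp (\<epsilon> * (n + \<bar>t\<bar>))"
      by (rule power_le_exp) (use assms in auto)
    ultimately have "norm (Gamma (Complex y t)) \<le>
        (real (Suc n) / \<epsilon>) ^ n * exp (\<epsilon> * (n + \<bar>t\<bar>)) * (sqrt (2 * pi) * exp (- (pi / 2) * \<bar>t\<bar>))"
      using norm_Gamma_half_le[of t] assms by (auto intro!: mult_mono)
    also have "\<dots> = K * (exp (\<epsilon> * \<bar>t\<bar>) * exp (- (pi / 2) * \<bar>t\<bar>))"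
      by (simp add: K_def distrib_left exp_add mult_ac del: of_nat_Suc)
    also have "exp (\<epsilon> * \<bar>t\<bar>) * exp (- (pi / 2) * \<bar>t\<bar>) = exp (- (pi/2 - \<epsilon>) * \<bar>t\<bar>)"
      by (simp add: algebra_simps flip: exp_add)
    finally show ?thesis .
  qed
  have K0: "K > 0" using assms by (auto simp: K_def intro!: mult_pos_pos)
  have "norm (Gamma w) \<le> (M / Gamma y * K) * exp (- (pi/2 - \<epsilon>) * \<bar>Im w\<bar>)" if "x0 \<le> Re w" "Re w \<le> m" for w
  proof -
    have Gy: "Gamma y > 0" using y by (intro Gamma_real_pos)
    have "norm (Gamma (Complex (Re w) (Im w))) * Gamma y \<le> norm (Gamma (Complex y (Im w))) * Gamma (Re w)"
      using that assms y by (intro norm_Gamma_vertical_mono) auto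
    also have "\<dots> \<le> (K * exp (- (pi/2 - \<epsilon>) * \<bar>Im w\<bar>)) * M"
      using that M(1)[of "Re w"] Gamma_real_pos[of "Re w"] assms K0 by (intro mult_mono K) auto
    finally show ?thesis using Gy by (simp add: field_simps)
  qed
  moreover have "M / Gamma y * K > 0" using K0 M Gamma_real_pos[OF y(2)] by simp
  ultimately show ?thesis by blast
qed

text \<open>Translating by a large k leads into Re >= 1. For |Im w| >= 1 every factor w + j of the
  functional equation has modulus at least 1, so |Gamma(w)| <= |Gamma(w + k)|.\<close>

lemma norm_Gamma_le_exp_strip:
  fixes m \<epsilon> :: real
  assumes "0 < \<epsilon>"
  shows "\<exists>C>0. \<forall>w. \<bar>Re w\<bar> \<le> m \<and> 1 \<le> \<bar>Im w\<bar> \<longrightarrow> norm (Gamma w) \<le> C * exp (- (pi/2 - \<epsilon>) * \<bar>Im w\<bar>)"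
proof -
  define k where "k = nat \<lceil>m\<rceil> + 1"
  have k: "1 \<le> k - m" unfolding k_def by linarith
  obtain C where C: "C > 0" "\<And>w. 1 \<le> Re w \<Longrightarrow> Re w \<le> m + k \<Longrightarrow> norm (Gamma w) \<le> C * exp (- (pi/2 - \<epsilon>) * \<bar>Im w\<bar>)"
    using norm_Gamma_le_exp_right[of 1 \<epsilon> "m + k"] assms by auto
  have "norm (Gamma w) \<le> C * exp (- (pi/2 - \<epsilon>) * \<bar>Im w\<bar>)" if w: "\<bar>Re w\<bar> \<le> m" "1 \<le> \<bar>Im w\<bar>" for w
  proof -
    have "w \<notin> \<int>\<^sub>\<le>\<^sub>0" using w by (auto elim!: nonpos_Ints_cases)
    then have "Gamma (w + of_nat k) = pochhammer w k * Gamma w"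
      by (simp add: pochhammer_Gamma Gamma_eq_zero_iff)
    moreover have "1 \<le> norm (pochhammer w k)"
    proof -
      have "(\<Prod>j<k. 1) \<le> (\<Prod>j<k. norm (w + of_nat j))"
        using w abs_Im_le_cmod[of "w + of_nat _"] by (intro prod_mono) (auto intro: order_trans)
      then show ?thesis by (simp add: pochhammer_prod prod_norm atLeast0LessThan)
    qed
    ultimately have "norm (Gamma w) \<le> norm (Gamma (w + of_nat k))"
      by (simp add: norm_mult mult_le_cancel_right1)
    also have "\<dots> \<le> C * exp (- (pi/2 - \<epsilon>) * \<bar>Im (w + of_nat k)\<bar>)"
      using w k by (intro C(2)) auto
    finally show ?thesis by simp
  qed
  then show ?thesis using C(1) by blast
qed

lemma norm_sin_pi_le: "norm (sin (of_real pi * w)) \<le> exp (pi * \<bar>Im w\<bar>)"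
proof -
  have "norm (sin (of_real pi * w)) = norm (exp (\<i> * (of_real pi * w)) - exp (- (\<i> * (of_real pi * w)))) / 2"
    by (simp add: sin_exp_eq norm_divide norm_mult)
  also have "\<dots> \<le> (norm (exp (\<i> * (of_real pi * w))) + norm (exp (- (\<i> * (of_real pi * w))))) / 2"
    by (intro divide_right_mono norm_triangle_ineq4) auto
  also have "\<dots> \<le> (exp (pi * \<bar>Im w\<bar>) + exp (pi * \<bar>Im w\<bar>)) / 2"
    by (intro divide_right_mono add_mono) (auto simp: abs_if)
  finally show ?thesis by simp
qed

text \<open>Away from the real axis 1/Gamma(w) = Gamma(1 - w) sin(pi w) / pi, where the sine grows
  with rate pi and Gamma decays with a rate close to pi/2. Near the axis 1/Gamma is continuous on a
  compact rectangle.\<close>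

lemma norm_rGamma_le_exp_strip:
  fixes m \<epsilon> :: real
  assumes "0 < \<epsilon>"
  shows "\<exists>C>0. \<forall>w. \<bar>Re w\<bar> \<le> m \<longrightarrow> norm (rGamma w) \<le> C * exp ((pi/2 + \<epsilon>) * \<bar>Im w\<bar>)"
proof -
  obtain C where C: "C > 0" "\<And>w. \<bar>Re w\<bar> \<le> m + 1 \<Longrightarrow> 1 \<le> \<bar>Im w\<bar> \<Longrightarrow> norm (Gamma w) \<le> C * exp (- (pi/2 - \<epsilon>) * \<bar>Im w\<bar>)"
    using norm_Gamma_le_exp_strip[of \<epsilon> "m + 1"] assms by auto
  have "compact (rGamma ` (cbox (Complex (-m) (-1)) (Complex m 1)))"
    by (intro compact_continuous_image continuous_intros) auto
  then obtain M where "\<forall>g\<in>rGamma ` cbox (Complex (-m) (-1)) (Complex m 1). norm g \<le> M" "M > 0"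
    using compact_imp_bounded[of "rGamma ` cbox (Complex (-m) (-1)) (Complex m 1)"] unfolding bounded_pos by blast
  then have M: "\<And>x. x \<in> cbox (Complex (-m) (-1)) (Complex m 1) \<Longrightarrow> norm (rGamma x) \<le> M" "M > 0"
    by auto
  have "norm (rGamma w) \<le> (C + M) * exp ((pi/2 + \<epsilon>) * \<bar>Im w\<bar>)" if w: "\<bar>Re w\<bar> \<le> m" for w
  proof (cases "1 \<le> \<bar>Im w\<bar>")
    case True
    have "w \<notin> \<int>\<^sub>\<le>\<^sub>0" using True by (auto elim!: nonpos_Ints_cases)
    then have G: "Gamma w \<noteq> 0" by (simp add: Gamma_eq_zero_iff)
    have "Im (of_real pi * w) \<noteq> 0" using True by auto
    then have s: "sin (of_real pi * w) \<noteq> 0"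
      by (auto simp: sin_eq_0)
    have "rGamma w = Gamma (1 - w) * sin (of_real pi * w) / of_real pi"
      using Gamma_reflection_complex[of w] G s by (simp add: rGamma_inverse_Gamma field_simps)
    then have "norm (rGamma w) = norm (Gamma (1 - w)) * norm (sin (of_real pi * w)) / pi"
      by (simp add: norm_mult norm_divide)
    also have "\<dots> \<le> norm (Gamma (1 - w)) * norm (sin (of_real pi * w)) / 1"
      using pi_gt3 by (intro divide_left_mono) auto
    also have "\<dots> \<le> (C * exp (- (pi/2 - \<epsilon>) * \<bar>Im (1 - w)\<bar>)) * exp (pi * \<bar>Im w\<bar>)"
      using w True C(1) by (simp del: Re_divide) (intro mult_mono order.trans[OF C(2)] norm_sin_pi_le; auto)
    also have "\<dots> = C * exp ((pi/2 + \<epsilon>) * \<bar>Im w\<bar>)"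
      by (simp add: algebra_simps flip: exp_add)
    also have "\<dots> \<le> (C + M) * exp ((pi/2 + \<epsilon>) * \<bar>Im w\<bar>)"
      using M by (intro mult_right_mono) auto
    finally show ?thesis .
  next
    case False
    then have "norm (rGamma w) \<le> M * 1"
      using w by (simp, intro M(1)) (auto simp: in_cbox_complex_iff)
    also have "\<dots> \<le> (C + M) * exp ((pi/2 + \<epsilon>) * \<bar>Im w\<bar>)"
      using M C(1) assms by (intro mult_mono) (auto intro!: add_nonneg_nonneg mult_nonneg_nonneg)
    finally show ?thesis .
  qed
  then show ?thesis using C(1) M(2) by (intro exI[of _ "C + M"]) auto
qed

section \<open>Winding numbers of Barnes contours\<close>

text \<open>The closed triangle through a, b, c stays in a convex set that misses z, hence does not
  wind around z.\<close>

lemma winding_number_linepath_sum_convex: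
  assumes "convex S" "a \<in> S" "b \<in> S" "c \<in> S" "z \<notin> S"
  shows "winding_number (linepath a b) z + winding_number (linepath b c) z = winding_number (linepath a c) z"
proof -
  have sub: "closed_segment u v \<subseteq> S" if "u \<in> S" "v \<in> S" for u v
    using that assms(1) by (simp add: closed_segment_subset)
  have n: "z \<notin> closed_segment a b" "z \<notin> closed_segment b c" "z \<notin> closed_segment c a" "z \<notin> closed_segment a c"
    using sub assms by blast+
  have "winding_number (linepath a b +++ linepath b c +++ linepath c a) z = 0"
    using sub assms by (intro winding_number_zero_outside[where s = S])
      (auto simp: path_image_join)
  then have "winding_number (linepath a b) z + (winding_number (linepath b c) z + winding_number (linepath c a) z) = 0"
    using n by (simp add: winding_number_join path_image_join)
  moreover have "winding_number (linepath a c) z = - winding_number (linepath c a) z"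
    using winding_number_reversepath[of "linepath c a" z] n by simp
  ultimately show ?thesis by (simp add: add_eq_0_iff2)
qed

text \<open>The part of the contour between the heights -T and T, closed by the line Re = D
  traversed downwards. D may have either sign: for large positive D the loop runs clockwise around
  the region on the right of the contour, for large negative D counterclockwise around the region on
  its left.\<close>

definition barnes_loop :: "real \<Rightarrow> (real \<Rightarrow> complex) \<Rightarrow> real \<Rightarrow> real \<Rightarrow> real \<Rightarrow> complex" where
  "barnes_loop R g T D =
     linepath (Complex 0 (-T)) (Complex 0 (-R)) +++ g +++ linepath (Complex 0 R) (Complex 0 T) +++
     linepath (Complex 0 T) (Complex D T) +++ linepath (Complex D T) (Complex D (-T)) +++
     linepath (Complex D (-T)) (Complex 0 (-T))"

locale barnes_path =
  fixes R :: real and g :: "real \<Rightarrow> complex"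
  assumes R_pos: "R > 0" and vpg: "valid_path g"
    and psg: "pathstart g = Complex 0 (-R)" and pfg: "pathfinish g = Complex 0 R"
begin

lemma path_g: "path g"
  using vpg by (rule valid_path_imp_path)

lemma valid_path_barnes_loop: "valid_path (barnes_loop R g T D)"
  and pathstart_barnes_loop: "pathstart (barnes_loop R g T D) = Complex 0 (-T)"
  and pathfinish_barnes_loop: "pathfinish (barnes_loop R g T D) = Complex 0 (-T)"
  by (simp_all add: barnes_loop_def vpg psg pfg)

lemma path_image_barnes_loop:
  "path_image (barnes_loop R g T D) =
     closed_segment (Complex 0 (-T)) (Complex 0 (-R)) \<union> path_image g \<union>
     closed_segment (Complex 0 R) (Complex 0 T) \<union> closed_segment (Complex 0 T) (Complex D T) \<union>
     closed_segment (Complex D T) (Complex D (-T)) \<union> closed_segment (Complex D (-T)) (Complex 0 (-T))"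
  by (auto simp: barnes_loop_def psg pfg path_image_join)

lemma winding_number_barnes_loop:
  assumes "z \<notin> path_image (barnes_loop R g T D)"
  shows "winding_number (barnes_loop R g T D) z =
     winding_number (linepath (Complex 0 (-T)) (Complex 0 (-R))) z + winding_number g z +
     winding_number (linepath (Complex 0 R) (Complex 0 T)) z + winding_number (linepath (Complex 0 T) (Complex D T)) z +
     winding_number (linepath (Complex D T) (Complex D (-T))) z + winding_number (linepath (Complex D (-T)) (Complex 0 (-T))) z"
  using assms unfolding path_image_barnes_loop
  by (simp add: barnes_loop_def psg pfg path_image_join winding_number_join path_g)

lemma path_image_barnes_loop_subset:
  assumes "R \<le> T"
  shows "path_image (barnes_loop R g T D) \<subseteq> barnes_trace R g \<union>
    {z. \<bar>Im z\<bar> = T \<and> Re z \<in> closed_segment 0 D} \<union> {z. Re z = D \<and> \<bar>Im z\<bar> \<le> T}"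
  using assms R_pos unfolding path_image_barnes_loop barnes_trace_def
  by (auto simp: closed_segment_same_Re closed_segment_same_Im closed_segment_eq_real_ivl split: if_splits)

text \<open>The two loops differ by the boundary of the rectangle between Re = d and Re = D: the
  horizontal sides add up along their common lines, and the two passages of the side at D
  cancel.\<close>

lemma winding_number_barnes_loop_shift:
  assumes "R \<le> T" "d < D" "z \<notin> barnes_trace R g" "\<bar>Im z\<bar> < T" "Re z \<noteq> d" "Re z \<noteq> D"
  shows "winding_number (barnes_loop R g T d) z =
         winding_number (barnes_loop R g T D) z + winding_number (rectpath (Complex d (-T)) (Complex D T)) z"
proof -
  have T: "T > 0" using R_pos assms by linarith
  let ?w = "\<lambda>a b. winding_number (linepath a b) z"
  have "z \<notin> path_image (barnes_loop R g T d)" "z \<notin> path_image (barnes_loop R g T D)"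
    using assms path_image_barnes_loop_subset[OF assms(1)] by fastforce+
  note w = winding_number_barnes_loop[OF this(1)] winding_number_barnes_loop[OF this(2)]
  have n: "z \<notin> closed_segment (Complex d (-T)) (Complex D (-T))" "z \<notin> closed_segment (Complex D (-T)) (Complex D T)"
      "z \<notin> closed_segment (Complex D T) (Complex d T)" "z \<notin> closed_segment (Complex d T) (Complex d (-T))"
    using assms by (auto simp: closed_segment_same_Re closed_segment_same_Im)
  have r: "winding_number (rectpath (Complex d (-T)) (Complex D T)) z =
      ?w (Complex d (-T)) (Complex D (-T)) + ?w (Complex D (-T)) (Complex D T) +
      ?w (Complex D T) (Complex d T) + ?w (Complex d T) (Complex d (-T))"
    using n by (simp add: rectpath_def Let_def winding_number_join path_image_join)
  have t1: "?w (Complex 0 T) (Complex D T) + ?w (Complex D T) (Complex d T) = ?w (Complex 0 T) (Complex d T)"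
    using assms by (intro winding_number_linepath_sum_convex[where S = "{w. Im w = T}"])
      (auto intro: convex_hyperplane[of \<i>, simplified] simp: convex_def algebra_simps simp flip: distrib_right)
  have t2: "?w (Complex d (-T)) (Complex D (-T)) + ?w (Complex D (-T)) (Complex 0 (-T)) = ?w (Complex d (-T)) (Complex 0 (-T))"
    using assms by (intro winding_number_linepath_sum_convex[where S = "{w. Im w = -T}"])
      (auto simp: convex_def algebra_simps simp flip: distrib_right)
  have t3: "?w (Complex D T) (Complex D (-T)) = - ?w (Complex D (-T)) (Complex D T)"
    using winding_number_reversepath[of "linepath (Complex D (-T)) (Complex D T)" z] n by simp
  show ?thesis unfolding w r t1[symmetric] t2[symmetric] t3 by simp
qed

lemma open_trace_complement: "open (- barnes_trace R g)"
proof -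
  have "closed {z. Re z = 0 \<and> R \<le> \<bar>Im z\<bar>}"
    by (intro closed_Collect_conj closed_Collect_eq closed_Collect_le continuous_intros)
  then show ?thesis
    unfolding barnes_trace_def using path_g by (simp add: closed_path_image open_Compl open_Int)
qed

text \<open>With \<open>\<sigma> = 1\<close> the loop is closed on the right and \<open>z\<close> is on the left of the contour; \<open>\<sigma> = -1\<close> is the mirror image.\<close>

lemma winding_number_barnes_loop_zero:
  fixes \<sigma> :: real
  assumes \<sigma>: "\<sigma> = 1 \<or> \<sigma> = -1"
    and ev: "\<forall>\<^sub>F X in at_top. connected_component (- barnes_trace R g) z (of_real (- \<sigma> * X))"
  shows "\<exists>M\<ge>R. \<bar>Re z\<bar> < M \<and> \<bar>Im z\<bar> < M \<and> (\<forall>T D. M \<le> T \<longrightarrow> M \<le> \<sigma> * D \<longrightarrow> winding_number (barnes_loop R g T D) z = 0)"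
proof -
  have "bounded (path_image g)" by (simp add: path_g bounded_path_image)
  then obtain Mg where Mg: "\<And>w. w \<in> path_image g \<Longrightarrow> norm w \<le> Mg"
    by (auto simp: bounded_iff)
  obtain X0 where X0: "\<And>X. X \<ge> X0 \<Longrightarrow> connected_component (- barnes_trace R g) z (of_real (- \<sigma> * X))"
    using ev by (auto simp: eventually_at_top_linorder)
  \<comment> \<open>Far enough out that the point -\<sigma> X lies beyond a half-plane containing
    every loop closed on the other side. The loop cannot wind around such a point.\<close>
  define X where "X = max X0 (\<bar>Mg\<bar> + R + 1)"
  have "connected_component (- barnes_trace R g) z (of_real (- \<sigma> * X))"
    by (rule X0) (simp add: X_def)
  then have "path_component (- barnes_trace R g) z (of_real (- \<sigma> * X))"
    by (simp add: path_component_eq_connected_component_set open_path_connected_component open_trace_complement)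
  then obtain q where q: "path q" "path_image q \<subseteq> - barnes_trace R g" "pathstart q = z" "pathfinish q = of_real (- \<sigma> * X)"
    unfolding path_component_def by blast
  have "bounded (path_image q)" by (simp add: q bounded_path_image)
  then obtain Mq where Mq: "\<And>w. w \<in> path_image q \<Longrightarrow> norm w \<le> Mq"
    by (auto simp: bounded_iff)
  \<comment> \<open>\<open>M\<close> exceeds every modulus on the path \<open>q\<close> from z to
    the far point. The closing sides of the loop have distance at least \<open>M\<close> from 0, and
    \<open>q\<close> avoids the trace of the contour, so the winding number is constant along
    \<open>q\<close>.\<close>
  define M where "M = max (\<bar>Mq\<bar> + 1) (max (\<bar>Mg\<bar> + 1) R)"
  have zq: "z \<in> path_image q" "of_real (- \<sigma> * X) \<in> path_image q" using q pathstart_in_path_image[of q] pathfinish_in_path_image[of q] by simp_all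
  have zM: "norm z < M" using Mq[OF zq(1)] by (simp add: M_def)
  have "winding_number (barnes_loop R g T D) z = 0" if TD: "M \<le> T" "M \<le> \<sigma> * D" for T D
  proof -
    have RT: "R \<le> T" using TD by (simp add: M_def)
    have D: "\<bar>D\<bar> = \<sigma> * D" "\<bar>D\<bar> \<ge> M" "M > 0" using \<sigma> TD by (auto simp: M_def)
    have im: "w \<in> barnes_trace R g \<or> M \<le> norm w" if w: "w \<in> path_image (barnes_loop R g T D)" for w
    proof -
      consider "w \<in> barnes_trace R g" | "\<bar>Im w\<bar> = T" | "\<bar>Re w\<bar> = \<bar>D\<bar>"
        using subsetD[OF path_image_barnes_loop_subset[OF RT, of D] w] by auto
      then show ?thesis
        using abs_Re_le_cmod[of w] abs_Im_le_cmod[of w] TD D by cases auto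
    qed
    have disj: "path_image q \<inter> path_image (barnes_loop R g T D) = {}"
    proof (intro equals0I)
      fix w assume w: "w \<in> path_image q \<inter> path_image (barnes_loop R g T D)"
      then have "norm w < M" using Mq[of w] by (simp add: M_def)
      then show False using im[of w] w q(2) by auto
    qed
    have "winding_number (barnes_loop R g T D) z = winding_number (barnes_loop R g T D) (of_real (- \<sigma> * X))"
      using disj zq q(1)
      by (intro winding_number_eq[where S = "path_image q"])
         (auto simp: valid_path_barnes_loop valid_path_imp_path pathstart_barnes_loop pathfinish_barnes_loop)
    also have "\<dots> = 0"
    proof (rule winding_number_zero_outside[where s = "{w. \<sigma> * Re w \<ge> - (\<bar>Mg\<bar> + R)}"])
      show "convex {w. \<sigma> * Re w \<ge> - (\<bar>Mg\<bar> + R)}"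
        using convex_halfspace_ge[of "- (\<bar>Mg\<bar> + R)" "of_real \<sigma> :: complex"] by (simp add: inner_complex_def)
      have "X > \<bar>Mg\<bar> + R" by (auto simp: X_def)
      then show "of_real (- \<sigma> * X) \<notin> {w. \<sigma> * Re w \<ge> - (\<bar>Mg\<bar> + R)}"
        using \<sigma> by auto
      show "path_image (barnes_loop R g T D) \<subseteq> {w. \<sigma> * Re w \<ge> - (\<bar>Mg\<bar> + R)}"
      proof
        fix w assume "w \<in> path_image (barnes_loop R g T D)"
        then consider "w \<in> path_image g" | "Re w = 0" | "Re w \<in> closed_segment 0 D"
          using path_image_barnes_loop_subset[OF RT, of D] by (auto simp: barnes_trace_def)
        then have "\<sigma> * Re w \<ge> - (\<bar>Mg\<bar> + R)"
        proof cases
          case 1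
          then have "\<bar>Re w\<bar> \<le> Mg" using Mg[of w] abs_Re_le_cmod[of w] by linarith
          then show ?thesis using \<sigma> R_pos by auto
        next
          case 3
          then have "\<sigma> * Re w \<ge> 0" using \<sigma> D
            by (auto simp: closed_segment_eq_real_ivl split: if_splits)
          then show ?thesis using R_pos by linarith
        qed (use R_pos in auto)
        then show "w \<in> {w. \<sigma> * Re w \<ge> - (\<bar>Mg\<bar> + R)}" by simp
      qed
    qed (auto simp: valid_path_barnes_loop valid_path_imp_path pathstart_barnes_loop pathfinish_barnes_loop)
    finally show ?thesis .
  qed
  moreover have "\<bar>Re z\<bar> < M" "\<bar>Im z\<bar> < M"
    using zM abs_Re_le_cmod[of z] abs_Im_le_cmod[of z] by linarith+
  moreover have "M \<ge> R" by (simp add: M_def)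
  ultimately show ?thesis by blast
qed

lemma trace_imp_component:
  fixes f :: "real \<Rightarrow> complex"
  assumes "\<forall>\<^sub>F X in at_top. connected_component (- barnes_trace R g) z (f X)"
  shows "z \<notin> barnes_trace R g"
proof -
  have "\<exists>X::real. connected_component (- barnes_trace R g) z (f X)"
    using assms eventually_happens[OF assms] by simp
  then show ?thesis using connected_component_in by fastforce
qed

text \<open>Closed on the far right, the loop does not wind around a point on the left of the
  contour. Moving the closing line to d adds a rectangle that surrounds z exactly if d < Re
  z.\<close>

lemma winding_number_barnes_loop_left:
  assumes "\<forall>\<^sub>F X in at_top. connected_component (- barnes_trace R g) z (of_real (- X))" "Re z \<noteq> d"
  shows "\<forall>\<^sub>F T in at_top. winding_number (barnes_loop R g T d) z = (if Re z < d then 0 else 1)"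
proof -
  obtain M where M: "M \<ge> R" "\<bar>Re z\<bar> < M" "\<bar>Im z\<bar> < M"
      "\<And>T D. M \<le> T \<Longrightarrow> M \<le> D \<Longrightarrow> winding_number (barnes_loop R g T D) z = 0"
    using winding_number_barnes_loop_zero[of 1 z] assms(1) by auto
  define D where "D = max M (\<bar>d\<bar> + 1)"
  have D: "D > d" "D \<ge> M" by (auto simp: D_def)
  have "winding_number (barnes_loop R g T d) z = (if Re z < d then 0 else 1)" if "T \<ge> M" for T
  proof -
    have "winding_number (barnes_loop R g T d) z = winding_number (rectpath (Complex d (-T)) (Complex D T)) z"
      using winding_number_barnes_loop_shift[of T d D z] M D that trace_imp_component[OF assms(1)] assms(2) by auto
    also have "\<dots> = (if Re z < d then 0 else 1)"
      using that assms(2) M D by (auto intro!: winding_number_rectpath winding_number_rectpath_outside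
          simp: in_box_complex_iff in_cbox_complex_iff)
    finally show ?thesis .
  qed
  then show ?thesis unfolding eventually_at_top_linorder by blast
qed

text \<open>Mirror image of the previous lemma: here the loop closed on the far left has winding
  number 0, and it is the loop at d plus a rectangle. That is where the sign -1 comes from.\<close>

lemma winding_number_barnes_loop_right:
  assumes "\<forall>\<^sub>F X in at_top. connected_component (- barnes_trace R g) z (of_real X)" "Re z \<noteq> d"
  shows "\<forall>\<^sub>F T in at_top. winding_number (barnes_loop R g T d) z = (if Re z < d then - 1 else 0)"
proof -
  obtain M where M: "M \<ge> R" "\<bar>Re z\<bar> < M" "\<bar>Im z\<bar> < M"
      "\<And>T D. M \<le> T \<Longrightarrow> M \<le> -1 * D \<Longrightarrow> winding_number (barnes_loop R g T D) z = 0"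
    using winding_number_barnes_loop_zero[of "-1" z] assms(1) by auto
  define D where "D = - max M (\<bar>d\<bar> + 1)"
  have D: "D < d" "- D \<ge> M" by (auto simp: D_def)
  have "winding_number (barnes_loop R g T d) z = (if Re z < d then - 1 else 0)" if "T \<ge> M" for T
  proof -
    have "0 = winding_number (barnes_loop R g T d) z + winding_number (rectpath (Complex D (-T)) (Complex d T)) z"
      using winding_number_barnes_loop_shift[of T D d z] M D that trace_imp_component[OF assms(1)] assms(2) by auto
    moreover have "winding_number (rectpath (Complex D (-T)) (Complex d T)) z = (if Re z < d then 1 else 0)"
      using that assms(2) M D by (auto intro!: winding_number_rectpath winding_number_rectpath_outside
          simp: in_box_complex_iff in_cbox_complex_iff)
    ultimately show ?thesis by (auto simp: add_eq_0_iff2 split: if_splits)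
  qed
  then show ?thesis unfolding eventually_at_top_linorder by blast
qed

end

section \<open>Barnes integrals and residues\<close>

lemma integrable_exp_minus_abs:
  fixes \<delta> :: real
  assumes "\<delta> > 0"
  shows "integrable lborel (\<lambda>t. exp (- \<delta> * \<bar>t\<bar>))"
proof -
  have "(\<lambda>x. exp (- \<delta> * x)) integrable_on {0..}"
    using integrable_on_exp_minus_to_infinity[OF assms] by simp
  then have "(\<lambda>x. exp (- \<delta> * x)) absolutely_integrable_on {0..}"
    by (rule nonnegative_absolutely_integrable_1) auto
  then have i: "integrable lborel (\<lambda>x. indicat_real {0..} x * exp (- \<delta> * x))"
    unfolding set_integrable_def by (subst (asm) integrable_completion) auto
  then have "integrable lborel (\<lambda>x. indicat_real {0..} (0 + (-1) * x) * exp (- \<delta> * (0 + (-1) * x)))"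
    by (intro lborel_integrable_real_affine) auto
  from Bochner_Integration.integrable_add[OF i this] show ?thesis
    by (rule Bochner_Integration.integrable_bound) (auto intro!: AE_I2 simp: indicator_def)
qed

text \<open>Only large |Im| is restricted, so poles at bounded height are allowed. The condition
  makes integrals along vertical lines converge and lets the horizontal sides of the loops vanish in
  the limit.\<close>

definition strip_decay :: "(complex \<Rightarrow> complex) \<Rightarrow> bool" where
  "strip_decay f \<longleftrightarrow> (\<forall>m. \<exists>C \<delta> T. 0 < \<delta> \<and>
     (\<forall>\<zeta>. \<bar>Re \<zeta>\<bar> \<le> m \<and> T \<le> \<bar>Im \<zeta>\<bar> \<longrightarrow> norm (f \<zeta>) \<le> C * exp (- \<delta> * \<bar>Im \<zeta>\<bar>)))"

lemma set_integrable_vertical: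
  assumes "strip_decay f" "closed S" "continuous_on S (\<lambda>t. f (Complex d t))"
  shows "set_integrable lborel S (\<lambda>t. f (Complex d t))"
proof -
  obtain C \<delta> T where C: "0 < \<delta>" "\<And>\<zeta>. \<bar>Re \<zeta>\<bar> \<le> \<bar>d\<bar> \<Longrightarrow> T \<le> \<bar>Im \<zeta>\<bar> \<Longrightarrow> norm (f \<zeta>) \<le> C * exp (- \<delta> * \<bar>Im \<zeta>\<bar>)"
    using assms(1) unfolding strip_decay_def by blast
  have "compact ((\<lambda>t. f (Complex d t)) ` (S \<inter> {-T..T}))"
    using assms(2,3) by (intro compact_continuous_image) (auto intro: continuous_on_subset closed_Int_compact)
  from compact_imp_bounded[OF this] obtain M where M: "\<And>t. t \<in> S \<Longrightarrow> \<bar>t\<bar> \<le> T \<Longrightarrow> norm (f (Complex d t)) \<le> M"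
    by (fastforce simp: bounded_iff)
  define K where "K = \<bar>C\<bar> + \<bar>M\<bar> * exp (\<delta> * T)"
  have "norm (f (Complex d t)) \<le> K * exp (- \<delta> * \<bar>t\<bar>)" if "t \<in> S" for t
  proof (cases "T \<le> \<bar>t\<bar>")
    case True
    then have "norm (f (Complex d t)) \<le> C * exp (- \<delta> * \<bar>t\<bar>)" using C(2)[of "Complex d t"] by simp
    also have "C \<le> K" using abs_ge_self[of C] by (simp add: K_def add_increasing2)
    then have "C * exp (- \<delta> * \<bar>t\<bar>) \<le> K * exp (- \<delta> * \<bar>t\<bar>)" by (intro mult_right_mono) auto
    finally show ?thesis .
  next
    case False
    then have "norm (f (Complex d t)) \<le> \<bar>M\<bar> * 1" using M[of t] that by auto
    also have "\<dots> \<le> \<bar>M\<bar> * exp (\<delta> * T - \<delta> * \<bar>t\<bar>)"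
      using False C(1) by (intro mult_left_mono) auto
    also have "\<dots> \<le> K * exp (- \<delta> * \<bar>t\<bar>)" by (simp add: K_def exp_diff exp_minus field_simps)
    finally show ?thesis .
  qed
  moreover have "K \<ge> 0" by (simp add: K_def)
  ultimately have bnd: "norm (indicat_real S t *\<^sub>R f (Complex d t)) \<le> norm (K * exp (- \<delta> * \<bar>t\<bar>))" for t
    by (auto simp: indicator_def)
  have int: "integrable lborel (\<lambda>t. K * exp (- \<delta> * \<bar>t\<bar>))"
    by (intro integrable_mult_right integrable_exp_minus_abs C)
  have "(\<lambda>t. indicat_real S t *\<^sub>R f (Complex d t)) \<in> borel_measurable lborel"
    using borel_measurable_continuous_on_indicator[OF _ assms(3)] assms(2) by simp
  from Bochner_Integration.integrable_bound[OF int this AE_I2[OF bnd]] show ?thesis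
    unfolding set_integrable_def .
qed

lemma contour_integral_horizontal_tendsto_0:
  fixes \<sigma> :: real
  assumes "strip_decay f" "\<sigma> = 1 \<or> \<sigma> = -1" "continuous_on {\<zeta>. H < \<bar>Im \<zeta>\<bar>} f"
  shows "((\<lambda>T. contour_integral (linepath (Complex a (\<sigma> * T)) (Complex b (\<sigma> * T))) f) \<longlongrightarrow> 0) at_top"
proof -
  define m where "m = max \<bar>a\<bar> \<bar>b\<bar>"
  obtain C \<delta> T0 where C: "0 < \<delta>" "\<And>\<zeta>. \<bar>Re \<zeta>\<bar> \<le> m \<Longrightarrow> T0 \<le> \<bar>Im \<zeta>\<bar> \<Longrightarrow> norm (f \<zeta>) \<le> C * exp (- \<delta> * \<bar>Im \<zeta>\<bar>)"
    using assms(1) unfolding strip_decay_def by blast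
  have b: "norm (contour_integral (linepath (Complex a (\<sigma> * T)) (Complex b (\<sigma> * T))) f) \<le> \<bar>C\<bar> * exp (- \<delta> * T) * \<bar>b - a\<bar>"
    if T: "T > max 0 (max T0 H)" for T
  proof -
    have "closed_segment (Complex a (\<sigma> * T)) (Complex b (\<sigma> * T)) \<subseteq> {\<zeta>. \<bar>Im \<zeta>\<bar> = T \<and> \<bar>Re \<zeta>\<bar> \<le> m}"
      using assms(2) T by (auto simp: closed_segment_same_Im closed_segment_eq_real_ivl m_def split: if_splits)
    note sub = subsetD[OF this]
    have "norm (contour_integral (linepath (Complex a (\<sigma> * T)) (Complex b (\<sigma> * T))) f) \<le>
        (\<bar>C\<bar> * exp (- \<delta> * T)) * cmod (Complex b (\<sigma> * T) - Complex a (\<sigma> * T))"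
    proof (rule contour_integral_bound_linepath)
      show "f contour_integrable_on linepath (Complex a (\<sigma> * T)) (Complex b (\<sigma> * T))"
        using sub T by (intro contour_integrable_continuous_linepath continuous_on_subset[OF assms(3)]) auto
      fix x assume "x \<in> closed_segment (Complex a (\<sigma> * T)) (Complex b (\<sigma> * T))"
      from sub[OF this] have "norm (f x) \<le> C * exp (- \<delta> * T)" using C(2)[of x] T by auto
      also have "\<dots> \<le> \<bar>C\<bar> * exp (- \<delta> * T)" by (intro mult_right_mono) auto
      finally show "norm (f x) \<le> \<bar>C\<bar> * exp (- \<delta> * T)" .
    qed auto
    also have "Complex b (\<sigma> * T) - Complex a (\<sigma> * T) = of_real (b - a)" by (simp add: complex_eq_iff)
    finally show ?thesis by (simp only: norm_of_real)
  qed
  have "((\<lambda>T. exp (- \<delta> * T)) \<longlongrightarrow> 0) at_top"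
    using C(1) by (intro filterlim_compose[OF exp_at_bot] filterlim_tendsto_neg_mult_at_bot[OF tendsto_const]) (auto intro: filterlim_ident)
  then have "((\<lambda>T. \<bar>C\<bar> * exp (- \<delta> * T) * \<bar>b - a\<bar>) \<longlongrightarrow> \<bar>C\<bar> * 0 * \<bar>b - a\<bar>) at_top"
    by (intro tendsto_intros)
  then have *: "((\<lambda>T. \<bar>C\<bar> * exp (- \<delta> * T) * \<bar>b - a\<bar>) \<longlongrightarrow> 0) at_top" by simp
  show ?thesis
    by (rule Lim_null_comparison[OF _ *]) (use b in \<open>auto intro: eventually_mono[OF eventually_gt_at_top[of "max 0 (max T0 H)"]]\<close>)
qed

lemma contour_integral_vertical_tendsto:
  assumes "strip_decay f" "continuous_on {\<zeta>. Re \<zeta> = d} f"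
  shows "((\<lambda>T. contour_integral (linepath (Complex d (-T)) (Complex d T)) f) \<longlongrightarrow> \<i> * (LINT t|lborel. f (Complex d t))) at_top"
proof -
  let ?h = "\<lambda>t. f (Complex d t)"
  have c: "continuous_on UNIV ?h"
    by (intro continuous_on_compose2[OF assms(2)]) (auto simp: Complex_eq intro!: continuous_intros)
  have int: "integrable lborel ?h"
    using set_integrable_vertical[OF assms(1) closed_UNIV c] by (simp add: set_integrable_def)
  have "((\<lambda>T. LINT t|lborel. indicat_real {-T..T} t *\<^sub>R ?h t) \<longlongrightarrow> (LINT t|lborel. ?h t)) at_top"
  proof (rule integral_dominated_convergence_at_top[where w = "\<lambda>t. norm (?h t)"])
    show "AE t in lborel. ((\<lambda>T. indicat_real {-T..T} t *\<^sub>R ?h t) \<longlongrightarrow> ?h t) at_top"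
    proof (intro AE_I2)
      fix t :: real
      show "((\<lambda>T. indicat_real {-T..T} t *\<^sub>R ?h t) \<longlongrightarrow> ?h t) at_top"
        by (rule tendsto_eventually, rule eventually_mono[OF eventually_ge_at_top[of "\<bar>t\<bar>"]]) (auto simp: indicator_def)
    qed
  qed (use int in \<open>auto simp: indicator_def intro!: always_eventually borel_measurable_integrable\<close>)
  then have "((\<lambda>T. \<i> * (LINT t|lborel. indicat_real {-T..T} t *\<^sub>R ?h t)) \<longlongrightarrow> \<i> * (LINT t|lborel. ?h t)) at_top"
    by (intro tendsto_intros)
  moreover have "\<forall>\<^sub>F T in at_top. \<i> * (LINT t|lborel. indicat_real {-T..T} t *\<^sub>R ?h t) =
       contour_integral (linepath (Complex d (-T)) (Complex d T)) f"
  proof (rule eventually_mono[OF eventually_gt_at_top[of 0]])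
    fix T :: real assume "T > 0"
    then have "contour_integral (linepath (Complex d (-T)) (Complex d T)) f = \<i> * integral {-T..T} ?h"
      by (intro contour_integral_linepath_same_Re) auto
    also have "integral {-T..T} ?h = set_lebesgue_integral lborel {-T..T} ?h"
      by (intro set_borel_integral_eq_integral(2)[symmetric] set_integrable_subset[OF set_integrable_vertical[OF assms(1) closed_UNIV c]]) auto
    finally show "\<i> * (LINT t|lborel. indicat_real {-T..T} t *\<^sub>R ?h t) = contour_integral (linepath (Complex d (-T)) (Complex d T)) f"
      by (simp add: set_lebesgue_integral_def)
  qed
  ultimately show ?thesis by (rule Lim_transform_eventually)
qed

lemma contour_integral_axis_tendsto:
  assumes "strip_decay f" "R > 0" "continuous_on {\<zeta>. Re \<zeta> = 0 \<and> R \<le> \<bar>Im \<zeta>\<bar>} f"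
  shows "((\<lambda>T. contour_integral (linepath (Complex 0 R) (Complex 0 T)) f) \<longlongrightarrow> \<i> * (LINT s:{R..}|lborel. f (\<i> * of_real s))) at_top"
    and "((\<lambda>T. contour_integral (linepath (Complex 0 (-T)) (Complex 0 (-R))) f) \<longlongrightarrow> \<i> * (LINT s:{..-R}|lborel. f (\<i> * of_real s))) at_top"
proof -
  let ?h = "\<lambda>t. f (Complex 0 t)"
  have h: "(\<lambda>s. f (\<i> * of_real s)) = ?h" by (intro ext arg_cong[where f = f]) (simp add: complex_eq_iff)
  have "continuous_on {R..} ?h" "continuous_on {..-R} ?h"
    using assms(2) by (intro continuous_on_compose2[OF assms(3)]; auto simp: Complex_eq intro!: continuous_intros)+
  then have int: "set_integrable lborel {R..} ?h" "set_integrable lborel {..-R} ?h"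
    using assms by (auto intro!: set_integrable_vertical)
  have "((\<lambda>T. \<i> * set_lebesgue_integral lborel {R..T} ?h) \<longlongrightarrow> \<i> * set_lebesgue_integral lborel {R..} ?h) at_top"
    by (intro tendsto_intros tendsto_set_lebesgue_integral_at_top int) auto
  moreover have "\<forall>\<^sub>F T in at_top. \<i> * set_lebesgue_integral lborel {R..T} ?h = contour_integral (linepath (Complex 0 R) (Complex 0 T)) f"
  proof (rule eventually_mono[OF eventually_gt_at_top[of R]])
    fix T assume T: "T > R"
    have "set_lebesgue_integral lborel {R..T} ?h = integral {R..T} ?h"
      by (intro set_borel_integral_eq_integral(2) set_integrable_subset[OF int(1)]) auto
    then show "\<i> * set_lebesgue_integral lborel {R..T} ?h = contour_integral (linepath (Complex 0 R) (Complex 0 T)) f"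
      using T by (subst contour_integral_linepath_same_Re[where c = 0 and a = R and b = T]) auto
  qed
  ultimately show "((\<lambda>T. contour_integral (linepath (Complex 0 R) (Complex 0 T)) f) \<longlongrightarrow> \<i> * (LINT s:{R..}|lborel. f (\<i> * of_real s))) at_top"
    unfolding h by (rule Lim_transform_eventually)
  have "((\<lambda>a. set_lebesgue_integral lborel {a..-R} ?h) \<longlongrightarrow> set_lebesgue_integral lborel {..-R} ?h) at_bot"
    by (intro tendsto_set_lebesgue_integral_at_bot int) auto
  from filterlim_compose[OF this filterlim_uminus_at_bot_at_top]
  have "((\<lambda>T. \<i> * set_lebesgue_integral lborel {-T..-R} ?h) \<longlongrightarrow> \<i> * set_lebesgue_integral lborel {..-R} ?h) at_top"
    by (intro tendsto_intros)
  moreover have "\<forall>\<^sub>F T in at_top. \<i> * set_lebesgue_integral lborel {-T..-R} ?h = contour_integral (linepath (Complex 0 (-T)) (Complex 0 (-R))) f"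
  proof (rule eventually_mono[OF eventually_gt_at_top[of R]])
    fix T assume T: "T > R"
    have "set_lebesgue_integral lborel {-T..-R} ?h = integral {-T..-R} ?h"
      by (intro set_borel_integral_eq_integral(2) set_integrable_subset[OF int(2)]) auto
    then show "\<i> * set_lebesgue_integral lborel {-T..-R} ?h = contour_integral (linepath (Complex 0 (-T)) (Complex 0 (-R))) f"
      using T by (subst contour_integral_linepath_same_Re[where c = 0 and a = "-T" and b = "-R"]) auto
  qed
  ultimately show "((\<lambda>T. contour_integral (linepath (Complex 0 (-T)) (Complex 0 (-R))) f) \<longlongrightarrow> \<i> * (LINT s:{..-R}|lborel. f (\<i> * of_real s))) at_top"
    unfolding h by (rule Lim_transform_eventually)
qed

text \<open>A and B are the poles belonging on the left and on the right of a contour. Since A is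
  bounded on the right and B on the left, only finitely many poles are on the wrong side of a
  vertical line. The bound H on the heights keeps the horizontal sides of tall loops free of
  poles.\<close>

locale barnes_integrand =
  fixes A B :: "complex set" and H :: real and f :: "complex \<Rightarrow> complex"
  assumes holf: "f holomorphic_on - (A \<union> B)"
    and fin: "\<And>r. finite {z \<in> A \<union> B. \<bar>Re z\<bar> \<le> r}"
    and disj: "A \<inter> B = {}"
    and decay: "strip_decay f"
    and ImH: "\<And>z. z \<in> A \<union> B \<Longrightarrow> \<bar>Im z\<bar> \<le> H"
    and Above: "\<exists>u. \<forall>a\<in>A. Re a \<le> u"
    and Bbelow: "\<exists>l. \<forall>b\<in>B. l \<le> Re b"
begin

lemma contf: "continuous_on S f" if "S \<inter> (A \<union> B) = {}"
  by (rule continuous_on_subset[OF holomorphic_on_imp_continuous_on[OF holf]]) (use that in auto)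

lemma finite_A_right: "finite {a \<in> A. d < Re a}"
proof -
  obtain u where u: "\<And>a. a \<in> A \<Longrightarrow> Re a \<le> u" using Above by blast
  show ?thesis by (rule finite_subset[OF _ fin[of "\<bar>u\<bar> + \<bar>d\<bar>"]]) (auto dest: u)
qed

lemma finite_B_left: "finite {b \<in> B. Re b < d}"
proof -
  obtain l where l: "\<And>b. b \<in> B \<Longrightarrow> l \<le> Re b" using Bbelow by blast
  show ?thesis by (rule finite_subset[OF _ fin[of "\<bar>l\<bar> + \<bar>d\<bar>"]]) (auto dest: l)
qed

lemma integrable_line:
  assumes "\<And>z. z \<in> A \<union> B \<Longrightarrow> Re z \<noteq> d"
  shows "integrable lborel (\<lambda>t. f (Complex d t))"
proof -
  have "continuous_on UNIV (\<lambda>t. f (Complex d t))"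
    by (intro continuous_on_compose2[OF contf[of "{\<zeta>. Re \<zeta> = d}"]]) (use assms in \<open>auto simp: Complex_eq intro!: continuous_intros\<close>)
  then show ?thesis using set_integrable_vertical[OF decay closed_UNIV, of d] by (simp add: set_integrable_def)
qed

text \<open>The contour closed by the line Re = d winds once around the poles of A to the right of
  the line, -1 times around the poles of B to its left, and around no other pole. In the limit of
  tall loops only the contour and the line remain.\<close>

proposition barnes_integral_eq_line:
  assumes bc: "barnes_contour A B R g" and d: "\<And>z. z \<in> A \<union> B \<Longrightarrow> Re z \<noteq> d"
  shows "barnes_integral R g f = \<i> * (LINT t|lborel. f (Complex d t)) +
    2 * of_real pi * \<i> * ((\<Sum>a | a \<in> A \<and> d < Re a. residue f a) - (\<Sum>b | b \<in> B \<and> Re b < d. residue f b))"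
proof -
  have sepA: "\<And>a. a \<in> A \<Longrightarrow> \<forall>\<^sub>F X in at_top. connected_component (- barnes_trace R g) a (of_real (- X))"
    and sepB: "\<And>b. b \<in> B \<Longrightarrow> \<forall>\<^sub>F X in at_top. connected_component (- barnes_trace R g) b (of_real X)"
    using bc by (auto simp: barnes_contour_def)
  interpret barnes_path R g
    using bc by unfold_locales (auto simp: barnes_contour_def complex_eq_iff)
  have tr: "(A \<union> B) \<inter> barnes_trace R g = {}"
    using trace_imp_component[OF sepA] trace_imp_component[OF sepB] by blast
  have "bounded (path_image g)" by (simp add: path_g bounded_path_image)
  then obtain Mg where Mg: "\<And>w. w \<in> path_image g \<Longrightarrow> norm w \<le> Mg"
    by (auto simp: bounded_iff)
  define SA where "SA = {a \<in> A. d < Re a}"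
  define SB where "SB = {b \<in> B. Re b < d}"
  have finS: "finite SA" "finite SB" unfolding SA_def SB_def by (rule finite_A_right finite_B_left)+
  obtain r where r: "\<And>z. z \<in> SA \<union> SB \<Longrightarrow> \<bar>Re z\<bar> \<le> r"
    using finite_imp_bounded[of "Re ` (SA \<union> SB)"] finS by (auto simp: bounded_iff)
  \<comment> \<open>The strip |Re| < \<rho> contains \<open>g\<close>, the line Re = d and all poles
    with nonzero winding number, but only finitely many poles, as the residue theorem
    requires.\<close>
  define \<rho> where "\<rho> = max \<bar>r\<bar> (max \<bar>d\<bar> \<bar>Mg\<bar>) + 1"
  have \<rho>: "r < \<rho>" "\<bar>d\<bar> < \<rho>" "Mg < \<rho>" "0 < \<rho>" unfolding \<rho>_def by linarith+
  define S where "S = {z. \<bar>Re z\<bar> < \<rho>}"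
  define pts where "pts = (A \<union> B) \<inter> S"
  have S_eq: "S = {z. Re z < \<rho>} \<inter> {z. - \<rho> < Re z}" by (auto simp: S_def)
  have oS: "open S" "convex S" unfolding S_eq
    using convex_halfspace_lt[of "1::complex" \<rho>] convex_halfspace_gt[of "-\<rho>" "1::complex"]
    by (auto intro!: open_Int open_halfspace_Re_lt open_halfspace_Re_gt convex_Int simp: inner_complex_def)
  have finpts: "finite pts" by (rule finite_subset[OF _ fin[of \<rho>]]) (auto simp: pts_def S_def)
  have holS: "f holomorphic_on S - pts" by (rule holomorphic_on_subset[OF holf]) (auto simp: pts_def)
  have SAB: "SA \<subseteq> pts" "SB \<subseteq> pts" using r \<rho>(1) by (force simp: pts_def S_def SA_def SB_def)+

  let ?res = "(\<Sum>a\<in>SA. residue f a) - (\<Sum>b\<in>SB. residue f b)"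
  define T0 where "T0 = max R (\<bar>H\<bar> + 1)"
  have sub: "path_image (barnes_loop R g T d) \<subseteq> S - pts" if T: "T \<ge> T0" for T
  proof
    fix w assume w: "w \<in> path_image (barnes_loop R g T d)"
    have "R \<le> T" using T by (simp add: T0_def)
    from subsetD[OF path_image_barnes_loop_subset[OF this] w]
    consider "w \<in> barnes_trace R g" | "\<bar>Im w\<bar> = T" "Re w \<in> closed_segment 0 d" | "Re w = d" by blast
    then show "w \<in> S - pts"
    proof cases
      case 1
      then consider "w \<in> path_image g" | "Re w = 0" by (auto simp: barnes_trace_def)
      then have "w \<in> S"
      proof cases
        case 1
        then have "\<bar>Re w\<bar> \<le> Mg" using Mg[of w] abs_Re_le_cmod[of w] by linarith
        then show ?thesis using \<rho> by (simp add: S_def)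
      qed (use \<rho> in \<open>simp add: S_def\<close>)
      then show ?thesis using 1 tr by (auto simp: pts_def)
    next
      case 2
      then have "w \<in> S" using \<rho> by (auto simp: S_def closed_segment_eq_real_ivl split: if_splits)
      moreover have "w \<notin> A \<union> B" using ImH[of w] 2 T by (auto simp: T0_def)
      ultimately show ?thesis by (auto simp: pts_def)
    next
      case 3
      then have "w \<in> S" using \<rho> by (simp add: S_def)
      then show ?thesis using d[of w] \<open>Re w = d\<close> by (auto simp: pts_def)
    qed
  qed
  have wn: "\<forall>\<^sub>F T in at_top. \<forall>p\<in>pts. winding_number (barnes_loop R g T d) p =
       (if p \<in> SA then 1 else 0) - (if p \<in> SB then 1 else 0)"
  proof (intro eventually_ball_finite finpts ballI)
    fix p assume "p \<in> pts"
    then have "p \<in> A \<union> B" by (simp add: pts_def)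
    from d[OF this] have pd: "Re p \<noteq> d" .
    show "\<forall>\<^sub>F T in at_top. winding_number (barnes_loop R g T d) p =
       (if p \<in> SA then 1 else 0) - (if p \<in> SB then 1 else 0)"
    proof (cases "p \<in> A")
      case True
      then have "p \<notin> B" using disj by blast
      then have "(if Re p < d then 0 else 1) = ((if p \<in> SA then 1 else 0) - (if p \<in> SB then 1 else 0) :: complex)"
        using True pd by (simp add: SA_def SB_def)
      then show ?thesis using winding_number_barnes_loop_left[OF sepA[OF True] pd] by simp
    next
      case False
      then have B: "p \<in> B" using \<open>p \<in> A \<union> B\<close> by blast
      have "(if Re p < d then - 1 else 0) = ((if p \<in> SA then 1 else 0) - (if p \<in> SB then 1 else 0) :: complex)"
        using False B pd by (simp add: SA_def SB_def)
      then show ?thesis using winding_number_barnes_loop_right[OF sepB[OF B] pd] by simp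
    qed
  qed
  have total: "\<forall>\<^sub>F T in at_top. contour_integral (barnes_loop R g T d) f = 2 * of_real pi * \<i> * ?res"
    using wn eventually_ge_at_top[of T0]
  proof eventually_elim
    case (elim T)
    have "contour_integral (barnes_loop R g T d) f =
        of_real (2 * pi) * \<i> * (\<Sum>p\<in>pts. winding_number (barnes_loop R g T d) p * residue f p)"
    proof (rule Residue_theorem[OF oS(1) convex_connected[OF oS(2)] finpts holS])
      show "\<forall>z. z \<notin> S \<longrightarrow> winding_number (barnes_loop R g T d) z = 0"
        using sub[OF elim(2)] oS
        by (auto intro!: winding_number_zero_outside[where s = S] simp: valid_path_barnes_loop valid_path_imp_path pathstart_barnes_loop pathfinish_barnes_loop)
    qed (use sub[OF elim(2)] in \<open>auto simp: valid_path_barnes_loop pathstart_barnes_loop pathfinish_barnes_loop\<close>)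
    also have "(\<Sum>p\<in>pts. winding_number (barnes_loop R g T d) p * residue f p) =
        (\<Sum>p\<in>pts. (if p \<in> SA then residue f p else 0) - (if p \<in> SB then residue f p else 0))"
      using elim(1) by (intro sum.cong) auto
    also have "\<dots> = ?res"
      using SAB finpts by (simp add: sum_subtractf sum.inter_restrict[symmetric] Int_absorb1)
    finally show ?case by simp
  qed
  let ?CI = "\<lambda>a b. contour_integral (linepath a b) f"
  have split: "\<forall>\<^sub>F T in at_top. contour_integral (barnes_loop R g T d) f =
      ?CI (Complex 0 (-T)) (Complex 0 (-R)) + contour_integral g f + ?CI (Complex 0 R) (Complex 0 T) +
      ?CI (Complex 0 T) (Complex d T) - ?CI (Complex d (-T)) (Complex d T) + ?CI (Complex d (-T)) (Complex 0 (-T))"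
    using eventually_ge_at_top[of T0]
  proof eventually_elim
    case (elim T)
    have op: "open (S - pts)" using oS(1) finpts by (intro open_Diff finite_imp_closed)
    have ci: "f contour_integrable_on h" if "valid_path h" "path_image h \<subseteq> path_image (barnes_loop R g T d)" for h
      using that sub[OF elim] by (intro contour_integrable_holomorphic_simple[OF holS op]) auto
    have cl: "f contour_integrable_on (linepath a b)" if "closed_segment a b \<subseteq> path_image (barnes_loop R g T d)" for a b
      using that by (intro ci) auto
    have rev: "?CI (Complex d T) (Complex d (-T)) = - ?CI (Complex d (-T)) (Complex d T)"
      using sub[OF elim] by (intro contour_integral_reverse_linepath contf) (auto simp: path_image_barnes_loop pts_def)
    show ?case
      unfolding barnes_loop_def
      by (simp add: vpg psg pfg ci cl path_image_barnes_loop[of T d] contour_integral_join contour_integrable_join subset_iff rev)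
  qed
  have lim: "((\<lambda>T. ?CI (Complex 0 (-T)) (Complex 0 (-R)) + contour_integral g f + ?CI (Complex 0 R) (Complex 0 T) +
      ?CI (Complex 0 T) (Complex d T) - ?CI (Complex d (-T)) (Complex d T) + ?CI (Complex d (-T)) (Complex 0 (-T))) \<longlongrightarrow>
      \<i> * (LINT s:{..-R}|lborel. f (\<i> * of_real s)) + contour_integral g f + \<i> * (LINT s:{R..}|lborel. f (\<i> * of_real s)) +
      0 - \<i> * (LINT t|lborel. f (Complex d t)) + 0) at_top"
  proof (intro tendsto_intros contour_integral_axis_tendsto contour_integral_vertical_tendsto decay R_pos)
    show "continuous_on {\<zeta>. Re \<zeta> = 0 \<and> R \<le> \<bar>Im \<zeta>\<bar>} f" using tr by (intro contf) (auto simp: barnes_trace_def)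
    then show "continuous_on {\<zeta>. Re \<zeta> = 0 \<and> R \<le> \<bar>Im \<zeta>\<bar>} f" .
    show "continuous_on {\<zeta>. Re \<zeta> = d} f" using d by (intro contf) auto
    have c: "continuous_on {\<zeta>. H < \<bar>Im \<zeta>\<bar>} f" using ImH by (intro contf) force
    show "((\<lambda>T. ?CI (Complex 0 T) (Complex d T)) \<longlongrightarrow> 0) at_top"
      using contour_integral_horizontal_tendsto_0[OF decay _ c, of 1 0 d] by simp
    show "((\<lambda>T. ?CI (Complex d (-T)) (Complex 0 (-T))) \<longlongrightarrow> 0) at_top"
      using contour_integral_horizontal_tendsto_0[OF decay _ c, of "-1" d 0] by simp
  qed
  have "((\<lambda>T. contour_integral (barnes_loop R g T d) f) \<longlongrightarrow> barnes_integral R g f - \<i> * (LINT t|lborel. f (Complex d t))) at_top"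
    using Lim_transform_eventually[OF lim, of "\<lambda>T. contour_integral (barnes_loop R g T d) f"] eventually_mono[OF split]
    by (simp add: barnes_integral_def algebra_simps)
  moreover have "((\<lambda>T. contour_integral (barnes_loop R g T d) f) \<longlongrightarrow> 2 * of_real pi * \<i> * ?res) at_top"
    using total by (rule tendsto_eventually)
  ultimately have "barnes_integral R g f - \<i> * (LINT t|lborel. f (Complex d t)) = 2 * of_real pi * \<i> * ?res"
    by (intro tendsto_unique[OF trivial_limit_at_top_linorder])
  then show ?thesis by (simp add: SA_def SB_def diff_eq_eq)
qed

text \<open>Along the lines Re = d + n the L^1 norm of f is at least halved at each step, so the
  line integrals tend to 0 while the residues passed over add up to r. Passing a pole of B to the
  right subtracts its residue.\<close>

proposition barnes_integral_eq_residues: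
  assumes bc: "barnes_contour A B R g" and sm: "(residue f has_sum r) B"
    and ratio: "\<And>\<zeta>. N \<le> Re \<zeta> \<Longrightarrow> norm (f (\<zeta> + 1)) \<le> norm (f \<zeta>) / 2"
  shows "barnes_integral R g f = - (2 * of_real pi * \<i> * r)"
proof -
  obtain u where u: "\<And>a. a \<in> A \<Longrightarrow> Re a \<le> u" using Above by blast
  \<comment> \<open>The poles are countable, so some abscissa in any interval has no integer
    translate d + n meeting a pole.\<close>
  have "A \<union> B = (\<Union>n::nat. {z \<in> A \<union> B. \<bar>Re z\<bar> \<le> real n})"
    using real_arch_simple by blast
  also have "countable \<dots>" by (rule Countable_Set.countable_UN[OF _ countable_finite[OF fin]]) simp
  finally have "countable ((\<lambda>(z, n::nat). Re z - real n) ` ((A \<union> B) \<times> UNIV))" by auto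
  then have "uncountable ({max u N<..<max u N + 1} - (\<lambda>(z, n::nat). Re z - real n) ` ((A \<union> B) \<times> UNIV))"
    by (intro uncountable_minus_countable) (auto simp: uncountable_open_interval)
  then have "{max u N<..<max u N + 1} - (\<lambda>(z, n::nat). Re z - real n) ` ((A \<union> B) \<times> UNIV) \<noteq> {}"
    by (metis countable_empty)
  then obtain d where d: "d > max u N" "\<And>z n. z \<in> A \<union> B \<Longrightarrow> d \<noteq> Re z - real n" by force
  have dn: "Re z \<noteq> d + real n" if "z \<in> A \<union> B" for z n using d(2)[OF that, of n] by auto
  let ?L = "\<lambda>n::nat. LINT t|lborel. f (Complex (d + n) t)"
  let ?J = "\<lambda>n::nat. LINT t|lborel. norm (f (Complex (d + n) t))"
  let ?S = "\<lambda>n::nat. (\<Sum>b | b \<in> B \<and> Re b < d + n. residue f b)"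
  have eq: "barnes_integral R g f = \<i> * ?L n - 2 * of_real pi * \<i> * ?S n" for n
  proof -
    have e: "{a. a \<in> A \<and> d + real n < Re a} = {}" using u d(1) by force
    have "barnes_integral R g f = \<i> * ?L n + 2 * of_real pi * \<i> * ((\<Sum>a | a \<in> A \<and> d + real n < Re a. residue f a) - ?S n)"
      by (rule barnes_integral_eq_line[OF bc dn])
    then show ?thesis unfolding e by simp
  qed
  have int: "integrable lborel (\<lambda>t. norm (f (Complex (d + real n) t)))" for n
    by (rule integrable_norm[OF integrable_line]) (rule dn)
  have J: "?J n \<le> ?J 0 * (1 / 2) ^ n" for n
  proof (induction n)
    case (Suc n)
    have "?J (Suc n) \<le> (LINT t|lborel. norm (f (Complex (d + n) t)) / 2)"
    proof (rule integral_mono[OF int integrable_divide[OF int]])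
      fix t
      have "Complex (d + real (Suc n)) t = Complex (d + n) t + 1" by (simp add: complex_eq_iff)
      then show "norm (f (Complex (d + real (Suc n)) t)) \<le> norm (f (Complex (d + n) t)) / 2"
        using ratio[of "Complex (d + n) t"] d(1) by simp
    qed
    then show ?case using Suc by simp
  qed simp
  have "norm (?L n) \<le> ?J 0 * (1 / 2) ^ n" for n
    using integral_norm_bound[of lborel "\<lambda>t. f (Complex (d + n) t)"] J[of n] by linarith
  then have ev: "\<forall>\<^sub>F n in sequentially. norm (?L n) \<le> ?J 0 * (1 / 2) ^ n" by (rule always_eventually[OF allI])
  have "(\<lambda>n. (1 / 2 :: real) ^ n) \<longlonglongrightarrow> 0" by (rule LIMSEQ_realpow_zero) auto
  from tendsto_mult_right_zero[OF this] have "(\<lambda>n. ?J 0 * (1 / 2) ^ n) \<longlonglongrightarrow> 0" .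
  then have "?L \<longlonglongrightarrow> 0" by (rule Lim_null_comparison[OF ev])
  moreover have "?S \<longlonglongrightarrow> r"
  proof -
    \<comment> \<open>The truncations Re b < d + n eventually contain any given finite subset of B,
      so this particular exhaustion computes the unordered sum.\<close>
    have "filterlim (\<lambda>n::nat. {b. b \<in> B \<and> Re b < d + n}) (finite_subsets_at_top B) sequentially"
      unfolding filterlim_finite_subsets_at_top
    proof (intro allI impI)
      fix X assume X: "finite X \<and> X \<subseteq> B"
      define m where "m = Max (insert 0 (Re ` X))"
      have m: "Re b \<le> m" if "b \<in> X" for b using X that by (auto simp: m_def)
      have "\<forall>\<^sub>F n in sequentially. m < d + real n"
        using filterlim_real_sequentially by (auto simp: filterlim_at_top_dense dest!: spec[of _ "m - d"] elim!: eventually_mono)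
      then show "\<forall>\<^sub>F n in sequentially. finite {b. b \<in> B \<and> Re b < d + real n} \<and>
          X \<subseteq> {b. b \<in> B \<and> Re b < d + real n} \<and> {b. b \<in> B \<and> Re b < d + real n} \<subseteq> B"
        by eventually_elim (use X m finite_B_left in force)
    qed
    then show ?thesis
      using sm unfolding has_sum_def by (rule filterlim_compose[rotated])
  qed
  ultimately have "(\<lambda>n. \<i> * ?L n - 2 * of_real pi * \<i> * ?S n) \<longlonglongrightarrow> \<i> * 0 - 2 * of_real pi * \<i> * r"
    by (intro tendsto_intros)
  then have "(\<lambda>n::nat. barnes_integral R g f) \<longlonglongrightarrow> \<i> * 0 - 2 * of_real pi * \<i> * r"
    using eq by simp
  then show ?thesis by (simp add: LIMSEQ_const_iff)
qed

end

section \<open>Existence of separating contours\<close>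

lemma connected_component_segment:
  fixes a b :: "'a :: real_normed_vector"
  shows "closed_segment a b \<subseteq> S \<Longrightarrow> connected_component S a b"
  unfolding connected_component_def
  by (intro exI[of _ "closed_segment a b"]) (simp add: connected_segment)

text \<open>The contour crosses the line \<open>Im z = h\<close> along the graph of \<open>\<phi>\<close>; points above the graph are on its left.\<close>

lemma barnes_contour_exists:
  fixes \<phi> \<phi>' :: "real \<Rightarrow> real" and c d h :: real
  assumes cd: "c < d"
    and der: "\<And>x. (\<phi> has_real_derivative \<phi>' x) (at x)" "continuous_on UNIV \<phi>'"
    and bnd: "\<And>x. \<bar>\<phi> x\<bar> \<le> 2"
    and A: "\<And>a. a \<in> A \<Longrightarrow> Im a = h \<and> Re a < d \<and> (c \<le> Re a \<longrightarrow> \<phi> (Re a) < 0)"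
    and B: "\<And>b. b \<in> B \<Longrightarrow> Im b = h \<and> c < Re b \<and> (Re b \<le> d \<longrightarrow> 0 < \<phi> (Re b))"
  shows "\<exists>R g. barnes_contour A B R g"
proof -
  \<comment> \<open>The graph stays within 2 of height h, and points escape at the heights h + 3 and
    h - 3; both must be strictly inside |Im| < R.\<close>
  define R where "R = \<bar>h\<bar> + 4"
  define G where "G = (\<lambda>t. Complex (c + (d - c) * t) (h + \<phi> (c + (d - c) * t)))"
  define P1 where "P1 = linepath (Complex 0 (-R)) (Complex c (-R)) +++ linepath (Complex c (-R)) (Complex c (h + \<phi> c))"
  define P2 where "P2 = linepath (Complex d (h + \<phi> d)) (Complex d R) +++ linepath (Complex d R) (Complex 0 R)"
  define g where "g = P1 +++ G +++ P2"
  have R: "R > \<bar>h\<bar> + 3" "R > 0" by (auto simp: R_def)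
  have sG: "pathstart G = Complex c (h + \<phi> c)" "pathfinish G = Complex d (h + \<phi> d)"
    by (auto simp: G_def pathstart_def pathfinish_def)
  have vG: "valid_path G"
  proof -
    have "G C1_differentiable_on {0..1}"
      unfolding C1_differentiable_on_def
    proof (intro exI conjI ballI)
      let ?D = "\<lambda>t. Complex (d - c) (\<phi>' (c + (d - c) * t) * (d - c))"
      have D: "((\<lambda>t. \<phi> (c + (d - c) * t)) has_real_derivative \<phi>' (c + (d - c) * t) * (d - c)) (at t)" for t
        by (rule DERIV_chain2[OF der(1)]) (auto intro!: derivative_eq_intros)
      have D1: "((\<lambda>t. complex_of_real (c + (d - c) * t)) has_vector_derivative of_real (d - c)) (at t)" for t
        by (rule has_vector_derivative_of_real) (auto intro!: derivative_eq_intros simp flip: has_real_derivative_iff_has_vector_derivative)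
      have D2: "((\<lambda>t. complex_of_real (h + \<phi> (c + (d - c) * t))) has_vector_derivative of_real (\<phi>' (c + (d - c) * t) * (d - c))) (at t)" for t
        using DERIV_cong[OF DERIV_add[OF DERIV_const D]]
        by (intro has_vector_derivative_of_real) (simp add: has_real_derivative_iff_has_vector_derivative)
      show "(G has_vector_derivative ?D t) (at t)" for t
        unfolding G_def Complex_eq by (intro has_vector_derivative_add has_vector_derivative_mult_right D1 D2)
      show "continuous_on {0..1} ?D"
        unfolding Complex_eq
        by (intro continuous_intros continuous_on_compose2[OF der(2)]) auto
    qed
    then show ?thesis by (simp add: valid_path_def C1_differentiable_imp_piecewise)
  qed
  have vg: "valid_path g" "pathstart g = Complex 0 (-R)" "pathfinish g = Complex 0 R"
    by (auto simp: g_def P1_def P2_def vG sG)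
  \<comment> \<open>A coarser set containing the trace: everything at height at least R in modulus,
    a downward ray at c, an upward ray at d, and the graph. Avoiding it can be checked
    coordinatewise.\<close>
  define Tr where "Tr = {z. R \<le> \<bar>Im z\<bar>} \<union> {z. Re z = c \<and> Im z \<le> h + \<phi> c} \<union> {z. Re z = d \<and> h + \<phi> d \<le> Im z} \<union>
      {z. c \<le> Re z \<and> Re z \<le> d \<and> Im z = h + \<phi> (Re z)}"
  have tr: "barnes_trace R g \<subseteq> Tr"
  proof -
    have "path_image G \<subseteq> Tr"
    proof
      fix z assume "z \<in> path_image G"
      then obtain t where t: "0 \<le> t" "t \<le> 1" "z = G t" by (auto simp: path_image_def)
      have "(d - c) * t \<le> (d - c) * 1" "0 \<le> (d - c) * t" using t cd by (intro mult_left_mono mult_nonneg_nonneg; simp)+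
      then show "z \<in> Tr" by (auto simp: Tr_def t G_def)
    qed
    moreover have "path_image P1 \<subseteq> Tr"
      using bnd[of c] R by (auto simp: P1_def path_image_join Tr_def closed_segment_same_Re closed_segment_same_Im closed_segment_eq_real_ivl split: if_splits)
    moreover have "path_image P2 \<subseteq> Tr"
      using bnd[of d] R by (auto simp: P2_def path_image_join Tr_def closed_segment_same_Re closed_segment_same_Im closed_segment_eq_real_ivl split: if_splits)
    moreover have "path_image g = path_image P1 \<union> (path_image G \<union> path_image P2)"
      unfolding g_def using sG by (simp add: path_image_join P1_def P2_def)
    moreover have "{z. Re z = 0 \<and> R \<le> \<bar>Im z\<bar>} \<subseteq> Tr" by (auto simp: Tr_def)
    ultimately show ?thesis unfolding barnes_trace_def by blast
  qed
  have seg: "connected_component (- barnes_trace R g) u v" if "closed_segment u v \<inter> Tr = {}" for u v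
    using that tr by (intro connected_component_segment) blast
  note cs = Tr_def closed_segment_same_Re closed_segment_same_Im closed_segment_eq_real_ivl
  have sepA: "connected_component (- barnes_trace R g) a (of_real (- X))" if a: "a \<in> A" and X: "X > \<bar>c\<bar> + \<bar>Re a\<bar>" for a X
  proof (cases "Re a < c")
    case True
    have "connected_component (- barnes_trace R g) a (Complex (-X) h)"
      using A[OF a] True X R by (intro seg) (auto simp: cs split: if_splits)
    moreover have "connected_component (- barnes_trace R g) (Complex (-X) h) (Complex (-X) 0)"
      using X R cd by (intro seg) (auto simp: cs split: if_splits)
    ultimately show ?thesis unfolding complex_of_real_def by (meson connected_component_trans)
  next
    case False
    then have a': "Im a = h" "Re a < d" "c \<le> Re a" "\<phi> (Re a) < 0" using A[OF a] by auto
    \<comment> \<open>A point above the graph goes up to h + 3, then left over the top of the ray at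
      c, which ends at height at most h + 2.\<close>
    have "connected_component (- barnes_trace R g) a (Complex (Re a) (h + 3))"
    proof (intro seg equals0I)
      fix w assume w: "w \<in> closed_segment a (Complex (Re a) (h + 3)) \<inter> Tr"
      then have "Re w = Re a" "h \<le> Im w" "Im w \<le> h + 3" using a' by (auto simp: closed_segment_same_Re closed_segment_eq_real_ivl)
      then show False using w a' R by (auto simp: Tr_def)
    qed
    moreover have "connected_component (- barnes_trace R g) (Complex (Re a) (h + 3)) (Complex (-X) (h + 3))"
    proof (intro seg equals0I)
      fix w assume w: "w \<in> closed_segment (Complex (Re a) (h + 3)) (Complex (-X) (h + 3)) \<inter> Tr"
      then have "Re w \<le> Re a" "Im w = h + 3" using X by (auto simp: closed_segment_same_Im closed_segment_eq_real_ivl split: if_splits)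
      then show False using w a' R bnd[of c] bnd[of "Re w"] by (auto simp: Tr_def)
    qed
    moreover have "connected_component (- barnes_trace R g) (Complex (-X) (h + 3)) (Complex (-X) 0)"
      using X R cd by (intro seg) (auto simp: cs split: if_splits)
    ultimately show ?thesis unfolding complex_of_real_def by (meson connected_component_trans)
  qed
  have sepB: "connected_component (- barnes_trace R g) b (of_real X)" if b: "b \<in> B" and X: "X > \<bar>d\<bar> + \<bar>Re b\<bar>" for b X
  proof (cases "d < Re b")
    case True
    have "connected_component (- barnes_trace R g) b (Complex X h)"
      using B[OF b] True X R by (intro seg) (auto simp: cs split: if_splits)
    moreover have "connected_component (- barnes_trace R g) (Complex X h) (Complex X 0)"
      using X R cd by (intro seg) (auto simp: cs split: if_splits)
    ultimately show ?thesis unfolding complex_of_real_def by (meson connected_component_trans)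
  next
    case False
    then have b': "Im b = h" "Re b \<le> d" "c < Re b" "0 < \<phi> (Re b)" using B[OF b] by auto
    \<comment> \<open>A point below the graph goes down to h - 3, then right under the ray at d,
      which starts at height at least h - 2.\<close>
    have "connected_component (- barnes_trace R g) b (Complex (Re b) (h - 3))"
    proof (intro seg equals0I)
      fix w assume w: "w \<in> closed_segment b (Complex (Re b) (h - 3)) \<inter> Tr"
      then have "Re w = Re b" "Im w \<le> h" "h - 3 \<le> Im w" using b' by (auto simp: closed_segment_same_Re closed_segment_eq_real_ivl)
      then show False using w b' R by (auto simp: Tr_def)
    qed
    moreover have "connected_component (- barnes_trace R g) (Complex (Re b) (h - 3)) (Complex X (h - 3))"
    proof (intro seg equals0I)
      fix w assume w: "w \<in> closed_segment (Complex (Re b) (h - 3)) (Complex X (h - 3)) \<inter> Tr"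
      then have "Re b \<le> Re w" "Im w = h - 3" using X by (auto simp: closed_segment_same_Im closed_segment_eq_real_ivl split: if_splits)
      then show False using w b' R bnd[of d] bnd[of "Re w"] by (auto simp: Tr_def)
    qed
    moreover have "connected_component (- barnes_trace R g) (Complex X (h - 3)) (Complex X 0)"
      using X R cd by (intro seg) (auto simp: cs split: if_splits)
    ultimately show ?thesis unfolding complex_of_real_def by (meson connected_component_trans)
  qed
  have "barnes_contour A B R g"
    unfolding barnes_contour_def
  proof (intro conjI ballI)
    show "\<forall>\<^sub>F X in at_top. connected_component (- barnes_trace R g) a (of_real (- X))" if "a \<in> A" for a
      by (rule eventually_mono[OF eventually_gt_at_top sepA[OF that]])
    show "\<forall>\<^sub>F X in at_top. connected_component (- barnes_trace R g) b (of_real X)" if "b \<in> B" for b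
      by (rule eventually_mono[OF eventually_gt_at_top sepB[OF that]])
  qed (use vg R in \<open>auto simp: complex_eq_iff\<close>)
  then show ?thesis by blast
qed

section \<open>Integrands with two Gamma factors\<close>

text \<open>The definite description needs a contour for existence and the same value on all
  contours for uniqueness.\<close>

lemma meijer_G_Log_eqI:
  assumes "\<exists>R g. barnes_contour (meijer_poles_\<alpha> N \<alpha>s) (meijer_poles_\<beta> M \<beta>s) R g"
    and "\<And>R g. barnes_contour (meijer_poles_\<alpha> N \<alpha>s) (meijer_poles_\<beta> M \<beta>s) R g \<Longrightarrow>
           barnes_integral R g (meijer_integrand M N \<alpha>s \<beta>s l) = 2 * of_real pi * \<i> * v"
  shows "meijer_G_Log M N \<alpha>s \<beta>s l = v"
  unfolding meijer_G_Log_def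
proof (rule the_equality)
  show "\<exists>R g. barnes_contour (meijer_poles_\<alpha> N \<alpha>s) (meijer_poles_\<beta> M \<beta>s) R g \<and>
      v = 1 / (2 * of_real pi * \<i>) * barnes_integral R g (meijer_integrand M N \<alpha>s \<beta>s l)"
  proof -
    obtain R g where bc: "barnes_contour (meijer_poles_\<alpha> N \<alpha>s) (meijer_poles_\<beta> M \<beta>s) R g" using assms(1) by blast
    then show ?thesis using assms(2)[OF bc] by (intro exI[of _ R] exI[of _ g]) simp
  qed
qed (auto simp: assms(2))

lemma minus_of_nat_in_nonpos_Ints_iff:
  fixes b z :: complex
  shows "b - z \<in> \<int>\<^sub>\<le>\<^sub>0 \<longleftrightarrow> (\<exists>k::nat. z = b + of_nat k)"
proof
  assume "b - z \<in> \<int>\<^sub>\<le>\<^sub>0"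
  then obtain k :: nat where "b - z = - of_nat k" by (elim nonpos_Ints_cases')
  then have "z = b + of_nat k" by (simp add: algebra_simps)
  then show "\<exists>k::nat. z = b + of_nat k" ..
qed auto

text \<open>The poles of Gamma(\<beta> - \<zeta>) as a function of \<zeta>.\<close>

definition right_lattice :: "complex \<Rightarrow> complex set" where
  "right_lattice \<beta> = range (\<lambda>k::nat. \<beta> + of_nat k)"

lemma mem_right_lattice: "z \<in> right_lattice \<beta> \<longleftrightarrow> \<beta> - z \<in> \<int>\<^sub>\<le>\<^sub>0"
  unfolding minus_of_nat_in_nonpos_Ints_iff right_lattice_def by auto

lemma finite_right_lattice: "finite {z \<in> right_lattice \<beta>. \<bar>Re z\<bar> \<le> r}"
proof (rule finite_subset)
  show "{z \<in> right_lattice \<beta>. \<bar>Re z\<bar> \<le> r} \<subseteq> (\<lambda>k::nat. \<beta> + of_nat k) ` {..nat \<lceil>\<bar>r\<bar> + \<bar>Re \<beta>\<bar>\<rceil>}"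
  proof
    fix z assume "z \<in> {z \<in> right_lattice \<beta>. \<bar>Re z\<bar> \<le> r}"
    then obtain k :: nat where k: "z = \<beta> + of_nat k" "\<bar>Re \<beta> + k\<bar> \<le> r" by (auto simp: right_lattice_def)
    then have "k \<le> nat \<lceil>\<bar>r\<bar> + \<bar>Re \<beta>\<bar>\<rceil>" by linarith
    then show "z \<in> (\<lambda>k::nat. \<beta> + of_nat k) ` {..nat \<lceil>\<bar>r\<bar> + \<bar>Re \<beta>\<bar>\<rceil>}" using k by auto
  qed
qed auto

lemma norm_Gamma_reflected_strip:
  fixes m \<epsilon> :: real and \<beta> :: complex
  assumes "0 < \<epsilon>" "\<epsilon> < 1"
  shows "\<exists>C>0. \<forall>\<zeta>. \<bar>Re \<zeta>\<bar> \<le> m \<and> 1 + \<bar>Im \<beta>\<bar> \<le> \<bar>Im \<zeta>\<bar> \<longrightarrow> norm (Gamma (\<beta> - \<zeta>)) \<le> C * exp (- (pi/2 - \<epsilon>) * \<bar>Im \<zeta>\<bar>)"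
proof -
  obtain C where C: "C > 0" "\<And>w. \<bar>Re w\<bar> \<le> m + \<bar>Re \<beta>\<bar> \<Longrightarrow> 1 \<le> \<bar>Im w\<bar> \<Longrightarrow> norm (Gamma w) \<le> C * exp (- (pi/2 - \<epsilon>) * \<bar>Im w\<bar>)"
    using norm_Gamma_le_exp_strip[OF assms(1), of "m + \<bar>Re \<beta>\<bar>"] by auto
  have pe: "pi / 2 - \<epsilon> > 0" using pi_gt3 assms by linarith
  have "norm (Gamma (\<beta> - \<zeta>)) \<le> (C * exp ((pi/2 - \<epsilon>) * \<bar>Im \<beta>\<bar>)) * exp (- (pi/2 - \<epsilon>) * \<bar>Im \<zeta>\<bar>)"
    if "\<bar>Re \<zeta>\<bar> \<le> m" "1 + \<bar>Im \<beta>\<bar> \<le> \<bar>Im \<zeta>\<bar>" for \<zeta>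
  proof -
    have "norm (Gamma (\<beta> - \<zeta>)) \<le> C * exp (- (pi/2 - \<epsilon>) * \<bar>Im (\<beta> - \<zeta>)\<bar>)"
      using that by (intro C) auto
    also have "exp (- (pi/2 - \<epsilon>) * \<bar>Im (\<beta> - \<zeta>)\<bar>) \<le> exp (- (pi/2 - \<epsilon>) * (\<bar>Im \<zeta>\<bar> - \<bar>Im \<beta>\<bar>))"
      using pe by (subst exp_le_cancel_iff, intro mult_left_mono_neg) auto
    finally show ?thesis using C(1) by (simp add: algebra_simps exp_add exp_diff)
  qed
  moreover have "C * exp ((pi/2 - \<epsilon>) * \<bar>Im \<beta>\<bar>) > 0" using C(1) by simp
  ultimately show ?thesis by blast
qed

text \<open>At its poles \<open>Gamma\<close> has the default value 0, so the functional equation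
  survives there. Only w = 1 fails, where the left side is 1 and the right side 0.\<close>

lemma Gamma_eq_mult_Gamma_minus1:
  fixes w :: complex
  assumes "w \<noteq> 1"
  shows "Gamma w = (w - 1) * Gamma (w - 1)"
proof (cases "w - 1 \<in> \<int>\<^sub>\<le>\<^sub>0")
  case True
  then obtain k :: nat where k: "w - 1 = - of_nat k" by (elim nonpos_Ints_cases')
  then obtain j where "k = Suc j" using assms by (cases k) auto
  then have "w = - of_nat j" using k by (simp add: algebra_simps eq_neg_iff_add_eq_0)
  then show ?thesis using True by (simp add: Gamma_eq_zero_iff)
next
  case False
  then show ?thesis using Gamma_plus1[of "w - 1"] by auto
qed

text \<open>\<open>\<kappa>\<close> is the exponential growth rate of \<open>E\<close> along vertical lines; the two Gamma factors decay with rate \<open>\<pi>\<close> together.\<close>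

locale gamma_kernel =
  fixes \<beta>1 \<beta>2 :: complex and E :: "complex \<Rightarrow> complex" and A :: "complex set" and \<kappa> h :: real
  assumes Im_\<beta>: "Im \<beta>1 = h" "Im \<beta>2 = h"
    and holE: "E holomorphic_on - A"
    and ImA: "\<And>a. a \<in> A \<Longrightarrow> Im a = h"
    and finA: "\<And>r. finite {a \<in> A. \<bar>Re a\<bar> \<le> r}"
    and Aabove: "\<exists>u. \<forall>a\<in>A. Re a \<le> u"
    and Adisj: "A \<inter> (right_lattice \<beta>1 \<union> right_lattice \<beta>2) = {}"
    and stripE: "\<And>m. \<exists>C T. \<forall>\<zeta>. \<bar>Re \<zeta>\<bar> \<le> m \<and> T \<le> \<bar>Im \<zeta>\<bar> \<longrightarrow> norm (E \<zeta>) \<le> C * exp (\<kappa> * \<bar>Im \<zeta>\<bar>)"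
    and ratioE: "\<exists>K N. \<forall>\<zeta>. N \<le> Re \<zeta> \<longrightarrow> norm (E (\<zeta> + 1)) \<le> K * (1 + norm \<zeta>) * norm (E \<zeta>)"
begin

definition B where "B = right_lattice \<beta>1 \<union> right_lattice \<beta>2"

definition f where "f l \<zeta> = Gamma (\<beta>1 - \<zeta>) * Gamma (\<beta>2 - \<zeta>) * E \<zeta> * exp (\<zeta> * l)"

lemma ImB: "b \<in> B \<Longrightarrow> Im b = h"
  using Im_\<beta> by (auto simp: B_def right_lattice_def)

lemma ReB: "b \<in> B \<Longrightarrow> min (Re \<beta>1) (Re \<beta>2) \<le> Re b"
  by (auto simp: B_def right_lattice_def)

lemma finite_poles: "finite {z \<in> A \<union> B. \<bar>Re z\<bar> \<le> r}"
proof -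
  have "{z \<in> A \<union> B. \<bar>Re z\<bar> \<le> r} = {z \<in> A. \<bar>Re z\<bar> \<le> r} \<union> ({z \<in> right_lattice \<beta>1. \<bar>Re z\<bar> \<le> r} \<union> {z \<in> right_lattice \<beta>2. \<bar>Re z\<bar> \<le> r})"
    by (auto simp: B_def)
  then show ?thesis using finA finite_right_lattice by simp
qed

lemma holf: "f l holomorphic_on - (A \<union> B)"
proof -
  have "E holomorphic_on - (A \<union> B)" by (rule holomorphic_on_subset[OF holE]) auto
  then show ?thesis unfolding f_def
    by (intro holomorphic_intros) (auto simp: B_def mem_right_lattice)
qed

lemma decay:
  assumes "\<bar>Im l\<bar> + \<kappa> < pi"
  shows "strip_decay (f l)"
  unfolding strip_decay_def
proof
  fix m :: real
  \<comment> \<open>Each Gamma factor loses \<epsilon> from its rate pi/2. Since 4\<epsilon> is at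
    most the gap pi - \<kappa> - |Im l|, a net decay of rate at least \<epsilon> remains. The cap
    1/2 serves the Gamma estimate, which assumes \<epsilon> < 1.\<close>
  define \<epsilon> where "\<epsilon> = min (1/2) ((pi - \<kappa> - \<bar>Im l\<bar>) / 4)"
  have \<epsilon>: "0 < \<epsilon>" "\<epsilon> < 1" "4 * \<epsilon> \<le> pi - \<kappa> - \<bar>Im l\<bar>" using assms by (auto simp: \<epsilon>_def min_def)
  obtain C1 where C1: "C1 > 0" "\<And>\<zeta>. \<bar>Re \<zeta>\<bar> \<le> m \<Longrightarrow> 1 + \<bar>h\<bar> \<le> \<bar>Im \<zeta>\<bar> \<Longrightarrow> norm (Gamma (\<beta>1 - \<zeta>)) \<le> C1 * exp (- (pi/2 - \<epsilon>) * \<bar>Im \<zeta>\<bar>)"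
    using norm_Gamma_reflected_strip[OF \<epsilon>(1,2), of m \<beta>1] Im_\<beta> by auto
  obtain C2 where C2: "C2 > 0" "\<And>\<zeta>. \<bar>Re \<zeta>\<bar> \<le> m \<Longrightarrow> 1 + \<bar>h\<bar> \<le> \<bar>Im \<zeta>\<bar> \<Longrightarrow> norm (Gamma (\<beta>2 - \<zeta>)) \<le> C2 * exp (- (pi/2 - \<epsilon>) * \<bar>Im \<zeta>\<bar>)"
    using norm_Gamma_reflected_strip[OF \<epsilon>(1,2), of m \<beta>2] Im_\<beta> by auto
  obtain C3 T where C3: "\<And>\<zeta>. \<bar>Re \<zeta>\<bar> \<le> m \<Longrightarrow> T \<le> \<bar>Im \<zeta>\<bar> \<Longrightarrow> norm (E \<zeta>) \<le> C3 * exp (\<kappa> * \<bar>Im \<zeta>\<bar>)"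
    using stripE[of m] by blast
  have "norm (f l \<zeta>) \<le> (C1 * C2 * \<bar>C3\<bar> * exp (m * \<bar>Re l\<bar>)) * exp (- \<epsilon> * \<bar>Im \<zeta>\<bar>)"
    if \<zeta>: "\<bar>Re \<zeta>\<bar> \<le> m" "max T (1 + \<bar>h\<bar>) \<le> \<bar>Im \<zeta>\<bar>" for \<zeta>
  proof -
    have "norm (E \<zeta>) \<le> C3 * exp (\<kappa> * \<bar>Im \<zeta>\<bar>)" using \<zeta> by (intro C3) auto
    also have "\<dots> \<le> \<bar>C3\<bar> * exp (\<kappa> * \<bar>Im \<zeta>\<bar>)" by (intro mult_right_mono) auto
    finally have e: "norm (E \<zeta>) \<le> \<bar>C3\<bar> * exp (\<kappa> * \<bar>Im \<zeta>\<bar>)" .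
    have "Re \<zeta> * Re l \<le> \<bar>Re \<zeta>\<bar> * \<bar>Re l\<bar>" by (metis abs_ge_self abs_mult)
    also have "\<dots> \<le> m * \<bar>Re l\<bar>" using \<zeta> by (intro mult_right_mono) auto
    finally have r: "Re \<zeta> * Re l \<le> m * \<bar>Re l\<bar>" .
    have "- (Im \<zeta> * Im l) \<le> \<bar>Im \<zeta>\<bar> * \<bar>Im l\<bar>" by (metis abs_ge_minus_self abs_mult)
    with r have x: "norm (exp (\<zeta> * l)) \<le> exp (m * \<bar>Re l\<bar>) * exp (\<bar>Im l\<bar> * \<bar>Im \<zeta>\<bar>)"
      by (simp add: mult.commute flip: exp_add)
    have "norm (f l \<zeta>) \<le> (C1 * exp (- (pi/2 - \<epsilon>) * \<bar>Im \<zeta>\<bar>)) * (C2 * exp (- (pi/2 - \<epsilon>) * \<bar>Im \<zeta>\<bar>)) *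
         (\<bar>C3\<bar> * exp (\<kappa> * \<bar>Im \<zeta>\<bar>)) * (exp (m * \<bar>Re l\<bar>) * exp (\<bar>Im l\<bar> * \<bar>Im \<zeta>\<bar>))"
      unfolding f_def norm_mult using \<zeta> C1(1) C2(1)
      by (intro mult_mono C1(2) C2(2) e x) auto
    also have "\<dots> = (C1 * C2 * \<bar>C3\<bar> * exp (m * \<bar>Re l\<bar>)) *
        (exp (- (pi/2 - \<epsilon>) * \<bar>Im \<zeta>\<bar>) * exp (- (pi/2 - \<epsilon>) * \<bar>Im \<zeta>\<bar>) * exp (\<kappa> * \<bar>Im \<zeta>\<bar>) * exp (\<bar>Im l\<bar> * \<bar>Im \<zeta>\<bar>))"
      by (simp only: mult_ac)
    also have "exp (- (pi/2 - \<epsilon>) * \<bar>Im \<zeta>\<bar>) * exp (- (pi/2 - \<epsilon>) * \<bar>Im \<zeta>\<bar>) * exp (\<kappa> * \<bar>Im \<zeta>\<bar>) * exp (\<bar>Im l\<bar> * \<bar>Im \<zeta>\<bar>)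
        = exp ((\<kappa> + \<bar>Im l\<bar> - pi + 2 * \<epsilon>) * \<bar>Im \<zeta>\<bar>)"
      by (simp add: algebra_simps flip: exp_add)
    also have "\<dots> \<le> exp (- \<epsilon> * \<bar>Im \<zeta>\<bar>)"
      using \<epsilon> by (subst exp_le_cancel_iff, intro mult_right_mono) auto
    finally show ?thesis using C1(1) C2(1) by (simp add: mult_left_mono)
  qed
  then show "\<exists>C \<delta> T. 0 < \<delta> \<and> (\<forall>\<zeta>. \<bar>Re \<zeta>\<bar> \<le> m \<and> T \<le> \<bar>Im \<zeta>\<bar> \<longrightarrow> norm (f l \<zeta>) \<le> C * exp (- \<delta> * \<bar>Im \<zeta>\<bar>))"
    using \<epsilon>(1) by blast
qed

lemma barnes_integrand:
  assumes "\<bar>Im l\<bar> + \<kappa> < pi"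
  shows "barnes_integrand A B \<bar>h\<bar> (f l)"
proof
  show "finite {z \<in> A \<union> B. \<bar>Re z\<bar> \<le> r}" for r by (rule finite_poles)
  show "\<exists>l. \<forall>b\<in>B. l \<le> Re b" using ReB by blast
qed (use holf decay[OF assms] Adisj ImA ImB Aabove in \<open>auto simp: B_def\<close>)

text \<open>A unit step to the right divides the Gamma factors by \<zeta> + 1 - \<beta>1 and \<zeta>
  + 1 - \<beta>2 in modulus. The first quotient absorbs the at most linear growth of E, the second
  makes the ratio small.\<close>

lemma f_ratio: "\<exists>N. \<forall>\<zeta>. N \<le> Re \<zeta> \<longrightarrow> norm (f l (\<zeta> + 1)) \<le> norm (f l \<zeta>) / 2"
proof -
  obtain K N where K: "\<And>\<zeta>. N \<le> Re \<zeta> \<Longrightarrow> norm (E (\<zeta> + 1)) \<le> K * (1 + norm \<zeta>) * norm (E \<zeta>)"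
    using ratioE by blast
  \<comment> \<open>\<open>Q\<close> collects all factors that stay bounded: the ratio is at most Q
    / |\<zeta> + 1 - \<beta>2|, hence at most 1/2 once Re \<zeta> >= Re \<beta>2 + 2Q.\<close>
  define Q where "Q = \<bar>K\<bar> * (2 + norm (1 - \<beta>1)) * exp (Re l)"
  define N' where "N' = Max {N, Re \<beta>1, Re \<beta>2 + 2 * Q}"
  have "norm (f l (\<zeta> + 1)) \<le> norm (f l \<zeta>) / 2" if "N' \<le> Re \<zeta>" for \<zeta>
  proof -
    have \<zeta>: "N \<le> Re \<zeta>" "Re \<beta>1 \<le> Re \<zeta>" "Re \<beta>2 + 2 * Q \<le> Re \<zeta>" using that by (auto simp: N'_def)
    have Q0: "Q \<ge> 0" by (simp add: Q_def)
    have G: "norm (Gamma (\<beta> - \<zeta>)) = norm (\<zeta> + 1 - \<beta>) * norm (Gamma (\<beta> - (\<zeta> + 1)))"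
      if "Re \<beta> \<le> Re \<zeta>" for \<beta>
    proof -
      have "\<beta> - \<zeta> \<noteq> 1" using that by (auto simp: complex_eq_iff)
      from Gamma_eq_mult_Gamma_minus1[OF this] show ?thesis
        by (simp add: norm_mult norm_minus_commute[of "\<zeta> + 1" \<beta>] diff_diff_eq)
    qed
    let ?a = "norm (\<zeta> + 1 - \<beta>1)" and ?b = "norm (\<zeta> + 1 - \<beta>2)"
    let ?g1 = "norm (Gamma (\<beta>1 - (\<zeta> + 1)))" and ?g2 = "norm (Gamma (\<beta>2 - (\<zeta> + 1)))"
    have a: "?a \<ge> 1" using abs_Re_le_cmod[of "\<zeta> + 1 - \<beta>1"] \<zeta> by simp
    have b: "?b \<ge> 2 * Q" using abs_Re_le_cmod[of "\<zeta> + 1 - \<beta>2"] \<zeta> Q0 by simp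
    have "norm \<zeta> \<le> ?a + norm (1 - \<beta>1)" using norm_triangle_ineq4[of "\<zeta> + 1 - \<beta>1" "1 - \<beta>1"] by simp
    also have "\<dots> \<le> ?a + norm (1 - \<beta>1) * ?a" using a by (intro add_left_mono) (simp add: mult_le_cancel_left1)
    finally have n: "1 + norm \<zeta> \<le> (2 + norm (1 - \<beta>1)) * ?a" using a by (simp add: algebra_simps)
    have "norm (E (\<zeta> + 1)) \<le> \<bar>K\<bar> * (1 + norm \<zeta>) * norm (E \<zeta>)"
      using K[OF \<zeta>(1)] by (rule order.trans) (intro mult_right_mono, auto)
    also have "\<dots> \<le> \<bar>K\<bar> * ((2 + norm (1 - \<beta>1)) * ?a) * norm (E \<zeta>)"
      by (intro mult_right_mono mult_left_mono n) auto
    finally have e: "norm (E (\<zeta> + 1)) \<le> \<bar>K\<bar> * ((2 + norm (1 - \<beta>1)) * ?a) * norm (E \<zeta>)" .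
    have "norm (f l (\<zeta> + 1)) = ?g1 * ?g2 * norm (E (\<zeta> + 1)) * (norm (exp (\<zeta> * l)) * exp (Re l))"
      by (simp add: f_def norm_mult distrib_right exp_add)
    also have "\<dots> \<le> ?g1 * ?g2 * (\<bar>K\<bar> * ((2 + norm (1 - \<beta>1)) * ?a) * norm (E \<zeta>)) * (norm (exp (\<zeta> * l)) * exp (Re l))"
      by (intro mult_right_mono mult_left_mono e) auto
    also have "\<dots> = Q * (?a * ?g1 * ?g2 * norm (E \<zeta>) * norm (exp (\<zeta> * l)))"
      by (simp add: Q_def mult_ac)
    also have "\<dots> \<le> (?b / 2) * (?a * ?g1 * ?g2 * norm (E \<zeta>) * norm (exp (\<zeta> * l)))"
      using b by (intro mult_right_mono) auto
    also have "\<dots> = norm (f l \<zeta>) / 2"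
      using \<zeta> Q0 by (simp add: f_def norm_mult G mult_ac)
    finally show ?thesis .
  qed
  then show ?thesis by blast
qed

text \<open>If \<beta>1 - \<beta>2 is not integral, the two lattices are disjoint and every pole is
  simple. The leading minus sign stems from \<zeta> entering Gamma(\<beta>1 - \<zeta>)
  negatively.\<close>

lemma residue_f:
  assumes dif: "\<beta>1 - \<beta>2 \<notin> \<int>"
  shows "residue (f l) (\<beta>1 + of_nat k) = - ((-1) ^ k / fact k * Gamma (\<beta>2 - \<beta>1 - of_nat k) * E (\<beta>1 + of_nat k) * exp ((\<beta>1 + of_nat k) * l))"
proof -
  define b where "b = \<beta>1 + of_nat k"
  \<comment> \<open>An open strip with all poles except b removed.\<close>
  define S where "S = {z. \<bar>Re z\<bar> < \<bar>Re b\<bar> + 1} - ({z \<in> A \<union> B. \<bar>Re z\<bar> \<le> \<bar>Re b\<bar> + 1} - {b})"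
  have bB: "b \<in> right_lattice \<beta>1" by (auto simp: b_def right_lattice_def)
  then have bA: "b \<notin> A" using Adisj by blast
  have oS: "open S" unfolding S_def
    by (intro open_Diff finite_imp_closed finite_Diff finite_poles open_Collect_less continuous_intros)
  have bS: "b \<in> S" by (simp add: S_def)
  have "f l holomorphic_on S - {b}"
    by (rule holomorphic_on_subset[OF holf]) (auto simp: S_def)
  moreover have "((\<lambda>w. f l w * (w - b)) \<longlongrightarrow> - ((-1) ^ k / fact k * Gamma (\<beta>2 - b) * E b * exp (b * l))) (at b)"
  proof -
    have "filterlim (\<lambda>w. \<beta>1 - w) (at (- of_nat k)) (at b)"
      unfolding filterlim_at
    proof
      show "\<forall>\<^sub>F x in at b. \<beta>1 - x \<in> UNIV \<and> \<beta>1 - x \<noteq> - of_nat k"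
        using eventually_neq_at_within[of b b] by eventually_elim (auto simp: b_def algebra_simps)
      show "((\<lambda>w. \<beta>1 - w) \<longlongrightarrow> - of_nat k) (at b)"
        by (auto intro!: tendsto_eq_intros simp: b_def)
    qed
    from filterlim_compose[OF Gamma_residues this]
    have g: "((\<lambda>w. Gamma (\<beta>1 - w) * (\<beta>1 - w + of_nat k)) \<longlongrightarrow> (-1) ^ k / fact k) (at b)" by simp
    have nb: "\<beta>2 - b \<notin> \<int>\<^sub>\<le>\<^sub>0"
    proof
      assume "\<beta>2 - b \<in> \<int>\<^sub>\<le>\<^sub>0"
      then have "\<beta>2 - b \<in> \<int>" by (rule nonpos_Ints_Int)
      then have "- (\<beta>2 - b) - of_nat k \<in> \<int>" by (rule Ints_diff[OF Ints_minus Ints_of_nat])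
      then show False using dif by (simp add: b_def)
    qed
    have g2: "isCont (\<lambda>w. Gamma (\<beta>2 - w)) b" using nb by (intro continuous_intros)
    have "open (S - A \<inter> {z. \<bar>Re z\<bar> \<le> \<bar>Re b\<bar> + 1})"
      using oS finA[of "\<bar>Re b\<bar> + 1"] by (intro open_Diff finite_imp_closed) (auto simp: Int_def)
    moreover have "E holomorphic_on (S - A \<inter> {z. \<bar>Re z\<bar> \<le> \<bar>Re b\<bar> + 1})"
      by (rule holomorphic_on_subset[OF holE]) (auto simp: S_def)
    ultimately have "isCont E b"
      using bS bA holomorphic_on_imp_continuous_on continuous_on_eq_continuous_at by blast
    then have "isCont (\<lambda>w. Gamma (\<beta>2 - w) * E w * exp (w * l)) b"
      by (intro isCont_mult g2) (auto intro!: continuous_intros)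
    then have "((\<lambda>w. Gamma (\<beta>2 - w) * E w * exp (w * l)) \<longlongrightarrow> Gamma (\<beta>2 - b) * E b * exp (b * l)) (at b)"
      by (simp add: isCont_def)
    from tendsto_minus[OF tendsto_mult[OF g this]] show ?thesis
      by (simp add: f_def b_def algebra_simps)
  qed
  ultimately have "residue (f l) b = - ((-1) ^ k / fact k * Gamma (\<beta>2 - b) * E b * exp (b * l))"
    by (intro residue_simple'[OF oS bS])
  then show ?thesis by (simp add: b_def diff_diff_eq)
qed

end

lemma gamma_kernel_swap: "gamma_kernel \<beta>1 \<beta>2 E A \<kappa> h \<Longrightarrow> gamma_kernel \<beta>2 \<beta>1 E A \<kappa> h"
  unfolding gamma_kernel_def by (simp add: Un_commute)

context gamma_kernel
begin

lemma residue_f':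
  assumes dif: "\<beta>1 - \<beta>2 \<notin> \<int>"
  shows "residue (f l) (\<beta>2 + of_nat k) = - ((-1) ^ k / fact k * Gamma (\<beta>1 - \<beta>2 - of_nat k) * E (\<beta>2 + of_nat k) * exp ((\<beta>2 + of_nat k) * l))"
proof -
  interpret sw: gamma_kernel \<beta>2 \<beta>1 E A \<kappa> h using gamma_kernel_swap[OF gamma_kernel_axioms] .
  have "sw.f l = f l" by (auto simp: sw.f_def f_def mult_ac)
  moreover have "\<beta>2 - \<beta>1 \<notin> \<int>" using dif Ints_minus[of "\<beta>2 - \<beta>1"] by auto
  ultimately show ?thesis using sw.residue_f[of l k] by simp
qed

text \<open>The minus sign of the residues cancels the one from closing the contour on the right, so
  both series enter positively.\<close>

lemma barnes_integral_series:
  assumes l: "\<bar>Im l\<bar> + \<kappa> < pi" and dif: "\<beta>1 - \<beta>2 \<notin> \<int>" and bc: "barnes_contour A B R g"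
    and s1: "((\<lambda>k. (-1) ^ k / fact k * Gamma (\<beta>2 - \<beta>1 - of_nat k) * E (\<beta>1 + of_nat k) * exp ((\<beta>1 + of_nat k) * l)) has_sum S1) (UNIV::nat set)"
    and s2: "((\<lambda>k. (-1) ^ k / fact k * Gamma (\<beta>1 - \<beta>2 - of_nat k) * E (\<beta>2 + of_nat k) * exp ((\<beta>2 + of_nat k) * l)) has_sum S2) (UNIV::nat set)"
  shows "barnes_integral R g (f l) = 2 * of_real pi * \<i> * (S1 + S2)"
proof -
  interpret barnes_integrand A B "\<bar>h\<bar>" "f l" by (rule barnes_integrand[OF l])
  obtain N where N: "\<And>\<zeta>. N \<le> Re \<zeta> \<Longrightarrow> norm (f l (\<zeta> + 1)) \<le> norm (f l \<zeta>) / 2" using f_ratio by blast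
  have inj: "inj (\<lambda>k::nat. \<beta> + of_nat k)" for \<beta> :: complex by (auto simp: inj_def)
  have "(residue (f l) has_sum - S1) (right_lattice \<beta>1)"
    unfolding right_lattice_def has_sum_reindex[OF inj] o_def residue_f[OF dif] using s1 by (simp add: has_sum_uminus)
  moreover have "(residue (f l) has_sum - S2) (right_lattice \<beta>2)"
    unfolding right_lattice_def has_sum_reindex[OF inj] o_def residue_f'[OF dif] using s2 by (simp add: has_sum_uminus)
  moreover have "right_lattice \<beta>1 \<inter> right_lattice \<beta>2 = {}"
  proof -
    have "\<beta>1 + of_nat j \<noteq> \<beta>2 + of_nat k" for j k :: nat
    proof
      assume "\<beta>1 + of_nat j = \<beta>2 + of_nat k"
      then have "\<beta>1 - \<beta>2 = of_nat k - of_nat j" by (simp add: algebra_simps)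
      then show False using dif by simp
    qed
    then show ?thesis by (auto simp: right_lattice_def)
  qed
  ultimately have "(residue (f l) has_sum (- S1 + - S2)) B"
    unfolding B_def by (rule has_sum_Un_disjoint)
  from barnes_integral_eq_residues[OF bc this N] show ?thesis by (simp add: algebra_simps)
qed

end

section \<open>Series for Bessel functions\<close>

lemma of_nat_plus_1_neq_0: "of_nat n + 1 \<noteq> (0 :: complex)" "1 + of_nat n \<noteq> (0 :: complex)"
  by (metis of_nat_Suc of_nat_eq_0_iff nat.distinct(1) add.commute)+

text \<open>The recurrence has a quadratic factor on the left and a linear one on the right, so the
  quotient of consecutive coefficients is O(1/k) and the power series converges everywhere. The case
  q = 0 serves the Bessel series, q = 2 the Kummer series.\<close>

lemma summable_norm_Gamma_ratio:
  fixes a :: "nat \<Rightarrow> complex" and q s :: complex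
  assumes rec: "\<And>k. (of_nat k + 1) * (s + of_nat k) * a (Suc k) = (q * of_nat k + r) * a k"
  shows "summable (\<lambda>k. norm (a k * w ^ k))"
proof -
  \<comment> \<open>For k >= X both |s + k| >= k/2 and 4 (|q| + |r|) |w| <= k hold, which brings the
    ratio of terms down to 1/2.\<close>
  define X where "X = 4 * (norm q + norm r) * norm w + 2 * norm s + 1"
  have "norm (norm (a (Suc k) * w ^ Suc k)) \<le> 1 / 2 * norm (norm (a k * w ^ k))" if k: "k \<ge> nat \<lceil>X\<rceil>" for k
  proof -
    have kX: "X \<le> real k" using k by linarith
    have X0: "X \<ge> 1" "X \<ge> 2 * norm s" by (auto simp: X_def intro!: add_nonneg_nonneg)
    have s: "real k / 2 \<le> norm (s + of_nat k)"
      using norm_triangle_ineq4[of "s + of_nat k" s] kX X0 by simp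
    have n: "norm (q * of_nat k + r) \<le> (norm q + norm r) * real k"
    proof -
      have "norm (q * of_nat k + r) \<le> norm q * real k + norm r" by (rule order.trans[OF norm_triangle_ineq]) (simp add: norm_mult)
      also have "norm r \<le> norm r * real k" using kX X0 by (simp add: mult_le_cancel_left1)
      finally show ?thesis by (simp add: algebra_simps)
    qed
    have "norm ((of_nat k + 1) * (s + of_nat k) * a (Suc k)) = (real k + 1) * norm (s + of_nat k) * norm (a (Suc k))"
      by (simp add: norm_mult) (metis norm_of_nat of_nat_Suc add.commute)
    then have "(real k + 1) * norm (s + of_nat k) * norm (a (Suc k)) = norm (q * of_nat k + r) * norm (a k)"
      using rec[of k] by (simp add: norm_mult)
    moreover have "real k * (real k / 2) * norm (a (Suc k)) \<le> (real k + 1) * norm (s + of_nat k) * norm (a (Suc k))"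
      using s by (intro mult_right_mono mult_mono) auto
    moreover have "norm (q * of_nat k + r) * norm (a k) \<le> ((norm q + norm r) * real k) * norm (a k)"
      by (intro mult_right_mono n) auto
    ultimately have "real k * (real k / 2 * norm (a (Suc k))) \<le> real k * ((norm q + norm r) * norm (a k))"
      by (simp add: mult_ac)
    moreover have k0: "real k > 0" using kX X0 by linarith
    ultimately have "real k / 2 * norm (a (Suc k)) \<le> (norm q + norm r) * norm (a k)"
      by (metis mult_le_cancel_left_pos)
    then have "real k / 2 * norm (a (Suc k)) * norm w \<le> (norm q + norm r) * norm (a k) * norm w"
      by (intro mult_right_mono) auto
    also have "\<dots> = ((norm q + norm r) * norm w) * norm (a k)" by (simp add: mult_ac)
    also have "\<dots> \<le> (real k / 4) * norm (a k)"
    proof (intro mult_right_mono)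
      have "4 * ((norm q + norm r) * norm w) \<le> X" unfolding X_def using norm_ge_zero[of s] by (simp only: mult.assoc[symmetric])
      then show "(norm q + norm r) * norm w \<le> real k / 4" using kX by linarith
    qed auto
    finally have "norm (a (Suc k)) * norm w \<le> norm (a k) / 2" using k0 by (simp add: field_simps)
    then have "norm (a (Suc k)) * norm w * norm w ^ k \<le> norm (a k) / 2 * norm w ^ k"
      by (intro mult_right_mono) auto
    then show ?thesis by (simp add: norm_mult norm_power mult_ac)
  qed
  then show ?thesis by (intro summable_ratio_test[where c = "1/2" and N = "nat \<lceil>X\<rceil>"]) simp_all
qed

text \<open>The coefficients of the entire function of (z/2)^2 that remains when (z/2)^\<alpha> is
  split off from I_\<alpha>(z).\<close>

definition bessel_coeff :: "complex \<Rightarrow> nat \<Rightarrow> complex" where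
  "bessel_coeff \<alpha> k = rGamma (\<alpha> + of_nat k + 1) / fact k"

lemma bessel_coeff_rec: "(of_nat k + 1) * (\<alpha> + 1 + of_nat k) * bessel_coeff \<alpha> (Suc k) = bessel_coeff \<alpha> k"
proof -
  have "rGamma (\<alpha> + of_nat k + 1) = (\<alpha> + 1 + of_nat k) * rGamma (\<alpha> + of_nat (Suc k) + 1)"
    using rGamma_plus1[of "\<alpha> + of_nat k + 1"] by (simp add: add_ac)
  then show ?thesis using of_nat_plus_1_neq_0[of k] by (simp add: bessel_coeff_def add.commute[of 1 "of_nat k"] del: of_nat_add)
qed

lemma summable_bessel_coeff: "summable (\<lambda>k. norm (bessel_coeff \<alpha> k * w ^ k))"
  by (rule summable_norm_Gamma_ratio[where q = 0 and r = 1 and s = "\<alpha> + 1"]) (simp add: bessel_coeff_rec)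

lemma bessel_I_has_sum:
  assumes "z \<noteq> 0"
  shows "((\<lambda>k. rGamma (of_real \<alpha> + of_nat k + 1) / fact k * (z / 2) powr (of_real \<alpha> + 2 * of_nat k)) has_sum bessel_I \<alpha> z) (UNIV::nat set)"
    and "bessel_I \<alpha> z = exp (of_real \<alpha> * Ln (z / 2)) * (\<Sum>k. bessel_coeff (of_real \<alpha>) k * ((z / 2)\<^sup>2) ^ k)"
proof -
  have eq: "rGamma (of_real \<alpha> + of_nat k + 1) / fact k * (z / 2) powr (of_real \<alpha> + 2 * of_nat k) =
      exp (of_real \<alpha> * Ln (z / 2)) * (bessel_coeff (of_real \<alpha>) k * ((z / 2)\<^sup>2) ^ k)" for k :: nat
  proof -
    have "exp (Ln (z / 2)) = z / 2" using assms by simp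
    then have "exp (2 * of_nat k * Ln (z / 2)) = ((z / 2)\<^sup>2) ^ k"
      by (metis exp_of_nat_mult mult.assoc of_nat_mult of_nat_numeral power_mult)
    then show ?thesis using assms by (simp add: powr_def distrib_right exp_add bessel_coeff_def)
  qed
  have sm: "summable (\<lambda>k. norm (exp (of_real \<alpha> * Ln (z / 2)) * (bessel_coeff (of_real \<alpha>) k * ((z / 2)\<^sup>2) ^ k)))"
    unfolding norm_mult[of "exp _"] by (intro summable_mult summable_bessel_coeff)
  have "summable (\<lambda>k. bessel_coeff (of_real \<alpha>) k * ((z / 2)\<^sup>2) ^ k)"
    using summable_bessel_coeff by (rule summable_norm_cancel)
  then show "bessel_I \<alpha> z = exp (of_real \<alpha> * Ln (z / 2)) * (\<Sum>k. bessel_coeff (of_real \<alpha>) k * ((z / 2)\<^sup>2) ^ k)"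
    unfolding bessel_I_def eq by (rule suminf_mult)
  have "(\<lambda>k. exp (of_real \<alpha> * Ln (z / 2)) * (bessel_coeff (of_real \<alpha>) k * ((z / 2)\<^sup>2) ^ k)) sums bessel_I \<alpha> z"
    unfolding bessel_I_def eq using summable_norm_cancel[OF sm] by (rule summable_sums)
  from norm_summable_imp_has_sum[OF sm this]
  show "((\<lambda>k. rGamma (of_real \<alpha> + of_nat k + 1) / fact k * (z / 2) powr (of_real \<alpha> + 2 * of_nat k)) has_sum bessel_I \<alpha> z) UNIV"
    unfolding eq .
qed

text \<open>Kummer's second formula: both sides have coefficients with the same first-order recurrence, which for
  the product \<open>e\<^sup>w Y(w)\<close> comes from the Bessel equation \<open>w Y'' + (2\<alpha> + 1) Y' = w Y\<close>.\<close>

lemma kummer_second: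
  fixes \<alpha> w :: complex
  assumes \<alpha>: "2 * \<alpha> \<notin> \<int>"
  shows "((\<lambda>n. Gamma (\<alpha> + 1/2 + of_nat n) * rGamma (2 * \<alpha> + 1 + of_nat n) / fact n * (2 * w) ^ n) has_sum
      (of_real (sqrt pi) * exp (- 2 * \<alpha> * of_real (ln 2)) * exp w * (\<Sum>k. bessel_coeff \<alpha> k * ((w / 2)\<^sup>2) ^ k))) (UNIV::nat set)"
proof -
  \<comment> \<open>The Bessel sum rewritten as a power series in w itself, with only even powers;
    4^j comes from (w/2)^(2j).\<close>
  define y where "y n = (if even n then bessel_coeff \<alpha> (n div 2) / 4 ^ (n div 2) else 0)" for n
  define Y where "Y = Abs_fps y"
  define W where "W = fps_exp 1 * Y"
  define c where "c n = fps_nth W n" for n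
  define v where "v n = 2 ^ n * Gamma (\<alpha> + 1/2 + of_nat n) * rGamma (2 * \<alpha> + 1 + of_nat n) / fact n" for n
  \<comment> \<open>The factor between the two solutions of the recurrence, read off at n = 0 by
    Legendre's duplication formula.\<close>
  define k0 where "k0 = exp (2 * \<alpha> * of_real (ln 2)) / of_real (sqrt pi)"
  have yrec: "(of_nat n + 2) * (of_nat n + 2 + 2 * \<alpha>) * y (Suc (Suc n)) = y n" for n
  proof (cases "even n")
    case True
    then obtain j where j: "n = 2 * j" by (elim evenE)
    have "(of_nat n + 2) * (of_nat n + 2 + 2 * \<alpha>) * y (Suc (Suc n)) =
       ((of_nat j + 1) * (\<alpha> + 1 + of_nat j) * bessel_coeff \<alpha> (Suc j)) / 4 ^ j"
      by (simp add: y_def j field_simps)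
    then show ?thesis by (simp only: bessel_coeff_rec) (simp add: y_def j)
  qed (simp add: y_def)
  have y1: "y 1 = 0" by (simp add: y_def)
  let ?k = "fps_const (2 * \<alpha> + 1)"
  have ode: "fps_X * fps_deriv (fps_deriv Y) + ?k * fps_deriv Y = fps_X * Y"
  proof (rule fps_ext)
    fix n show "fps_nth (fps_X * fps_deriv (fps_deriv Y) + ?k * fps_deriv Y) n = fps_nth (fps_X * Y) n"
    proof (cases n)
      case (Suc m)
      then show ?thesis using yrec[of m] by (simp add: Y_def algebra_simps)
    qed (simp add: Y_def y1[simplified])
  qed
  have dW: "fps_deriv W = fps_exp 1 * (Y + fps_deriv Y)"
    "fps_deriv (fps_deriv W) = fps_exp 1 * (Y + 2 * fps_deriv Y + fps_deriv (fps_deriv Y))"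
    by (simp_all add: W_def algebra_simps)
  \<comment> \<open>Multiplication by the exponential turns Bessel's equation into Kummer's: the
    term w W cancels, and the coefficients of W obey a recurrence with only two terms.\<close>
  have "fps_X * fps_deriv (fps_deriv W) + ?k * fps_deriv W - 2 * fps_X * fps_deriv W - ?k * W =
      fps_exp 1 * (fps_X * fps_deriv (fps_deriv Y) + ?k * fps_deriv Y - fps_X * Y)"
    unfolding dW by (simp only: W_def) (simp add: algebra_simps)
  also have "\<dots> = 0" unfolding ode by simp
  finally have odeW: "fps_X * fps_deriv (fps_deriv W) + ?k * fps_deriv W = 2 * (fps_X * fps_deriv W) + ?k * W"
    by (simp add: algebra_simps)
  have crec: "(of_nat n + 1) * (of_nat n + 2 * \<alpha> + 1) * c (Suc n) = (2 * of_nat n + 2 * \<alpha> + 1) * c n" for n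
  proof -
    have two: "(2 :: complex fps) = fps_const 2" by (simp add: numeral_fps_const)
    have "fps_nth (fps_X * fps_deriv (fps_deriv W) + ?k * fps_deriv W) n = fps_nth (fps_const 2 * (fps_X * fps_deriv W) + ?k * W) n"
      using odeW by (simp add: two)
    then show ?thesis by (cases n) (auto simp: c_def algebra_simps)
  qed
  have n0: "2 * \<alpha> + 1 + of_nat n \<noteq> 0" for n
  proof
    assume "2 * \<alpha> + 1 + of_nat n = 0"
    then have "2 * \<alpha> = - of_nat (Suc n)" by (simp add: algebra_simps eq_neg_iff_add_eq_0)
    then show False using \<alpha> by (metis Ints_minus Ints_of_nat)
  qed
  have h0: "\<alpha> + 1/2 + of_nat n \<noteq> 0" for n
  proof
    assume "\<alpha> + 1/2 + of_nat n = 0"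
    then have "2 * \<alpha> + 1 + of_nat (2 * n) = 0" by (simp add: field_simps)
    then show False using n0[of "2 * n"] by simp
  qed
  have hn: "\<alpha> + 1/2 + of_nat n \<notin> \<int>\<^sub>\<le>\<^sub>0" for n
  proof
    assume "\<alpha> + 1/2 + of_nat n \<in> \<int>\<^sub>\<le>\<^sub>0"
    then obtain j :: nat where "\<alpha> + 1/2 + of_nat n = - of_nat j" by (elim nonpos_Ints_cases')
    then have "\<alpha> + 1/2 + of_nat n + of_nat j = 0" by simp
    then have "\<alpha> + 1/2 + of_nat (n + j) = 0" by (simp add: add_ac)
    then show False using h0 by blast
  qed
  have vrec: "(of_nat n + 1) * (of_nat n + 2 * \<alpha> + 1) * v (Suc n) = (2 * of_nat n + 2 * \<alpha> + 1) * v n" for n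
  proof -
    have g: "Gamma (\<alpha> + 1/2 + of_nat n + 1) = (\<alpha> + 1/2 + of_nat n) * Gamma (\<alpha> + 1/2 + of_nat n)"
      using hn by (rule Gamma_plus1)
    have r: "rGamma (2 * \<alpha> + 1 + of_nat n) = (2 * \<alpha> + 1 + of_nat n) * rGamma (2 * \<alpha> + 1 + of_nat n + 1)"
      by (rule rGamma_plus1[symmetric])
    have "(of_nat n + 1) * (of_nat n + 2 * \<alpha> + 1) * v (Suc n) =
        (of_nat n + 2 * \<alpha> + 1) * (2 * 2 ^ n * Gamma (\<alpha> + 1/2 + of_nat n + 1) * rGamma (2 * \<alpha> + 1 + of_nat n + 1)) / fact n"
      by (simp add: v_def add_ac divide_simps of_nat_plus_1_neq_0 del: of_nat_add)
    also have "\<dots> = (2 * of_nat n + 2 * \<alpha> + 1) * v n"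
      unfolding g v_def r by (simp add: field_simps)
    finally show ?thesis .
  qed
  \<comment> \<open>As 2\<alpha> is not integral, the leading factor (n + 1)(n + 2\<alpha> + 1)
    never vanishes, so the recurrence reduces the claim to n = 0.\<close>
  have cv: "c n = k0 * v n" for n
  proof (induction n)
    case 0
    have "c 0 = rGamma (\<alpha> + 1)" by (simp add: c_def W_def Y_def y_def bessel_coeff_def)
    moreover have "Gamma (\<alpha> + 1/2) * Gamma (\<alpha> + 1) = exp (- 2 * \<alpha> * of_real (ln 2)) * of_real (sqrt pi) * Gamma (2 * \<alpha> + 1)"
    proof -
      have "\<alpha> + 1/2 + 1/2 \<notin> \<int>\<^sub>\<le>\<^sub>0"
      proof
        assume "\<alpha> + 1/2 + 1/2 \<in> \<int>\<^sub>\<le>\<^sub>0"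
        then have "\<alpha> + 1 \<in> \<int>" by (auto dest: nonpos_Ints_Int)
        then have "2 * (\<alpha> + 1) - 2 \<in> \<int>" by (intro Ints_diff Ints_mult) auto
        then show False using \<alpha> by simp
      qed
      then show ?thesis
        using Gamma_legendre_duplication[of "\<alpha> + 1/2"] hn[of 0] by (simp add: algebra_simps)
    qed
    moreover have "Gamma (\<alpha> + 1) \<noteq> 0"
    proof -
      have "\<alpha> + 1 \<notin> \<int>\<^sub>\<le>\<^sub>0"
      proof
        assume "\<alpha> + 1 \<in> \<int>\<^sub>\<le>\<^sub>0"
        then have "2 * (\<alpha> + 1) - 2 \<in> \<int>" by (intro Ints_diff Ints_mult) (auto dest: nonpos_Ints_Int)
        then show False using \<alpha> by simp
      qed
      then show ?thesis by (simp add: Gamma_eq_zero_iff)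
    qed
    moreover have "Gamma (2 * \<alpha> + 1) \<noteq> 0"
    proof -
      have "2 * \<alpha> + 1 \<notin> \<int>\<^sub>\<le>\<^sub>0"
      proof
        assume "2 * \<alpha> + 1 \<in> \<int>\<^sub>\<le>\<^sub>0"
        then have "2 * \<alpha> + 1 - 1 \<in> \<int>" by (intro Ints_diff) (auto dest: nonpos_Ints_Int)
        then show False using \<alpha> by simp
      qed
      then show ?thesis by (simp add: Gamma_eq_zero_iff)
    qed
    ultimately have "c 0 * Gamma (\<alpha> + 1) = k0 * v 0 * Gamma (\<alpha> + 1)"
      by (simp add: v_def k0_def rGamma_inverse_Gamma field_simps exp_minus)
    then show ?case using \<open>Gamma (\<alpha> + 1) \<noteq> 0\<close> by simp
  next
    case (Suc n)
    have "(of_nat n + 1) * (of_nat n + 2 * \<alpha> + 1) * c (Suc n) = (of_nat n + 1) * (of_nat n + 2 * \<alpha> + 1) * (k0 * v (Suc n))"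
      using crec[of n] vrec[of n] Suc by (metis mult.left_commute)
    moreover note of_nat_plus_1_neq_0(1)[of n]
    moreover have "of_nat n + 2 * \<alpha> + 1 \<noteq> 0" using n0[of n] by (simp add: add_ac)
    ultimately show ?case by simp
  qed
  have sy: "(\<lambda>n. y n * w ^ n) sums (\<Sum>k. bessel_coeff \<alpha> k * ((w / 2)\<^sup>2) ^ k)" "summable (\<lambda>n. norm (y n * w ^ n))"
  proof -
    have inj: "strict_mono (\<lambda>k::nat. 2 * k)" by (auto simp: strict_mono_def)
    have z: "y n * w ^ n = 0" if "n \<notin> range (\<lambda>k. 2 * k)" for n
      using that by (auto simp: y_def elim!: evenE)
    have e: "(\<lambda>k. y (2 * k) * w ^ (2 * k)) = (\<lambda>k. bessel_coeff \<alpha> k * ((w / 2)\<^sup>2) ^ k)"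
      by (auto simp: y_def power_mult power_divide)
    have "summable (\<lambda>k. bessel_coeff \<alpha> k * ((w / 2)\<^sup>2) ^ k)"
      using summable_bessel_coeff by (rule summable_norm_cancel)
    then have "(\<lambda>k. y (2 * k) * w ^ (2 * k)) sums (\<Sum>k. bessel_coeff \<alpha> k * ((w / 2)\<^sup>2) ^ k)"
      unfolding e by (rule summable_sums)
    then show "(\<lambda>n. y n * w ^ n) sums (\<Sum>k. bessel_coeff \<alpha> k * ((w / 2)\<^sup>2) ^ k)"
      using sums_mono_reindex[OF inj, of "\<lambda>n. y n * w ^ n"] z by simp
    have "summable (\<lambda>k. norm (y (2 * k) * w ^ (2 * k)))"
      using summable_bessel_coeff[of \<alpha> "(w/2)\<^sup>2"] unfolding fun_cong[OF e] .
    then show "summable (\<lambda>n. norm (y n * w ^ n))"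
      using summable_mono_reindex[OF inj, of "\<lambda>n. norm (y n * w ^ n)"] z by simp
  qed
  have se: "(\<lambda>n. w ^ n / fact n) sums exp w" "summable (\<lambda>n. norm (w ^ n / fact n))"
    using exp_converges[of w] summable_norm_exp[of w] by (simp_all add: scaleR_conv_of_real divide_inverse mult.commute)
  have "(\<lambda>n. \<Sum>i\<le>n. (w ^ i / fact i) * (y (n - i) * w ^ (n - i))) sums ((\<Sum>n. w ^ n / fact n) * (\<Sum>n. y n * w ^ n))"
    by (rule Cauchy_product_sums[OF se(2) sy(2)])
  also have "(\<lambda>n. \<Sum>i\<le>n. (w ^ i / fact i) * (y (n - i) * w ^ (n - i))) = (\<lambda>n. c n * w ^ n)"
  proof
    fix n
    have "c n * w ^ n = (\<Sum>i\<le>n. 1 / fact i * y (n - i) * w ^ n)"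
      by (simp add: c_def W_def fps_mult_nth Y_def sum_distrib_right atMost_atLeast0)
    also have "\<dots> = (\<Sum>i\<le>n. (w ^ i / fact i) * (y (n - i) * w ^ (n - i)))"
      by (intro sum.cong refl) (simp flip: power_add)
    finally show "(\<Sum>i\<le>n. (w ^ i / fact i) * (y (n - i) * w ^ (n - i))) = c n * w ^ n" ..
  qed
  finally have sums: "(\<lambda>n. c n * w ^ n) sums (exp w * (\<Sum>k. bessel_coeff \<alpha> k * ((w / 2)\<^sup>2) ^ k))"
    using se(1) sy(1) by (simp add: sums_iff)
  have "summable (\<lambda>n. norm (c n * w ^ n))"
    by (rule summable_norm_Gamma_ratio[where q = 2 and r = "2 * \<alpha> + 1" and s = "2 * \<alpha> + 1"])
       (use crec in \<open>simp add: algebra_simps\<close>)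
  from norm_summable_imp_has_sum[OF this sums]
  have "((\<lambda>n. inverse k0 * (c n * w ^ n)) has_sum (inverse k0 * (exp w * (\<Sum>k. bessel_coeff \<alpha> k * ((w / 2)\<^sup>2) ^ k)))) UNIV"
    by (rule has_sum_cmult_right)
  moreover have "inverse k0 * (c n * w ^ n) = Gamma (\<alpha> + 1/2 + of_nat n) * rGamma (2 * \<alpha> + 1 + of_nat n) / fact n * (2 * w) ^ n" for n
    by (simp add: cv v_def k0_def power_mult_distrib)
  moreover have "inverse k0 = of_real (sqrt pi) * exp (- 2 * \<alpha> * of_real (ln 2))"
    by (simp add: k0_def exp_minus field_simps)
  ultimately show ?thesis by (simp add: mult_ac)
qed

section \<open>Continuity in the parameters\<close>

text \<open>The constant depends on w only through the range of Re w and the height h. This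
  uniformity supplies a single majorant when the parameters move.\<close>

lemma norm_Gamma_reflected_halfplane:
  fixes x0 m \<epsilon> h :: real
  assumes "0 < x0" "0 < \<epsilon>" "\<epsilon> < 1"
  shows "\<exists>C>0. \<forall>w t. x0 \<le> Re w \<and> Re w \<le> m \<and> Im w = h - t \<longrightarrow> norm (Gamma w) \<le> C * exp (- (pi/2 - \<epsilon>) * \<bar>t\<bar>)"
proof -
  obtain C where C: "C > 0" "\<And>w. x0 \<le> Re w \<Longrightarrow> Re w \<le> m \<Longrightarrow> norm (Gamma w) \<le> C * exp (- (pi/2 - \<epsilon>) * \<bar>Im w\<bar>)"
    using norm_Gamma_le_exp_right[OF assms(1,2), of m] by blast
  have pe: "pi / 2 - \<epsilon> > 0" using pi_gt3 assms by linarith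
  have "norm (Gamma w) \<le> (C * exp ((pi/2 - \<epsilon>) * \<bar>h\<bar>)) * exp (- (pi/2 - \<epsilon>) * \<bar>t\<bar>)"
    if w: "x0 \<le> Re w" "Re w \<le> m" "Im w = h - t" for w t
  proof -
    have "norm (Gamma w) \<le> C * exp (- (pi/2 - \<epsilon>) * \<bar>Im w\<bar>)" by (rule C(2)[OF w(1,2)])
    also have "exp (- (pi/2 - \<epsilon>) * \<bar>Im w\<bar>) \<le> exp (- (pi/2 - \<epsilon>) * (\<bar>t\<bar> - \<bar>h\<bar>))"
      using pe w(3) by (subst exp_le_cancel_iff, intro mult_left_mono_neg) auto
    also have "exp (- q * (a - b)) = exp (q * b) * exp (- q * a)" for q a b :: real
      by (simp add: algebra_simps flip: exp_add)
    finally show ?thesis using C(1) by (simp add: mult.assoc)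
  qed
  moreover have "C * exp ((pi/2 - \<epsilon>) * \<bar>h\<bar>) > 0" using C(1) by simp
  ultimately show ?thesis by blast
qed

lemma continuous_on_Gamma_comp:
  fixes f :: "_ \<Rightarrow> complex"
  assumes "continuous_on A f" "\<And>x. x \<in> A \<Longrightarrow> f x \<notin> \<int>\<^sub>\<le>\<^sub>0"
  shows "continuous_on A (\<lambda>x. Gamma (f x))"
  by (rule continuous_on_compose2[OF continuous_on_Gamma[of "f ` A"] assms(1)]) (use assms(2) in auto)

lemma Re_pos_imp_not_nonpos_Ints: "Re z > 0 \<Longrightarrow> z \<notin> \<int>\<^sub>\<le>\<^sub>0"
  by (auto elim!: nonpos_Ints_cases)

text \<open>Dominated convergence: once the parameters are near their limits, both Gamma arguments
  on the line have real part at least half the distance from the line to the nearest limiting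
  pole.\<close>

lemma kernel_line_tendsto:
  fixes b1 b2 l :: "nat \<Rightarrow> complex" and \<beta>1 \<beta>2 \<Lambda> :: complex and E :: "complex \<Rightarrow> complex"
  assumes b: "b1 \<longlonglongrightarrow> \<beta>1" "b2 \<longlonglongrightarrow> \<beta>2" "l \<longlonglongrightarrow> \<Lambda>"
    and im: "\<And>n. Im (b1 n) = h" "\<And>n. Im (b2 n) = h"
    and c: "c < Re \<beta>1" "c < Re \<beta>2"
    and E: "continuous_on UNIV (\<lambda>t. E (Complex c t))" "\<And>t. norm (E (Complex c t)) \<le> CE * exp (\<kappa> * \<bar>t\<bar>)"
    and \<Lambda>: "\<bar>Im \<Lambda>\<bar> + \<kappa> < pi"
  shows "(\<lambda>n. LINT t|lborel. Gamma (b1 n - Complex c t) * Gamma (b2 n - Complex c t) * E (Complex c t) * exp (Complex c t * l n))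
     \<longlonglongrightarrow> (LINT t|lborel. Gamma (\<beta>1 - Complex c t) * Gamma (\<beta>2 - Complex c t) * E (Complex c t) * exp (Complex c t * \<Lambda>))"
proof -
  \<comment> \<open>Two Gamma factors and the perturbation of Im l cost \<epsilon> each; the gap of
    at least 8\<epsilon> leaves a decay of rate \<epsilon> to the majorant.\<close>
  define \<epsilon> where "\<epsilon> = min (1/2) ((pi - \<kappa> - \<bar>Im \<Lambda>\<bar>) / 8)"
  have \<epsilon>: "0 < \<epsilon>" "\<epsilon> < 1" "8 * \<epsilon> \<le> pi - \<kappa> - \<bar>Im \<Lambda>\<bar>" using \<Lambda> by (auto simp: \<epsilon>_def min_def)
  \<comment> \<open>The horizontal distance from the line to the nearest limiting pole. Parameters
    may move by x0 / 2, which also explains the upper bound \<open>m\<close>.\<close>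
  define x0 where "x0 = min (Re \<beta>1) (Re \<beta>2) - c"
  define m where "m = max (Re \<beta>1) (Re \<beta>2) - c + x0"
  have x0: "x0 > 0" using c by (simp add: x0_def)
  then have x2: "x0 / 2 > 0" by simp
  obtain C where C: "C > 0" "\<And>w t. x0 / 2 \<le> Re w \<Longrightarrow> Re w \<le> m \<Longrightarrow> Im w = h - t \<Longrightarrow> norm (Gamma w) \<le> C * exp (- (pi/2 - \<epsilon>) * \<bar>t\<bar>)"
    using norm_Gamma_reflected_halfplane[OF x2 \<epsilon>(1,2), of m h] by blast
  have CE: "CE \<ge> 0" using order.trans[OF norm_ge_zero E(2)[of 0]] by simp
  define K where "K = C * C * CE * exp (\<bar>c\<bar> * (\<bar>Re \<Lambda>\<bar> + 1))"
  let ?F = "\<lambda>n t. Gamma (b1 n - Complex c t) * Gamma (b2 n - Complex c t) * E (Complex c t) * exp (Complex c t * l n)"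
  let ?G = "\<lambda>t. Gamma (\<beta>1 - Complex c t) * Gamma (\<beta>2 - Complex c t) * E (Complex c t) * exp (Complex c t * \<Lambda>)"
  have "\<forall>\<^sub>F n in sequentially. dist (b1 n) \<beta>1 < x0 / 2 \<and> dist (b2 n) \<beta>2 < x0 / 2 \<and> dist (l n) \<Lambda> < \<epsilon>"
    using b x0 \<epsilon>(1) by (intro eventually_conj tendstoD) auto
  then obtain N where N: "\<And>n. n \<ge> N \<Longrightarrow> dist (b1 n) \<beta>1 < x0 / 2 \<and> dist (b2 n) \<beta>2 < x0 / 2 \<and> dist (l n) \<Lambda> < \<epsilon>"
    by (auto simp: eventually_sequentially)
  have re: "x0 / 2 \<le> Re (w - Complex c t)" "Re (w - Complex c t) \<le> m"
    if "dist w \<beta> < x0 / 2" "\<beta> = \<beta>1 \<or> \<beta> = \<beta>2" for w \<beta> t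
  proof -
    have "\<bar>Re w - Re \<beta>\<bar> < x0 / 2" using that(1) abs_Re_le_cmod[of "w - \<beta>"] by (simp add: dist_norm)
    then have "Re w - Re \<beta> < x0 / 2" "Re \<beta> - Re w < x0 / 2" by linarith+
    then show "x0 / 2 \<le> Re (w - Complex c t)" "Re (w - Complex c t) \<le> m"
      using that(2) by (auto simp: x0_def m_def min_def max_def split: if_splits)
  qed
  have bound: "norm (?F n t) \<le> K * exp (- \<epsilon> * \<bar>t\<bar>)" if n: "n \<ge> N" for n t
  proof -
    have l: "\<bar>Re (l n)\<bar> \<le> \<bar>Re \<Lambda>\<bar> + 1" "\<bar>Im (l n)\<bar> \<le> \<bar>Im \<Lambda>\<bar> + \<epsilon>"
      using N[OF n] abs_Re_le_cmod[of "l n - \<Lambda>"] abs_Im_le_cmod[of "l n - \<Lambda>"] \<epsilon>(2) by (auto simp: dist_norm)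
    have "c * Re (l n) \<le> \<bar>c\<bar> * \<bar>Re (l n)\<bar>" by (metis abs_ge_self abs_mult)
    also have "\<dots> \<le> \<bar>c\<bar> * (\<bar>Re \<Lambda>\<bar> + 1)" using l by (intro mult_left_mono) auto
    finally have r: "c * Re (l n) \<le> \<bar>c\<bar> * (\<bar>Re \<Lambda>\<bar> + 1)" .
    have "- (t * Im (l n)) \<le> \<bar>t\<bar> * \<bar>Im (l n)\<bar>" by (metis abs_ge_minus_self abs_mult)
    also have "\<dots> \<le> \<bar>t\<bar> * (\<bar>Im \<Lambda>\<bar> + \<epsilon>)" using l by (intro mult_left_mono) auto
    finally have x: "norm (exp (Complex c t * l n)) \<le> exp (\<bar>c\<bar> * (\<bar>Re \<Lambda>\<bar> + 1)) * exp ((\<bar>Im \<Lambda>\<bar> + \<epsilon>) * \<bar>t\<bar>)"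
      using r by (simp add: mult.commute flip: exp_add)
    have "norm (?F n t) \<le> (C * exp (- (pi/2 - \<epsilon>) * \<bar>t\<bar>)) * (C * exp (- (pi/2 - \<epsilon>) * \<bar>t\<bar>)) *
         (CE * exp (\<kappa> * \<bar>t\<bar>)) * (exp (\<bar>c\<bar> * (\<bar>Re \<Lambda>\<bar> + 1)) * exp ((\<bar>Im \<Lambda>\<bar> + \<epsilon>) * \<bar>t\<bar>))"
      unfolding norm_mult using re N[OF n] C(1) CE
      by (intro mult_mono C(2) E(2) x) (auto simp: im)
    also have "\<dots> = K * (exp (- (pi/2 - \<epsilon>) * \<bar>t\<bar>) * exp (- (pi/2 - \<epsilon>) * \<bar>t\<bar>) * exp (\<kappa> * \<bar>t\<bar>) * exp ((\<bar>Im \<Lambda>\<bar> + \<epsilon>) * \<bar>t\<bar>))"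
      by (simp only: K_def mult_ac)
    also have "exp (- (pi/2 - \<epsilon>) * \<bar>t\<bar>) * exp (- (pi/2 - \<epsilon>) * \<bar>t\<bar>) * exp (\<kappa> * \<bar>t\<bar>) * exp ((\<bar>Im \<Lambda>\<bar> + \<epsilon>) * \<bar>t\<bar>)
        = exp ((\<kappa> + \<bar>Im \<Lambda>\<bar> - pi + 3 * \<epsilon>) * \<bar>t\<bar>)"
      by (simp add: algebra_simps flip: exp_add)
    also have "\<dots> \<le> exp (- \<epsilon> * \<bar>t\<bar>)"
      using \<epsilon> by (subst exp_le_cancel_iff, intro mult_right_mono) auto
    finally show ?thesis using C(1) CE by (simp add: K_def mult_left_mono)
  qed
  have cC: "continuous_on UNIV (Complex c)" unfolding Complex_eq[abs_def] by (intro continuous_intros)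
  have meas: "(\<lambda>t. Gamma (w1 - Complex c t) * Gamma (w2 - Complex c t) * E (Complex c t) * exp (Complex c t * u)) \<in> borel_measurable lborel"
    if "dist w1 \<beta>1 < x0 / 2" "dist w2 \<beta>2 < x0 / 2" for w1 w2 u
  proof -
    have np: "w - Complex c t \<notin> \<int>\<^sub>\<le>\<^sub>0" if "dist w \<beta> < x0 / 2" "\<beta> = \<beta>1 \<or> \<beta> = \<beta>2" for w \<beta> t
      by (rule Re_pos_imp_not_nonpos_Ints[OF less_le_trans[OF x2 re(1)[OF that]]])
    have "continuous_on UNIV (\<lambda>t. Gamma (w1 - Complex c t) * Gamma (w2 - Complex c t) * E (Complex c t) * exp (Complex c t * u))"
      using np[OF that(1)] np[OF that(2)]
      by (intro continuous_on_mult continuous_on_Gamma_comp continuous_on_diff continuous_on_const continuous_on_exp cC E(1)) auto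
    then show ?thesis using borel_measurable_continuous_onI by simp
  qed
  have "(\<lambda>n. LINT t|lborel. ?F (n + N) t) \<longlonglongrightarrow> (LINT t|lborel. ?G t)"
  proof (rule integral_dominated_convergence[where w = "\<lambda>t. K * exp (- \<epsilon> * \<bar>t\<bar>)"])
    show "?G \<in> borel_measurable lborel" using x0 by (intro meas) auto
    show "?F (n + N) \<in> borel_measurable lborel" for n using N[of "n + N"] by (intro meas) auto
    show "integrable lborel (\<lambda>t. K * exp (- \<epsilon> * \<bar>t\<bar>))"
      by (intro integrable_mult_right integrable_exp_minus_abs \<epsilon>)
    show "AE t in lborel. norm (?F (n + N) t) \<le> K * exp (- \<epsilon> * \<bar>t\<bar>)" for n
      by (intro AE_I2 bound) simp
    show "AE t in lborel. (\<lambda>n. ?F (n + N) t) \<longlonglongrightarrow> ?G t"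
    proof (intro AE_I2)
      fix t
      have "\<beta> - Complex c t \<notin> \<int>\<^sub>\<le>\<^sub>0" if "\<beta> = \<beta>1 \<or> \<beta> = \<beta>2" for \<beta>
        using c that by (auto elim!: nonpos_Ints_cases simp: complex_eq_iff)
      then have "(\<lambda>n. ?F n t) \<longlonglongrightarrow> ?G t"
        by (intro tendsto_intros b) auto
      then show "(\<lambda>n. ?F (n + N) t) \<longlonglongrightarrow> ?G t" by (rule LIMSEQ_ignore_initial_segment)
    qed
  qed
  then show ?thesis by (rule LIMSEQ_offset)
qed

context gamma_kernel
begin

lemma kernel_line_bound_E:
  assumes "\<And>a. a \<in> A \<Longrightarrow> Re a \<noteq> c"
  shows "continuous_on UNIV (\<lambda>t. E (Complex c t))" "\<exists>CE. \<forall>t. norm (E (Complex c t)) \<le> CE * exp (\<kappa> * \<bar>t\<bar>)"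
proof -
  have cC: "continuous_on UNIV (Complex c)" unfolding Complex_eq[abs_def] by (intro continuous_intros)
  show co: "continuous_on UNIV (\<lambda>t. E (Complex c t))"
    by (rule continuous_on_compose2[OF holomorphic_on_imp_continuous_on[OF holE] cC]) (use assms in force)
  obtain C T where C: "\<And>\<zeta>. \<bar>Re \<zeta>\<bar> \<le> \<bar>c\<bar> \<Longrightarrow> T \<le> \<bar>Im \<zeta>\<bar> \<Longrightarrow> norm (E \<zeta>) \<le> C * exp (\<kappa> * \<bar>Im \<zeta>\<bar>)"
    using stripE[of "\<bar>c\<bar>"] by blast
  have "compact ((\<lambda>t. E (Complex c t) * of_real (exp (- \<kappa> * \<bar>t\<bar>))) ` {-\<bar>T\<bar>..\<bar>T\<bar>})"
    by (intro compact_continuous_image continuous_intros continuous_on_subset[OF co]) auto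
  from compact_imp_bounded[OF this] obtain M where M: "\<And>t. \<bar>t\<bar> \<le> \<bar>T\<bar> \<Longrightarrow> norm (E (Complex c t)) * exp (- \<kappa> * \<bar>t\<bar>) \<le> M"
    by (fastforce simp: bounded_iff norm_mult)
  have "norm (E (Complex c t)) \<le> max C M * exp (\<kappa> * \<bar>t\<bar>)" for t
  proof (cases "T \<le> \<bar>t\<bar>")
    case True
    then have "norm (E (Complex c t)) \<le> C * exp (\<kappa> * \<bar>t\<bar>)" using C[of "Complex c t"] by simp
    also have "\<dots> \<le> max C M * exp (\<kappa> * \<bar>t\<bar>)" by (intro mult_right_mono) auto
    finally show ?thesis .
  next
    case False
    then have "norm (E (Complex c t)) \<le> M * exp (\<kappa> * \<bar>t\<bar>)" using M[of t] by (simp add: exp_minus field_simps)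
    also have "\<dots> \<le> max C M * exp (\<kappa> * \<bar>t\<bar>)" by (intro mult_right_mono) auto
    finally show ?thesis .
  qed
  then show "\<exists>CE. \<forall>t. norm (E (Complex c t)) \<le> CE * exp (\<kappa> * \<bar>t\<bar>)" by blast
qed

text \<open>With every pole of the two Gamma factors to the right of the line, only the finitely
  many poles of A to the right of it contribute residues.\<close>

lemma barnes_integral_left_line:
  assumes l: "\<bar>Im l\<bar> + \<kappa> < pi" and bc: "barnes_contour A B R g"
    and c: "c < Re \<beta>1" "c < Re \<beta>2" "\<And>a. a \<in> A \<Longrightarrow> Re a \<noteq> c"
  shows "barnes_integral R g (f l) = \<i> * (LINT t|lborel. f l (Complex c t)) +
    2 * of_real pi * \<i> * (\<Sum>a | a \<in> A \<and> c < Re a. residue (f l) a)"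
proof -
  interpret barnes_integrand A B "\<bar>h\<bar>" "f l" by (rule barnes_integrand[OF l])
  have "c < Re b" if "b \<in> B" for b using ReB[OF that] c by linarith
  then have e: "{b. b \<in> B \<and> Re b < c} = {}" and n: "\<And>z. z \<in> A \<union> B \<Longrightarrow> Re z \<noteq> c"
    using c(3) by force+
  show ?thesis using barnes_integral_eq_line[OF bc n] unfolding e by simp
qed

end

section \<open>Mellin--Barnes integral for the Macdonald function\<close>

lemma gamma_kernel_const: "Im \<beta>1 = h \<Longrightarrow> Im \<beta>2 = h \<Longrightarrow> gamma_kernel \<beta>1 \<beta>2 (\<lambda>_. 1) {} 0 h"
proof
  show "\<exists>C T. \<forall>\<zeta>. \<bar>Re \<zeta>\<bar> \<le> m \<and> T \<le> \<bar>Im \<zeta>\<bar> \<longrightarrow> norm (1::complex) \<le> C * exp (0 * \<bar>Im \<zeta>\<bar>)" for m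
    by (intro exI[of _ 1]) auto
  show "\<exists>K N. \<forall>\<zeta>. N \<le> Re \<zeta> \<longrightarrow> norm (1::complex) \<le> K * (1 + norm \<zeta>) * norm (1::complex)"
    by (intro exI[of _ 1]) auto
qed auto

text \<open>Nothing has to be kept on the left, so a constant positive graph suffices: all of B lies
  below it or beyond its right end.\<close>

lemma barnes_contour_right:
  assumes "\<And>b. b \<in> B \<Longrightarrow> Im b = h \<and> c < Re b"
  shows "\<exists>R g. barnes_contour {} B R g"
  by (rule barnes_contour_exists[where c = c and d = "c + 1" and h = h and \<phi> = "\<lambda>_. 1" and \<phi>' = "\<lambda>_. 0"])
     (use assms in auto)

text \<open>Reflection turns the Gamma factor of a residue into the 1/Gamma of the Bessel series.
  Shifting the sine by k pi gives the sign that cancels (-1)^k.\<close>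

lemma Gamma_reflect_term:
  fixes s :: complex
  assumes "s \<notin> \<int>"
  shows "(-1) ^ k * Gamma (- s - of_nat k) = - (of_real pi / sin (of_real pi * s)) * rGamma (s + of_nat k + 1)"
proof -
  have ni: "s + of_nat k \<notin> \<int>" using assms by (metis Ints_diff Ints_of_nat add_diff_cancel_right')
  have sn: "sin (of_real pi * s) \<noteq> 0"
  proof
    assume "sin (of_real pi * s) = 0"
    then obtain n :: int where "of_real pi * s = of_real (of_int n * pi)" by (auto simp: sin_eq_0)
    then have "s = of_int n" by simp
    then show False using assms by simp
  qed
  have "s + of_nat k + 1 \<notin> \<int>\<^sub>\<le>\<^sub>0"
  proof
    assume "s + of_nat k + 1 \<in> \<int>\<^sub>\<le>\<^sub>0"
    then have "s + of_nat k + 1 - 1 \<in> \<int>" by (intro Ints_diff) (auto dest: nonpos_Ints_Int)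
    then show False using ni by simp
  qed
  then have g: "Gamma (s + of_nat k + 1) \<noteq> 0" by (simp add: Gamma_eq_zero_iff)
  have "Gamma (- s - of_nat k) * Gamma (s + of_nat k + 1) = of_real pi / sin (of_real pi * (- s - of_nat k))"
    using Gamma_reflection_complex[of "- s - of_nat k"] by (simp only: diff_diff_eq2 minus_diff_eq diff_minus_eq_add add_ac)
  also have "sin (of_real pi * (- s - of_nat k)) = - ((-1) ^ k * sin (of_real pi * s))"
  proof -
    have "of_real pi * (- s - of_nat k) = - (of_real pi * s + of_nat k * of_real pi)" by (simp add: algebra_simps)
    then have "sin (of_real pi * (- s - of_nat k)) = - sin (of_real pi * s + of_nat k * of_real pi)" by (simp only: sin_minus)
    also have "sin (of_real pi * s + of_nat k * of_real pi) = (-1) ^ k * sin (of_real pi * s)"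
      by (induction k) (auto simp: distrib_right sin_add cos_add add.assoc[symmetric])
    finally show ?thesis .
  qed
  finally have X: "Gamma (- s - of_nat k) * Gamma (s + of_nat k + 1) = of_real pi / - ((-1) ^ k * sin (of_real pi * s))" .
  have "(-1) ^ k * Gamma (- s - of_nat k) * Gamma (s + of_nat k + 1) = (-1) ^ k * (of_real pi / - ((-1) ^ k * sin (of_real pi * s)))"
    by (simp only: mult.assoc X)
  also have "\<dots> = - (of_real pi / sin (of_real pi * s))" using sn by simp
  finally have "(-1) ^ k * Gamma (- s - of_nat k) * Gamma (s + of_nat k + 1) = - (of_real pi / sin (of_real pi * s))" .
  then have "(-1) ^ k * Gamma (- s - of_nat k) = - (of_real pi / sin (of_real pi * s)) / Gamma (s + of_nat k + 1)"
    using g by (intro eq_divide_imp)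
  then show ?thesis by (simp only: rGamma_inverse_Gamma divide_inverse mult_minus_left)
qed

lemma meijer_poles_simps:
  "meijer_poles_\<alpha> 0 \<alpha>s = {}"
  "meijer_poles_\<beta> 2 [\<beta>1, \<beta>2] = right_lattice \<beta>1 \<union> right_lattice \<beta>2"
  "meijer_poles_\<beta> 4 [\<beta>1, \<beta>2, \<beta>3, \<beta>4] = right_lattice \<beta>1 \<union> right_lattice \<beta>2 \<union> right_lattice \<beta>3 \<union> right_lattice \<beta>4"
  by (auto simp: meijer_poles_\<alpha>_def meijer_poles_\<beta>_def mem_right_lattice numeral_eq_Suc less_Suc_eq)

lemma abs_Im_Ln_lt:
  assumes "Re z > 0"
  shows "\<bar>Im (Ln z)\<bar> < pi / 2"
  using assms Re_Ln_pos_lt[of z] by (auto simp: complex_eq_iff)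

lemma Ln_scale:
  assumes "r > 0" "Re z > 0"
  shows "Ln (z * of_real r) = Ln z + of_real (ln r)"
  using assms Ln_times_of_real[of r z] by (auto simp: mult.commute complex_eq_iff)

lemma Ln_half: "Re z > 0 \<Longrightarrow> Ln (z / 2) = Ln z - of_real (ln 2)"
  using Ln_scale[of "1/2" z] by (simp add: ln_div)

lemma Ln_double: "Re z > 0 \<Longrightarrow> Ln (2 * z) = Ln z + of_real (ln 2)"
  using Ln_scale[of 2 z] by (simp add: mult.commute)

lemma cancel_2pi_i: "\<i> * A = 2 * of_real pi * \<i> * X \<Longrightarrow> A = 2 * of_real pi * X"
  by (simp add: mult.left_commute[of _ \<i>] mult.assoc)

lemma sin_of_real_pi: "sin (of_real pi * (of_real \<alpha> :: complex)) = of_real (sin (\<alpha> * pi))"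
  by (simp add: sin_of_real mult.commute flip: of_real_mult)

text \<open>The poles at \<alpha>/2 + k and -\<alpha>/2 + k yield the series of I_\<alpha> and
  I_{-\<alpha>}. The constant 4 pi is 2 pi from the residue theorem times the 2 in the normalisation
  pi/2 of K. The factor 1 is the function E of \<open>gamma_kernel\<close>, kept for syntactic
  agreement with \<open>f\<close>.\<close>

lemma bessel_K_quotient_line:
  assumes z: "Re z > 0" and \<alpha>: "\<alpha> \<notin> \<int>" and c: "2 * c < - \<bar>\<alpha>\<bar>"
  shows "(LINT t|lborel. Gamma (of_real \<alpha> / 2 - Complex c t) * Gamma (- of_real \<alpha> / 2 - Complex c t) * 1 * exp (Complex c t * (2 * Ln (z / 2))))
     = 4 * of_real pi * bessel_K_quotient \<alpha> z"
proof -
  let ?L = "Ln (z / 2)"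
  interpret gamma_kernel "of_real \<alpha> / 2" "- of_real \<alpha> / 2" "\<lambda>_. 1" "{}" 0 0 by (rule gamma_kernel_const) auto
  have l: "\<bar>Im (2 * ?L)\<bar> + 0 < pi" using abs_Im_Ln_lt[of "z / 2"] z by simp
  have z0: "z \<noteq> 0" using z by auto
  obtain R g where bc: "barnes_contour {} B R g"
    using barnes_contour_right[of B 0 c] ImB ReB c by (fastforce simp: min_def split: if_splits)
  have dif: "of_real \<alpha> / 2 - (- of_real \<alpha> / 2) \<notin> (\<int> :: complex set)"
    using \<alpha> by (simp add: of_real_in_Ints_iff)
  have trm: "((\<lambda>k. (-1) ^ k / fact k * Gamma (- of_real a - of_nat k) * 1 * exp ((of_real a / 2 + of_nat k) * (2 * ?L)))
      has_sum - (of_real pi / sin (of_real pi * of_real a)) * bessel_I a z) (UNIV :: nat set)" if a: "a \<notin> \<int>" for a :: real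
  proof -
    have a': "(of_real a :: complex) \<notin> \<int>" using a by (simp add: of_real_in_Ints_iff)
    have "(-1) ^ k / fact k * Gamma (- of_real a - of_nat k) * 1 * exp ((of_real a / 2 + of_nat k) * (2 * ?L)) =
       - (of_real pi / sin (of_real pi * of_real a)) *
       (rGamma (of_real a + of_nat k + 1) / fact k * (z / 2) powr (of_real a + 2 * of_nat k))" for k :: nat
    proof -
      have E: "(of_real a / 2 + of_nat k) * (2 * ?L) = (of_real a + 2 * of_nat k) * ?L" by (simp add: algebra_simps)
      have e: "exp ((of_real a / 2 + of_nat k) * (2 * ?L)) = (z / 2) powr (of_real a + 2 * of_nat k)"
        unfolding E using z0 by (simp add: powr_def)
      have "u / F * g * 1 * P = (u * g) / F * P" "- x * r / F * P = - x * (r / F * P)" for u F g P x r :: complex by simp_all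
      then show ?thesis unfolding e by (simp only: Gamma_reflect_term[OF a', of k])
    qed
    then show ?thesis by (simp only: has_sum_cmult_right[OF bessel_I_has_sum(1)[OF z0]])
  qed
  have m\<alpha>: "- \<alpha> \<notin> \<int>" using \<alpha> Ints_minus by fastforce
  have "barnes_integral R g (f (2 * ?L)) = 2 * of_real pi * \<i> *
     (- (of_real pi / sin (of_real pi * of_real \<alpha>)) * bessel_I \<alpha> z + - (of_real pi / sin (of_real pi * of_real (- \<alpha>))) * bessel_I (- \<alpha>) z)"
  proof (rule barnes_integral_series[OF l dif bc])
    have e1: "- of_real \<alpha> / 2 - of_real \<alpha> / 2 = (- of_real \<alpha> :: complex)" by simp
    show "((\<lambda>k. (-1) ^ k / fact k * Gamma (- of_real \<alpha> / 2 - of_real \<alpha> / 2 - of_nat k) * 1 * exp ((of_real \<alpha> / 2 + of_nat k) * (2 * ?L)))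
      has_sum - (of_real pi / sin (of_real pi * of_real \<alpha>)) * bessel_I \<alpha> z) (UNIV :: nat set)"
      unfolding e1 by (rule trm[OF \<alpha>])
    have e2: "of_real \<alpha> / 2 - - of_real \<alpha> / 2 = (- of_real (- \<alpha>) :: complex)" "- of_real \<alpha> / 2 = (of_real (- \<alpha>) / 2 :: complex)" by simp_all
    show "((\<lambda>k. (-1) ^ k / fact k * Gamma (of_real \<alpha> / 2 - - of_real \<alpha> / 2 - of_nat k) * 1 * exp ((- of_real \<alpha> / 2 + of_nat k) * (2 * ?L)))
      has_sum - (of_real pi / sin (of_real pi * of_real (- \<alpha>))) * bessel_I (- \<alpha>) z) (UNIV :: nat set)"
      unfolding e2(1) unfolding e2(2) by (rule trm[OF m\<alpha>])
  qed
  moreover have "barnes_integral R g (f (2 * ?L)) = \<i> * (LINT t|lborel. f (2 * ?L) (Complex c t))"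
    using barnes_integral_left_line[OF l bc, of c] c by simp
  ultimately have "(LINT t|lborel. f (2 * ?L) (Complex c t)) = 2 * of_real pi *
     (- (of_real pi / sin (of_real pi * of_real \<alpha>)) * bessel_I \<alpha> z + - (of_real pi / sin (of_real pi * of_real (- \<alpha>))) * bessel_I (- \<alpha>) z)"
    by (intro cancel_2pi_i) simp
  also have "sin (of_real pi * of_real (- \<alpha>)) = - (sin (of_real pi * of_real \<alpha>) :: complex)" by simp
  also have "2 * of_real pi * (- (of_real pi / S) * u + - (of_real pi / - S) * v) = 4 * of_real pi * (of_real (pi / 2) * (v - u) / S)" for S u v :: complex
    by (cases "S = 0") (simp_all add: field_simps)
  finally have "(LINT t|lborel. f (2 * ?L) (Complex c t)) = 4 * of_real pi * bessel_K_quotient \<alpha> z"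
    unfolding sin_of_real_pi bessel_K_quotient_def .
  then show ?thesis by (simp only: f_def)
qed

lemma macdonald_line_tendsto:
  fixes a :: "nat \<Rightarrow> real" and l :: "nat \<Rightarrow> complex"
  assumes "a \<longlonglongrightarrow> \<alpha>" "l \<longlonglongrightarrow> \<Lambda>" "2 * c < - \<bar>\<alpha>\<bar>" "\<bar>Im \<Lambda>\<bar> < pi"
  shows "(\<lambda>n. LINT t|lborel. Gamma (of_real (a n) / 2 - Complex c t) * Gamma (- of_real (a n) / 2 - Complex c t) * 1 * exp (Complex c t * l n))
     \<longlonglongrightarrow> (LINT t|lborel. Gamma (of_real \<alpha> / 2 - Complex c t) * Gamma (- of_real \<alpha> / 2 - Complex c t) * 1 * exp (Complex c t * \<Lambda>))"
  by (rule kernel_line_tendsto[where h = 0 and CE = 1 and \<kappa> = 0]) (use assms in \<open>auto intro!: tendsto_intros\<close>)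

text \<open>For integral \<alpha> the definition of K is a limit over orders near \<alpha>. The line
  integral is continuous in the order and equals the quotient at nearby non-integers.\<close>

lemma bessel_K_line:
  assumes z: "Re z > 0" and c: "2 * c < - \<bar>\<alpha>\<bar>"
  shows "(LINT t|lborel. Gamma (of_real \<alpha> / 2 - Complex c t) * Gamma (- of_real \<alpha> / 2 - Complex c t) * 1 * exp (Complex c t * (2 * Ln (z / 2))))
     = 4 * of_real pi * bessel_K \<alpha> z" (is "?I \<alpha> = _")
proof (cases "\<alpha> \<in> \<int>")
  case False
  then show ?thesis using bessel_K_quotient_line[OF z False c] by (simp add: bessel_K_def)
next
  case True
  have l: "\<bar>Im (2 * Ln (z / 2))\<bar> < pi" using abs_Im_Ln_lt[of "z / 2"] z by simp
  have "((\<lambda>a. bessel_K_quotient a z) \<longlongrightarrow> ?I \<alpha> / (4 * of_real pi)) (at \<alpha>)"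
    unfolding tendsto_at_iff_sequentially o_def
  proof (intro allI impI)
    fix X assume X: "\<forall>i. X i \<in> UNIV - {\<alpha>}" "X \<longlonglongrightarrow> \<alpha>"
    have "(\<lambda>n. ?I (X n)) \<longlonglongrightarrow> ?I \<alpha>" by (rule macdonald_line_tendsto[OF X(2) tendsto_const c l])
    then have "(\<lambda>n. ?I (X n) / (4 * of_real pi)) \<longlonglongrightarrow> ?I \<alpha> / (4 * of_real pi)" by (intro tendsto_intros) auto
    moreover have "\<forall>\<^sub>F n in sequentially. ?I (X n) / (4 * of_real pi) = bessel_K_quotient (X n) z"
    proof -
      \<comment> \<open>Distance below 1 from the integer \<alpha>, and not equal to it, excludes
        integers; the second bound keeps the line to the left of the moving poles.\<close>
      have "0 < min 1 (- \<bar>\<alpha>\<bar> - 2 * c)" using c by simp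
      from tendstoD[OF X(2) this] show ?thesis
      proof eventually_elim
        case (elim n)
        have "X n \<notin> \<int>"
        proof
          assume "X n \<in> \<int>"
          then have "X n - \<alpha> \<in> \<int>" using True by (rule Ints_diff)
          then obtain m :: int where m: "X n - \<alpha> = m" by (elim Ints_cases)
          then have "\<bar>real_of_int m\<bar> < 1" using elim by (simp add: dist_real_def)
          then have "m = 0" by linarith
          then show False using m X(1) by auto
        qed
        moreover have "2 * c < - \<bar>X n\<bar>" using elim by (auto simp: dist_real_def)
        ultimately show ?case using bessel_K_quotient_line[OF z, of "X n" c] by simp
      qed
    qed
    ultimately show "(\<lambda>n. bessel_K_quotient (X n) z) \<longlonglongrightarrow> ?I \<alpha> / (4 * of_real pi)"
      by (rule Lim_transform_eventually)
  qed
  then have "bessel_K \<alpha> z = ?I \<alpha> / (4 * of_real pi)"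
    using True by (simp add: bessel_K_def tendsto_Lim)
  then show ?thesis by simp
qed

lemma bessel_K_tendsto:
  fixes a :: "nat \<Rightarrow> real" and w :: "nat \<Rightarrow> complex"
  assumes a: "a \<longlonglongrightarrow> \<alpha>" and w: "w \<longlonglongrightarrow> z" and z: "Re z > 0"
  shows "(\<lambda>n. bessel_K (a n) (w n)) \<longlonglongrightarrow> bessel_K \<alpha> z"
proof -
  \<comment> \<open>The extra -1 leaves room for all orders at distance below 1 from \<alpha>, so
    one line serves the tail of the sequence.\<close>
  define c where "c = - \<bar>\<alpha>\<bar> / 2 - 1"
  have c: "2 * c < - \<bar>\<alpha>\<bar>" by (simp add: c_def)
  let ?I = "\<lambda>\<alpha> z. LINT t|lborel. Gamma (of_real \<alpha> / 2 - Complex c t) * Gamma (- of_real \<alpha> / 2 - Complex c t) * 1 * exp (Complex c t * (2 * Ln (z / 2)))"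
  have "z / 2 \<notin> \<real>\<^sub>\<le>\<^sub>0" using z by (auto simp: complex_nonpos_Reals_iff)
  then have "(\<lambda>n. 2 * Ln (w n / 2)) \<longlonglongrightarrow> 2 * Ln (z / 2)" by (intro tendsto_intros w) auto
  moreover have "\<bar>Im (2 * Ln (z / 2))\<bar> < pi" using abs_Im_Ln_lt[of "z / 2"] z by simp
  ultimately have "(\<lambda>n. ?I (a n) (w n)) \<longlonglongrightarrow> ?I \<alpha> z" by (intro macdonald_line_tendsto[OF a _ c])
  then have "(\<lambda>n. ?I (a n) (w n) / (4 * of_real pi)) \<longlonglongrightarrow> ?I \<alpha> z / (4 * of_real pi)" by (intro tendsto_intros) auto
  moreover have "\<forall>\<^sub>F n in sequentially. ?I (a n) (w n) / (4 * of_real pi) = bessel_K (a n) (w n)"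
  proof -
    have "\<forall>\<^sub>F n in sequentially. dist (a n) \<alpha> < 1" by (rule tendstoD[OF a]) simp
    moreover have "\<forall>\<^sub>F n in sequentially. Re (w n) > 0" using order_tendstoD(1)[OF tendsto_Re[OF w] z] .
    ultimately show ?thesis
    proof eventually_elim
      case (elim n)
      have "2 * c < - \<bar>a n\<bar>" using elim(1) by (auto simp: c_def dist_real_def)
      then show ?case using bessel_K_line[OF elim(2), of c "a n"] by simp
    qed
  qed
  ultimately have "(\<lambda>n. bessel_K (a n) (w n)) \<longlonglongrightarrow> ?I \<alpha> z / (4 * of_real pi)" by (rule Lim_transform_eventually)
  then show ?thesis using bessel_K_line[OF z c] by simp
qed

text \<open>Scaling z by r multiplies the integrand by r^(2\<zeta>), of modulus r^(2c) on the line.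
  As c may be arbitrarily negative, K decays along rays faster than any power.\<close>

lemma bessel_K_power_bound:
  assumes z: "Re z > 0" and c: "2 * c < - \<bar>\<alpha>\<bar>"
  shows "\<exists>C. \<forall>r>0. norm (bessel_K \<alpha> (z * of_real r)) \<le> C * r powr (2 * c)"
proof -
  let ?F = "\<lambda>l t. Gamma (of_real \<alpha> / 2 - Complex c t) * Gamma (- of_real \<alpha> / 2 - Complex c t) * 1 * exp (Complex c t * l)"
  let ?l = "2 * Ln (z / 2)"
  have "norm (bessel_K \<alpha> (z * of_real r)) \<le> (LINT t|lborel. norm (?F ?l t)) / (4 * pi) * r powr (2 * c)" if r: "r > 0" for r
  proof -
    have L: "2 * Ln (z * of_real r / 2) = ?l + of_real (2 * ln r)"
      using Ln_scale[of r "z / 2"] z r by (simp add: mult.commute distrib_left)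
    have "4 * of_real pi * bessel_K \<alpha> (z * of_real r) = (LINT t|lborel. ?F (2 * Ln (z * of_real r / 2)) t)"
      using bessel_K_line[of "z * of_real r" c \<alpha>] z r c by simp
    from arg_cong[OF this, of norm]
    have "4 * pi * norm (bessel_K \<alpha> (z * of_real r)) = norm (LINT t|lborel. ?F (2 * Ln (z * of_real r / 2)) t)"
      by (simp only: norm_mult norm_numeral norm_of_real abs_of_pos[OF pi_gt_zero])
    also have "\<dots> \<le> (LINT t|lborel. norm (?F (2 * Ln (z * of_real r / 2)) t))" by (rule integral_norm_bound)
    also have "(\<lambda>t. norm (?F (2 * Ln (z * of_real r / 2)) t)) = (\<lambda>t. norm (?F ?l t) * r powr (2 * c))"
    proof
      fix t
      have "norm (exp (Complex c t * (?l + of_real (2 * ln r)))) = norm (exp (Complex c t * ?l)) * r powr (2 * c)"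
        using r by (simp add: powr_def algebra_simps flip: exp_add)
      then show "norm (?F (2 * Ln (z * of_real r / 2)) t) = norm (?F ?l t) * r powr (2 * c)"
        unfolding L by (simp only: norm_mult mult.assoc)
    qed
    finally show ?thesis using pi_gt_zero by (simp add: field_simps)
  qed
  then show ?thesis by blast
qed

section \<open>The functions \<open>G\<^sup>2\<^sup>,\<^sup>0\<close> and \<open>G\<^sup>4\<^sup>,\<^sup>0\<close> without upper parameters\<close>

text \<open>Substitute \<zeta> + \<mu>/2 for \<zeta>: the real part of \<mu>/2 changes the abscissa,
  the imaginary part translates the variable of integration, and exp(\<mu> Ln(z/2)) splits
  off.\<close>

lemma macdonald_line_shift:
  assumes z: "Re z > 0" and c: "2 * c < Re \<mu> - \<bar>\<alpha>\<bar>"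
  shows "(LINT t|lborel. Gamma ((\<mu> + of_real \<alpha>) / 2 - Complex c t) * Gamma ((\<mu> - of_real \<alpha>) / 2 - Complex c t) * 1 * exp (Complex c t * (2 * Ln (z / 2))))
     = 4 * of_real pi * exp (\<mu> * Ln (z / 2)) * bessel_K \<alpha> z"
proof -
  let ?l = "2 * Ln (z / 2)"
  let ?c = "c - Re \<mu> / 2"
  have "(LINT t|lborel. Gamma ((\<mu> + of_real \<alpha>) / 2 - Complex c t) * Gamma ((\<mu> - of_real \<alpha>) / 2 - Complex c t) * 1 * exp (Complex c t * ?l)) =
     (LINT t|lborel. Gamma ((\<mu> + of_real \<alpha>) / 2 - Complex c (Im \<mu> / 2 + 1 * t)) * Gamma ((\<mu> - of_real \<alpha>) / 2 - Complex c (Im \<mu> / 2 + 1 * t)) * 1 *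
        exp (Complex c (Im \<mu> / 2 + 1 * t) * ?l))"
    by (subst lborel_integral_real_affine[of 1 _ "Im \<mu> / 2"]) auto
  also have "\<dots> = (LINT t|lborel. exp (\<mu> * Ln (z / 2)) * (Gamma (of_real \<alpha> / 2 - Complex ?c t) * Gamma (- of_real \<alpha> / 2 - Complex ?c t) * 1 * exp (Complex ?c t * ?l)))"
  proof (rule Bochner_Integration.integral_cong[OF refl])
    fix t
    have s: "Complex c (Im \<mu> / 2 + 1 * t) = \<mu> / 2 + Complex ?c t" by (simp add: complex_eq_iff)
    have "(\<mu> + of_real \<alpha>) / 2 - (\<mu> / 2 + Complex ?c t) = of_real \<alpha> / 2 - Complex ?c t"
      "(\<mu> - of_real \<alpha>) / 2 - (\<mu> / 2 + Complex ?c t) = - of_real \<alpha> / 2 - Complex ?c t"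
      "(\<mu> / 2 + Complex ?c t) * ?l = \<mu> * Ln (z / 2) + Complex ?c t * ?l" by (simp_all add: field_simps)
    then show "Gamma ((\<mu> + of_real \<alpha>) / 2 - Complex c (Im \<mu> / 2 + 1 * t)) * Gamma ((\<mu> - of_real \<alpha>) / 2 - Complex c (Im \<mu> / 2 + 1 * t)) * 1 *
        exp (Complex c (Im \<mu> / 2 + 1 * t) * ?l) =
        exp (\<mu> * Ln (z / 2)) * (Gamma (of_real \<alpha> / 2 - Complex ?c t) * Gamma (- of_real \<alpha> / 2 - Complex ?c t) * 1 * exp (Complex ?c t * ?l))"
      unfolding s by (simp only: exp_add mult_ac)
  qed
  also have "\<dots> = 4 * of_real pi * exp (\<mu> * Ln (z / 2)) * bessel_K \<alpha> z"
    using bessel_K_line[OF z, of ?c \<alpha>] c by simp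
  finally show ?thesis .
qed

lemma meijer_G20_02:
  assumes z: "Re z > 0"
  shows "meijer_G_Log 2 0 [] [(\<mu> + of_real \<alpha>) / 2, (\<mu> - of_real \<alpha>) / 2] (2 * Ln (z / 2)) = 2 * exp (\<mu> * Ln (z / 2)) * bessel_K \<alpha> z"
proof -
  let ?L = "Ln (z / 2)"
  define c where "c = (Re \<mu> - \<bar>\<alpha>\<bar>) / 2 - 1"
  interpret gamma_kernel "(\<mu> + of_real \<alpha>) / 2" "(\<mu> - of_real \<alpha>) / 2" "\<lambda>_. 1" "{}" 0 "Im \<mu> / 2" by (rule gamma_kernel_const) auto
  have l: "\<bar>Im (2 * ?L)\<bar> + 0 < pi" using abs_Im_Ln_lt[of "z / 2"] z by simp
  have c: "2 * c < Re \<mu> - \<bar>\<alpha>\<bar>" by (simp add: c_def field_simps)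
  have B: "meijer_poles_\<beta> 2 [(\<mu> + of_real \<alpha>) / 2, (\<mu> - of_real \<alpha>) / 2] = B" by (simp add: meijer_poles_simps B_def)
  have f: "meijer_integrand 2 0 [] [(\<mu> + of_real \<alpha>) / 2, (\<mu> - of_real \<alpha>) / 2] l = f l" for l
    by (auto simp: meijer_integrand_def f_def numeral_2_eq_2)
  show ?thesis
  proof (rule meijer_G_Log_eqI, unfold meijer_poles_simps(1) B f)
    have cB: "c < Re b" if "b \<in> B" for b using ReB[OF that] c by (auto simp: field_simps min_def split: if_splits)
    show "\<exists>R g. barnes_contour {} B R g" using barnes_contour_right[of B "Im \<mu> / 2" c] ImB cB by blast
    fix R g assume bc: "barnes_contour {} B R g"
    have "barnes_integral R g (f (2 * ?L)) = \<i> * (LINT t|lborel. f (2 * ?L) (Complex c t))"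
      using barnes_integral_left_line[OF l bc, of c] c by (auto simp: field_simps)
    also have "(LINT t|lborel. f (2 * ?L) (Complex c t)) = 4 * of_real pi * exp (\<mu> * ?L) * bessel_K \<alpha> z"
      unfolding f_def by (rule macdonald_line_shift[OF z c])
    finally show "barnes_integral R g (f (2 * ?L)) = 2 * of_real pi * \<i> * (2 * exp (\<mu> * ?L) * bessel_K \<alpha> z)"
      by (simp add: mult_ac)
  qed
qed

text \<open>The identity is demanded only above a height H because duplication formulas fail at the
  poles.\<close>

lemma strip_decay_rescale:
  assumes f: "strip_decay f" and g: "\<And>\<zeta>. H < \<bar>Im \<zeta>\<bar> \<Longrightarrow> g \<zeta> = K * f (2 * \<zeta>)"
  shows "strip_decay g"
  unfolding strip_decay_def
proof
  fix m
  obtain C \<delta> T where C: "0 < \<delta>" "\<And>\<zeta>. \<bar>Re \<zeta>\<bar> \<le> 2 * m \<Longrightarrow> T \<le> \<bar>Im \<zeta>\<bar> \<Longrightarrow> norm (f \<zeta>) \<le> C * exp (- \<delta> * \<bar>Im \<zeta>\<bar>)"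
    using f unfolding strip_decay_def by blast
  have "norm (g \<zeta>) \<le> (norm K * C) * exp (- (2 * \<delta>) * \<bar>Im \<zeta>\<bar>)" if "\<bar>Re \<zeta>\<bar> \<le> m" "max (\<bar>T\<bar>) (H + 1) \<le> \<bar>Im \<zeta>\<bar>" for \<zeta>
  proof -
    have "norm (g \<zeta>) = norm K * norm (f (2 * \<zeta>))" using that g[of \<zeta>] by (simp add: norm_mult)
    also have "\<dots> \<le> norm K * (C * exp (- \<delta> * \<bar>Im (2 * \<zeta>)\<bar>))" using that by (intro mult_left_mono C) auto
    finally show ?thesis by (simp add: mult_ac abs_mult)
  qed
  then show "\<exists>C \<delta> T. 0 < \<delta> \<and> (\<forall>\<zeta>. \<bar>Re \<zeta>\<bar> \<le> m \<and> T \<le> \<bar>Im \<zeta>\<bar> \<longrightarrow> norm (g \<zeta>) \<le> C * exp (- \<delta> * \<bar>Im \<zeta>\<bar>))"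
    using C(1) by (intro exI[of _ "norm K * C"] exI[of _ "2 * \<delta>"] exI[of _ "max \<bar>T\<bar> (H + 1)"]) simp
qed

lemma right_lattice_ImRe: "z \<in> right_lattice \<beta> \<Longrightarrow> Im z = Im \<beta> \<and> Re \<beta> \<le> Re z"
  by (auto simp: right_lattice_def)

text \<open>Legendre duplication on each pair b, b + 1/2 gives the integrand of G^{2,0}_{0,2} at
  2\<zeta>. The factor 2^(4\<zeta>) it produces changes 4 Ln(z/4) into 4 Ln(z/2), and the remaining
  constant is pi 2^(2 - \<mu>), as b1 + b3 = \<mu>/2.\<close>

lemma meijer_G40_04:
  assumes z: "Re z > 0"
  shows "meijer_G_Log 4 0 [] [(\<mu> + of_real \<alpha>) / 4, (\<mu> + of_real \<alpha>) / 4 + 1/2, (\<mu> - of_real \<alpha>) / 4, (\<mu> - of_real \<alpha>) / 4 + 1/2] (4 * Ln (z / 4))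
     = of_real pi * exp ((2 - \<mu>) * of_real (ln 2)) * exp (\<mu> * Ln (z / 2)) * bessel_K \<alpha> z"
proof -
  let ?L = "Ln (z / 2)"
  define b1 where "b1 = (\<mu> + of_real \<alpha>) / 4"
  define b3 where "b3 = (\<mu> - of_real \<alpha>) / 4"
  define B4 where "B4 = right_lattice b1 \<union> right_lattice (b1 + 1/2) \<union> right_lattice b3 \<union> right_lattice (b3 + 1/2)"
  define c where "c = (Re \<mu> - \<bar>\<alpha>\<bar>) / 4 - 1"
  define h where "h = Im \<mu> / 4"
  define K where "K = of_real pi * exp ((2 - \<mu>) * of_real (ln 2))"
  define f4 where "f4 = meijer_integrand 4 0 [] [b1, b1 + 1/2, b3, b3 + 1/2] (4 * Ln (z / 4))"
  have f4: "f4 \<zeta> = Gamma (b1 - \<zeta>) * Gamma (b1 + 1/2 - \<zeta>) * Gamma (b3 - \<zeta>) * Gamma (b3 + 1/2 - \<zeta>) * exp (\<zeta> * (4 * Ln (z / 4)))" for \<zeta>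
    by (simp add: f4_def meijer_integrand_def numeral_eq_Suc lessThan_Suc mult_ac)
  have imre: "Im b = h" "c < Re b" if "b \<in> B4" for b
  proof -
    have i: "Im b1 = h" "Im b3 = h" "c < Re b1" "c < Re b3"
      using abs_ge_self[of \<alpha>] abs_ge_minus_self[of \<alpha>] by (simp_all add: b1_def b3_def h_def c_def field_simps)
    from that consider "b \<in> right_lattice b1" | "b \<in> right_lattice (b1 + 1/2)" | "b \<in> right_lattice b3" | "b \<in> right_lattice (b3 + 1/2)"
      unfolding B4_def by blast
    then have "Im b = h \<and> c < Re b"
      by cases (use i in \<open>auto dest!: right_lattice_ImRe\<close>)
    then show "Im b = h" "c < Re b" by auto
  qed
  interpret gamma_kernel "(\<mu> + of_real \<alpha>) / 2" "(\<mu> - of_real \<alpha>) / 2" "\<lambda>_. 1" "{}" 0 "Im \<mu> / 2" by (rule gamma_kernel_const) auto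
  have l: "\<bar>Im (2 * ?L)\<bar> + 0 < pi" using abs_Im_Ln_lt[of "z / 2"] z by simp
  have L4: "Ln (z / 4) = ?L - of_real (ln 2)" using Ln_half[of "z / 2"] z by simp
  have leg: "Gamma (b - \<zeta>) * Gamma (b + 1/2 - \<zeta>) = exp ((1 - 2 * (b - \<zeta>)) * of_real (ln 2)) * of_real (sqrt pi) * Gamma (2 * b - 2 * \<zeta>)"
    if "b - \<zeta> \<notin> \<int>\<^sub>\<le>\<^sub>0" "b + 1/2 - \<zeta> \<notin> \<int>\<^sub>\<le>\<^sub>0" for b \<zeta> :: complex
  proof -
    have "b - \<zeta> + 1/2 = b + 1/2 - \<zeta>" by simp
    then show ?thesis using Gamma_legendre_duplication[of "b - \<zeta>"] that by (simp only:) (simp add: right_diff_distrib)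
  qed
  have resc: "f4 \<zeta> = K * f (2 * ?L) (2 * \<zeta>)" if "\<zeta> \<notin> B4" for \<zeta>
  proof -
    have n: "b1 - \<zeta> \<notin> \<int>\<^sub>\<le>\<^sub>0" "b1 + 1/2 - \<zeta> \<notin> \<int>\<^sub>\<le>\<^sub>0" "b3 - \<zeta> \<notin> \<int>\<^sub>\<le>\<^sub>0" "b3 + 1/2 - \<zeta> \<notin> \<int>\<^sub>\<le>\<^sub>0"
      using that by (auto simp: B4_def mem_right_lattice)
    have e: "exp ((1 - 2 * (b1 - \<zeta>)) * of_real (ln 2)) * exp ((1 - 2 * (b3 - \<zeta>)) * of_real (ln 2)) * exp (\<zeta> * (4 * Ln (z / 4)))
       = exp ((2 - \<mu>) * of_real (ln 2)) * exp (2 * \<zeta> * (2 * ?L))"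
      unfolding L4 exp_add[symmetric] by (rule arg_cong[where f = exp]) (simp add: b1_def b3_def field_simps)
    have s: "complex_of_real (sqrt pi) * of_real (sqrt pi) = of_real pi" by (simp flip: of_real_mult)
    have "f4 \<zeta> = (Gamma (b1 - \<zeta>) * Gamma (b1 + 1/2 - \<zeta>)) * (Gamma (b3 - \<zeta>) * Gamma (b3 + 1/2 - \<zeta>)) * exp (\<zeta> * (4 * Ln (z / 4)))"
      by (simp add: f4)
    also have "\<dots> = (exp ((1 - 2 * (b1 - \<zeta>)) * of_real (ln 2)) * exp ((1 - 2 * (b3 - \<zeta>)) * of_real (ln 2)) * exp (\<zeta> * (4 * Ln (z / 4)))) *
        (complex_of_real (sqrt pi) * of_real (sqrt pi)) * (Gamma (2 * b1 - 2 * \<zeta>) * Gamma (2 * b3 - 2 * \<zeta>))"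
      unfolding leg[OF n(1,2)] leg[OF n(3,4)] by (simp only: mult_ac)
    also have "\<dots> = K * (Gamma (2 * b1 - 2 * \<zeta>) * Gamma (2 * b3 - 2 * \<zeta>) * 1 * exp (2 * \<zeta> * (2 * ?L)))"
      unfolding e s K_def by (simp only: mult_ac mult_1_left)
    also have "2 * b1 = (\<mu> + of_real \<alpha>) / 2" by (simp add: b1_def)
    also have "2 * b3 = (\<mu> - of_real \<alpha>) / 2" by (simp add: b3_def)
    finally show ?thesis by (simp only: f_def)
  qed
  have dec: "strip_decay f4"
    by (rule strip_decay_rescale[OF decay[OF l], of "\<bar>h\<bar>" _ K]) (rule resc, use imre in force)
  have np: "\<zeta> \<notin> B4 \<Longrightarrow> b1 - \<zeta> \<notin> \<int>\<^sub>\<le>\<^sub>0 \<and> b1 + 1/2 - \<zeta> \<notin> \<int>\<^sub>\<le>\<^sub>0 \<and> b3 - \<zeta> \<notin> \<int>\<^sub>\<le>\<^sub>0 \<and> b3 + 1/2 - \<zeta> \<notin> \<int>\<^sub>\<le>\<^sub>0" for \<zeta>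
    by (auto simp: B4_def mem_right_lattice)
  interpret bi: barnes_integrand "{}" B4 "\<bar>h\<bar>" f4
  proof
    show "f4 holomorphic_on - ({} \<union> B4)"
      unfolding f4[abs_def] using np by (intro holomorphic_intros) auto
    show "finite {z \<in> {} \<union> B4. \<bar>Re z\<bar> \<le> r}" for r
    proof -
      have "{z \<in> {} \<union> B4. \<bar>Re z\<bar> \<le> r} = {z \<in> right_lattice b1. \<bar>Re z\<bar> \<le> r} \<union> {z \<in> right_lattice (b1 + 1/2). \<bar>Re z\<bar> \<le> r} \<union>
          {z \<in> right_lattice b3. \<bar>Re z\<bar> \<le> r} \<union> {z \<in> right_lattice (b3 + 1/2). \<bar>Re z\<bar> \<le> r}"
        by (auto simp: B4_def)
      then show ?thesis using finite_right_lattice by simp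
    qed
    show "\<exists>l. \<forall>b\<in>B4. l \<le> Re b" using imre(2) less_imp_le by blast
  qed (use dec imre in auto)
  show ?thesis
    unfolding b1_def[symmetric] b3_def[symmetric]
  proof (rule meijer_G_Log_eqI, unfold meijer_poles_simps(1,3) B4_def[symmetric] f4_def[symmetric])
    show "\<exists>R g. barnes_contour {} B4 R g" using barnes_contour_right[of B4 h c] imre by blast
    fix R g assume bc: "barnes_contour {} B4 R g"
    have e: "{b. b \<in> B4 \<and> Re b < c} = {}" using imre(2) by force
    have "Re z \<noteq> c" if "z \<in> {} \<union> B4" for z using imre(2)[of z] that by auto
    from bi.barnes_integral_eq_line[OF bc this]
    have "barnes_integral R g f4 = \<i> * (LINT t|lborel. f4 (Complex c t))"
      unfolding e by simp
    also have "(LINT t|lborel. f4 (Complex c t)) = (LINT t|lborel. K * f (2 * ?L) (Complex (2 * c) (2 * t)))"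
    proof (rule Bochner_Integration.integral_cong[OF refl])
      fix t
      have "Complex c t \<notin> B4" using imre(2)[of "Complex c t"] by auto
      moreover have "2 * Complex c t = Complex (2 * c) (2 * t)" by (simp add: complex_eq_iff)
      ultimately show "f4 (Complex c t) = K * f (2 * ?L) (Complex (2 * c) (2 * t))" using resc by metis
    qed
    also have "\<dots> = K * (LINT t|lborel. f (2 * ?L) (Complex (2 * c) (2 * t)))" by simp
    \<comment> \<open>The substitution 2t halves the integral, so 4 pi becomes the 2 pi expected of
      a Barnes integral.\<close>
    also have "(LINT t|lborel. f (2 * ?L) (Complex (2 * c) (2 * t))) = (LINT t|lborel. f (2 * ?L) (Complex (2 * c) t)) / 2"
      using lborel_integral_real_affine[of 2 "\<lambda>t. f (2 * ?L) (Complex (2 * c) t)" 0]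
      by (simp add: scaleR_conv_of_real)
    also have "(LINT t|lborel. f (2 * ?L) (Complex (2 * c) t)) = 4 * of_real pi * exp (\<mu> * ?L) * bessel_K \<alpha> z"
      unfolding f_def by (rule macdonald_line_shift[OF z]) (simp add: c_def field_simps)
    finally show "barnes_integral R g f4 = 2 * of_real pi * \<i> * (of_real pi * exp ((2 - \<mu>) * of_real (ln 2)) * exp (\<mu> * ?L) * bessel_K \<alpha> z)"
      by (simp add: K_def mult_ac)
  qed
qed

section \<open>The functions with one upper parameter\<close>

text \<open>In Kummer's formula at w = z or w = -z the Bessel sum depends only on w^2, so one
  formula serves both signs of the exponential. Splitting off (2z)^a accounts for the powers of
  2.\<close>

lemma kummer_bessel_I:
  assumes z: "Re z > 0" and a: "2 * a \<notin> \<int>" and \<sigma>: "\<sigma> = 1 \<or> \<sigma> = (-1 :: complex)"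
  shows "((\<lambda>k. Gamma (of_real a + 1/2 + of_nat k) * rGamma (2 * of_real a + 1 + of_nat k) / fact k * (\<sigma> ^ k * exp ((of_real a + of_nat k) * Ln (2 * z))))
     has_sum (of_real (sqrt pi) * exp (\<sigma> * z) * bessel_I a z)) (UNIV :: nat set)"
proof -
  have z0: "z \<noteq> 0" using z by auto
  have "2 * (of_real a :: complex) \<notin> \<int>" using a by (metis of_real_in_Ints_iff of_real_mult of_real_numeral)
  from has_sum_cmult_right[OF kummer_second[OF this, of "\<sigma> * z"], of "exp (of_real a * Ln (2 * z))"]
  have "((\<lambda>k. exp (of_real a * Ln (2 * z)) * (Gamma (of_real a + 1/2 + of_nat k) * rGamma (2 * of_real a + 1 + of_nat k) / fact k * (2 * (\<sigma> * z)) ^ k))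
     has_sum (exp (of_real a * Ln (2 * z)) * (of_real (sqrt pi) * exp (- 2 * of_real a * of_real (ln 2)) * exp (\<sigma> * z) *
       (\<Sum>k. bessel_coeff (of_real a) k * ((\<sigma> * z / 2)\<^sup>2) ^ k)))) (UNIV :: nat set)" .
  also have "(\<sigma> * z / 2)\<^sup>2 = (z / 2)\<^sup>2" using \<sigma> by (auto simp: power_divide)
  also have "exp (of_real a * Ln (2 * z)) * (of_real (sqrt pi) * exp (- 2 * of_real a * of_real (ln 2)) * exp (\<sigma> * z) *
       (\<Sum>k. bessel_coeff (of_real a) k * ((z / 2)\<^sup>2) ^ k)) =
       of_real (sqrt pi) * exp (\<sigma> * z) * bessel_I a z"
  proof -
    have "exp (of_real a * Ln (2 * z)) * exp (- 2 * of_real a * of_real (ln 2)) = exp (of_real a * Ln (z / 2))"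
      unfolding Ln_half[OF z] Ln_double[OF z] exp_add[symmetric] by (rule arg_cong[where f = exp]) (simp add: algebra_simps)
    moreover have "u * (s * v * w * S) = s * w * ((u * v) * S)" for u s v w S :: complex by (simp only: mult_ac)
    ultimately show ?thesis unfolding bessel_I_has_sum(2)[OF z0] by (simp only:)
  qed
  also have "(\<lambda>k. exp (of_real a * Ln (2 * z)) * (Gamma (of_real a + 1/2 + of_nat k) * rGamma (2 * of_real a + 1 + of_nat k) / fact k * (2 * (\<sigma> * z)) ^ k)) =
     (\<lambda>k. Gamma (of_real a + 1/2 + of_nat k) * rGamma (2 * of_real a + 1 + of_nat k) / fact k * (\<sigma> ^ k * exp ((of_real a + of_nat k) * Ln (2 * z))))"
  proof
    fix k
    have "exp (of_nat k * Ln (2 * z)) = (2 * z) ^ k" using z0 by (simp add: exp_of_nat_mult)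
    then have "exp (of_real a * Ln (2 * z)) * (2 * (\<sigma> * z)) ^ k = \<sigma> ^ k * exp ((of_real a + of_nat k) * Ln (2 * z))"
      by (simp add: distrib_right exp_add power_mult_distrib mult_ac)
    then show "exp (of_real a * Ln (2 * z)) * (Gamma (of_real a + 1/2 + of_nat k) * rGamma (2 * of_real a + 1 + of_nat k) / fact k * (2 * (\<sigma> * z)) ^ k) =
      Gamma (of_real a + 1/2 + of_nat k) * rGamma (2 * of_real a + 1 + of_nat k) / fact k * (\<sigma> ^ k * exp ((of_real a + of_nat k) * Ln (2 * z)))"
      by (simp only: mult.left_commute[of "exp (of_real a * Ln (2 * z))"])
  qed
  finally show ?thesis .
qed

text \<open>Reflection at w = a + 1/2 + k, where sin(pi w) = (-1)^k cos(pi a).\<close>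

lemma rGamma_reflect_half:
  fixes a :: real
  assumes "2 * a \<notin> \<int>"
  shows "rGamma (1/2 - (of_real a + of_nat k) :: complex) = (-1) ^ k * (of_real (cos (a * pi) / pi) * Gamma (of_real a + 1/2 + of_nat k))"
proof -
  let ?w = "of_real a + 1/2 + of_nat k :: complex"
  have "?w \<notin> \<int>\<^sub>\<le>\<^sub>0"
  proof
    assume "?w \<in> \<int>\<^sub>\<le>\<^sub>0"
    then have "2 * ?w - of_nat (2 * k + 1) \<in> \<int>" by (intro Ints_diff Ints_mult) (auto dest: nonpos_Ints_Int)
    moreover have "2 * ?w - of_nat (2 * k + 1) = of_real (2 * a)" by (simp add: algebra_simps)
    ultimately show False using assms by (simp only: of_real_in_Ints_iff)
  qed
  then have g: "Gamma ?w \<noteq> 0" by (simp add: Gamma_eq_zero_iff)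
  have s: "sin (of_real pi * ?w) = (-1) ^ k * of_real (cos (a * pi))"
  proof -
    have "of_real pi * ?w = of_real (pi * a + pi / 2 + real k * pi)" by (simp add: algebra_simps)
    then have "sin (of_real pi * ?w) = of_real (sin (pi * a + pi / 2 + real k * pi))" by (simp only: sin_of_real)
    also have "sin (x + real k * pi) = (-1) ^ k * sin x" for x :: real
      by (induction k) (auto simp: distrib_right sin_add cos_add add.assoc[symmetric])
    finally show ?thesis by (simp add: sin_add mult.commute)
  qed
  have "1 - ?w = 1/2 - (of_real a + of_nat k)" by (simp add: algebra_simps)
  with Gamma_reflection_complex[of ?w] s
  have r: "Gamma ?w * Gamma (1/2 - (of_real a + of_nat k)) = of_real pi / ((-1) ^ k * of_real (cos (a * pi)))" by simp
  have cn: "cos (a * pi) \<noteq> 0"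
  proof
    assume "cos (a * pi) = 0"
    then obtain n :: int where "a * pi = of_int n * (pi / 2)" by (auto simp: cos_zero_iff_int)
    then have "2 * a = of_int n" by (simp add: field_simps)
    then show False using assms by simp
  qed
  have "inverse Y = X / (X * Y)" if "X \<noteq> 0" for X Y :: complex using that by (simp add: divide_inverse)
  from this[OF g] have "inverse (Gamma (1/2 - (of_real a + of_nat k))) = Gamma ?w / (of_real pi / ((-1) ^ k * of_real (cos (a * pi))))"
    unfolding r[symmetric] .
  also have "X / (of_real pi / ((-1) ^ k * of_real (cos (a * pi)))) = (-1) ^ k * (of_real (cos (a * pi) / pi) * X)" for X :: complex
    by simp
  finally show ?thesis by (simp only: rGamma_inverse_Gamma)
qed

lemma sin_2pi_of_real: "sin (of_real pi * (2 * of_real a :: complex)) = of_real (2 * sin (a * pi) * cos (a * pi))"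
proof -
  have "of_real pi * (2 * of_real a :: complex) = of_real (2 * (a * pi))" by simp
  then show ?thesis by (simp only: sin_of_real sin_double)
qed

lemma sequence_avoiding_half_integers:
  fixes \<alpha> :: real
  shows "\<exists>X. X \<longlonglongrightarrow> \<alpha> \<and> (\<forall>n. 2 * X n \<notin> \<int>)"
proof -
  have "X \<longlonglongrightarrow> \<alpha> \<and> (\<forall>n. 2 * X n \<notin> \<int>)" if "2 * \<alpha> \<notin> \<int>" "X = (\<lambda>_. \<alpha>)" for X :: "nat \<Rightarrow> real" using that by simp
  \<comment> \<open>The offset 3 makes 2 / (n + 3) lie strictly between 0 and 1 for every n.\<close>
  moreover have "(\<lambda>n. \<alpha> + 1 / real (n + 3)) \<longlonglongrightarrow> \<alpha> \<and> (\<forall>n. 2 * (\<alpha> + 1 / real (n + 3)) \<notin> \<int>)" if i: "2 * \<alpha> \<in> \<int>"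
  proof (intro conjI allI notI)
    have "(\<lambda>n. 1 / real (n + 3)) \<longlonglongrightarrow> 0" by (rule LIMSEQ_ignore_initial_segment[OF lim_1_over_n])
    from tendsto_add[OF tendsto_const[of \<alpha>] this] show "(\<lambda>n. \<alpha> + 1 / real (n + 3)) \<longlonglongrightarrow> \<alpha>" by simp
    fix n assume "2 * (\<alpha> + 1 / real (n + 3)) \<in> \<int>"
    from Ints_diff[OF this i] have "2 / real (n + 3) \<in> \<int>" by (simp add: algebra_simps)
    then obtain m :: int where m: "2 / real (n + 3) = m" by (elim Ints_cases)
    have "0 < 2 / real (n + 3)" "2 / real (n + 3) < 1" by (auto simp: field_simps)
    then show False unfolding m by simp
  qed
  ultimately show ?thesis by blast
qed

text \<open>1/Gamma grows with any rate above pi/2, so convergence requires |arg(2z)| < pi/2 -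
  \<epsilon>. \<open>growth_rate_margin\<close> chooses \<epsilon> according to z.\<close>

lemma gamma_kernel_rGamma:
  assumes "0 < \<epsilon>" "Im \<beta>1 = 0" "Im \<beta>2 = 0"
  shows "gamma_kernel \<beta>1 \<beta>2 (\<lambda>\<zeta>. rGamma (1/2 - \<zeta>)) {} (pi / 2 + \<epsilon>) 0"
proof
  show "\<exists>C T. \<forall>\<zeta>. \<bar>Re \<zeta>\<bar> \<le> m \<and> T \<le> \<bar>Im \<zeta>\<bar> \<longrightarrow> norm (rGamma (1/2 - \<zeta>)) \<le> C * exp ((pi / 2 + \<epsilon>) * \<bar>Im \<zeta>\<bar>)" for m
  proof -
    obtain C where C: "\<And>w. \<bar>Re w\<bar> \<le> m + 1 \<Longrightarrow> norm (rGamma w) \<le> C * exp ((pi/2 + \<epsilon>) * \<bar>Im w\<bar>)"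
      using norm_rGamma_le_exp_strip[OF assms(1), of "m + 1"] by blast
    have "norm (rGamma (1/2 - \<zeta>)) \<le> C * exp ((pi / 2 + \<epsilon>) * \<bar>Im \<zeta>\<bar>)" if "\<bar>Re \<zeta>\<bar> \<le> m" for \<zeta>
    proof -
      have "\<bar>Re (1/2 - \<zeta>)\<bar> \<le> m + 1" using that by simp
      from C[OF this] show ?thesis by simp
    qed
    then show ?thesis by blast
  qed
  show "\<exists>K N. \<forall>\<zeta>. N \<le> Re \<zeta> \<longrightarrow> norm (rGamma (1/2 - (\<zeta> + 1))) \<le> K * (1 + norm \<zeta>) * norm (rGamma (1/2 - \<zeta>))"
  proof (intro exI[of _ 1] exI[of _ 0] allI impI)
    fix \<zeta> :: complex
    have "rGamma (1/2 - (\<zeta> + 1)) = (1/2 - (\<zeta> + 1)) * rGamma (1/2 - \<zeta>)"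
      using rGamma_plus1[of "1/2 - (\<zeta> + 1)"] by simp
    moreover have "norm (1/2 - (\<zeta> + 1)) \<le> 1 + norm \<zeta>"
    proof -
      have "1/2 - (\<zeta> + 1) = - (1/2) - \<zeta>" by simp
      then show ?thesis using norm_triangle_ineq4[of "- (1/2)" \<zeta>] by (simp only:) simp
    qed
    ultimately show "norm (rGamma (1/2 - (\<zeta> + 1))) \<le> 1 * (1 + norm \<zeta>) * norm (rGamma (1/2 - \<zeta>))"
      by (simp only: norm_mult mult_1_left mult_right_mono norm_ge_zero)
  qed
qed (use assms in \<open>auto intro!: holomorphic_intros\<close>)

lemma not_Ints_of_double:
  fixes a :: real
  assumes "2 * a \<notin> \<int>"
  shows "a \<notin> \<int>" "2 * (- a) \<notin> \<int>" "cos (a * pi) \<noteq> 0" "sin (a * pi) \<noteq> 0"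
proof -
  show "a \<notin> \<int>" using assms by (metis Ints_mult Ints_numeral)
  then show "sin (a * pi) \<noteq> 0" by (auto simp: sin_zero_iff_int2)
  show "2 * (- a) \<notin> \<int>" using assms Ints_minus[of "2 * (- a)"] by auto
  show "cos (a * pi) \<noteq> 0"
  proof
    assume "cos (a * pi) = 0"
    then obtain n :: int where "a * pi = of_int n * (pi / 2)" by (auto simp: cos_zero_iff_int)
    then have "2 * a = of_int n" by (simp add: field_simps)
    then show False using assms by simp
  qed
qed

lemma growth_rate_margin:
  assumes "Re z > 0"
  shows "\<exists>\<epsilon>>0. \<bar>Im (Ln (2 * z))\<bar> + (pi / 2 + \<epsilon>) < pi"
proof (intro exI conjI)
  have "pi / 2 - \<bar>Im (Ln (2 * z))\<bar> > 0" using abs_Im_Ln_lt[of "2 * z"] assms by simp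
  then show "(pi / 2 - \<bar>Im (Ln (2 * z))\<bar>) / 2 > 0"
    "\<bar>Im (Ln (2 * z))\<bar> + (pi / 2 + (pi / 2 - \<bar>Im (Ln (2 * z))\<bar>) / 2) < pi" by (simp_all add: field_simps)
qed

text \<open>At a pole the factor 1/Gamma(1/2 - \<zeta>) reflects to (-1)^k cos(pi a) Gamma(a + 1/2 +
  k) / pi. Its cosine cancels against sin(2 pi a) = 2 sin(pi a) cos(pi a), and its sign turns the
  residue series into Kummer's series at -z, whence exp(-z).\<close>

lemma meijer_G20_12_line_aux:
  assumes z: "Re z > 0" and \<alpha>: "2 * \<alpha> \<notin> \<int>" and c: "c < - \<bar>\<alpha>\<bar>"
  shows "(LINT t|lborel. Gamma (of_real \<alpha> - Complex c t) * Gamma (- of_real \<alpha> - Complex c t) * rGamma (1/2 - Complex c t) * exp (Complex c t * Ln (2 * z)))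
    = 2 * of_real pi * (exp (- z) * bessel_K \<alpha> z / of_real (sqrt pi))"
proof -
  let ?L = "Ln (2 * z)"
  obtain \<epsilon> where eps: "\<epsilon> > 0" and l: "\<bar>Im ?L\<bar> + (pi / 2 + \<epsilon>) < pi" using growth_rate_margin[OF z] by blast
  interpret gamma_kernel "of_real \<alpha>" "- of_real \<alpha>" "\<lambda>\<zeta>. rGamma (1/2 - \<zeta>)" "{}" "pi / 2 + \<epsilon>" 0
    by (rule gamma_kernel_rGamma[OF eps]) auto
  have cB: "c < Re b" if "b \<in> B" for b using ReB[OF that] c by (auto simp: min_def split: if_splits)
  obtain R g where bc: "barnes_contour {} B R g"
    using barnes_contour_right[of B 0 c] ImB cB by blast
  have "of_real \<alpha> - - of_real \<alpha> = (of_real (2 * \<alpha>) :: complex)" by simp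
  then have dif: "of_real \<alpha> - - of_real \<alpha> \<notin> (\<int> :: complex set)" using \<alpha> by (simp only: of_real_in_Ints_iff) simp
  have trm: "((\<lambda>k. (-1) ^ k / fact k * Gamma (- (2 * of_real a) - of_nat k) * rGamma (1/2 - (of_real a + of_nat k)) * exp ((of_real a + of_nat k) * ?L))
      has_sum - (1 / of_real (2 * sin (a * pi))) * (of_real (sqrt pi) * exp (- 1 * z) * bessel_I a z)) (UNIV :: nat set)" if a: "2 * a \<notin> \<int>" for a :: real
  proof -
    have a': "(2 * of_real a :: complex) \<notin> \<int>" using a by (metis of_real_in_Ints_iff of_real_mult of_real_numeral)
    note nz = not_Ints_of_double[OF a]
    have gen: "u / F * G * ((-1) ^ k * (of_real (cos (a * pi) / pi) * X)) * P = (u * G) * (of_real (cos (a * pi) / pi) / F * X * ((-1) ^ k * P))"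
      for u F G X P :: complex and k :: nat by (simp add: mult_ac)
    have coef: "- (of_real pi / of_real (2 * sin (a * pi) * cos (a * pi))) * r * (of_real (cos (a * pi) / pi) / F * X * P) =
        - (1 / of_real (2 * sin (a * pi))) * (X * r / F * P)" for r F X P :: complex
      using nz by (simp add: mult_ac)
    have eq: "(-1) ^ k / fact k * Gamma (- (2 * of_real a) - of_nat k) * rGamma (1/2 - (of_real a + of_nat k)) * exp ((of_real a + of_nat k) * ?L) =
       - (1 / of_real (2 * sin (a * pi))) * (Gamma (of_real a + 1/2 + of_nat k) * rGamma (2 * of_real a + 1 + of_nat k) / fact k * ((-1) ^ k * exp ((of_real a + of_nat k) * ?L)))" for k :: nat
    proof -
      have e: "2 * of_real a + of_nat k + 1 = 2 * of_real a + 1 + (of_nat k :: complex)" by simp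
      show ?thesis
        unfolding rGamma_reflect_half[OF a] gen Gamma_reflect_term[OF a'] sin_2pi_of_real coef e ..
    qed
    show ?thesis unfolding eq by (rule has_sum_cmult_right[OF kummer_bessel_I[OF z a disjI2[OF refl]]])
  qed
  have m\<alpha>: "2 * (- \<alpha>) \<notin> \<int>" by (rule not_Ints_of_double[OF \<alpha>])
  have "barnes_integral R g (f ?L) = 2 * of_real pi * \<i> *
     (- (1 / of_real (2 * sin (\<alpha> * pi))) * (of_real (sqrt pi) * exp (- 1 * z) * bessel_I \<alpha> z) +
      - (1 / of_real (2 * sin (- \<alpha> * pi))) * (of_real (sqrt pi) * exp (- 1 * z) * bessel_I (- \<alpha>) z))"
  proof (rule barnes_integral_series[OF l dif bc])
    have e1: "- of_real \<alpha> - of_real \<alpha> = (- (2 * of_real \<alpha>) :: complex)" by simp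
    show "((\<lambda>k. (-1) ^ k / fact k * Gamma (- of_real \<alpha> - of_real \<alpha> - of_nat k) * rGamma (1/2 - (of_real \<alpha> + of_nat k)) * exp ((of_real \<alpha> + of_nat k) * ?L))
      has_sum - (1 / of_real (2 * sin (\<alpha> * pi))) * (of_real (sqrt pi) * exp (- 1 * z) * bessel_I \<alpha> z)) (UNIV :: nat set)"
      unfolding e1 by (rule trm[OF \<alpha>])
    have e2: "of_real \<alpha> - - of_real \<alpha> = (- (2 * of_real (- \<alpha>)) :: complex)" "- of_real \<alpha> = (of_real (- \<alpha>) :: complex)" by simp_all
    show "((\<lambda>k. (-1) ^ k / fact k * Gamma (of_real \<alpha> - - of_real \<alpha> - of_nat k) * rGamma (1/2 - (- of_real \<alpha> + of_nat k)) * exp ((- of_real \<alpha> + of_nat k) * ?L))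
      has_sum - (1 / of_real (2 * sin (- \<alpha> * pi))) * (of_real (sqrt pi) * exp (- 1 * z) * bessel_I (- \<alpha>) z)) (UNIV :: nat set)"
      unfolding e2(1) unfolding e2(2) by (rule trm[OF m\<alpha>])
  qed
  moreover have "barnes_integral R g (f ?L) = \<i> * (LINT t|lborel. f ?L (Complex c t))"
    using barnes_integral_left_line[OF l bc, of c] c by (simp add: abs_if split: if_splits)
  ultimately have "(LINT t|lborel. f ?L (Complex c t)) = 2 * of_real pi *
     (- (1 / of_real (2 * sin (\<alpha> * pi))) * (of_real (sqrt pi) * exp (- 1 * z) * bessel_I \<alpha> z) +
      - (1 / of_real (2 * sin (- \<alpha> * pi))) * (of_real (sqrt pi) * exp (- 1 * z) * bessel_I (- \<alpha>) z))"
    by (intro cancel_2pi_i) simp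
  also have "2 * sin (- \<alpha> * pi) = - (2 * sin (\<alpha> * pi))" by simp
  also have "- (1 / of_real (2 * S)) * (of_real (sqrt pi) * x * u) + - (1 / of_real (- (2 * S))) * (of_real (sqrt pi) * x * v) =
     x * (of_real (pi / 2) * (v - u) / of_real S) / of_real (sqrt pi)" if "S \<noteq> 0" for S :: real and x u v :: complex
  proof -
    have s: "complex_of_real (pi / 2) = of_real (sqrt pi) * of_real (sqrt pi) / 2" by (simp flip: of_real_mult)
    have "sqrt pi \<noteq> 0" by simp
    then show ?thesis unfolding s using that by (simp add: field_simps)
  qed
  also have "exp (- 1 * z) = exp (- z)" by simp
  also have "of_real (pi / 2) * (bessel_I (- \<alpha>) z - bessel_I \<alpha> z) / of_real (sin (\<alpha> * pi)) = bessel_K \<alpha> z"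
    using not_Ints_of_double(1)[OF \<alpha>] by (simp only: bessel_K_def bessel_K_quotient_def if_False)
  finally show ?thesis using not_Ints_of_double(4)[OF \<alpha>] by (simp only: f_def) simp
qed

text \<open>Orders with 2\<alpha> integral are reached as limits of orders without this property, on
  a fixed line; both sides are continuous in \<alpha>.\<close>

lemma meijer_G20_12_line:
  assumes z: "Re z > 0" and c: "c < - \<bar>\<alpha>\<bar>"
  shows "(LINT t|lborel. Gamma (of_real \<alpha> - Complex c t) * Gamma (- of_real \<alpha> - Complex c t) * rGamma (1/2 - Complex c t) * exp (Complex c t * Ln (2 * z)))
    = 2 * of_real pi * (exp (- z) * bessel_K \<alpha> z / of_real (sqrt pi))" (is "?I \<alpha> = ?V \<alpha>")
proof -
  let ?L = "Ln (2 * z)"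
  obtain \<epsilon> where eps: "\<epsilon> > 0" and l: "\<bar>Im ?L\<bar> + (pi / 2 + \<epsilon>) < pi" using growth_rate_margin[OF z] by blast
  interpret gamma_kernel "of_real \<alpha>" "- of_real \<alpha>" "\<lambda>\<zeta>. rGamma (1/2 - \<zeta>)" "{}" "pi / 2 + \<epsilon>" 0
    by (rule gamma_kernel_rGamma[OF eps]) auto
  obtain X where X: "X \<longlonglongrightarrow> \<alpha>" "\<And>n. 2 * X n \<notin> \<int>" using sequence_avoiding_half_integers by blast
  obtain CE where CE: "\<And>t. norm (rGamma (1/2 - Complex c t)) \<le> CE * exp ((pi / 2 + \<epsilon>) * \<bar>t\<bar>)"
    using kernel_line_bound_E(2)[of c] by auto
  have "(\<lambda>n. ?I (X n)) \<longlonglongrightarrow> ?I \<alpha>"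
    by (rule kernel_line_tendsto[where h = 0, OF _ _ tendsto_const _ _ _ _ kernel_line_bound_E(1) CE l])
       (use c in \<open>auto intro!: tendsto_intros X\<close>)
  moreover have "\<forall>\<^sub>F n in sequentially. ?I (X n) = ?V (X n)"
  proof -
    have "0 < - \<bar>\<alpha>\<bar> - c" using c by simp
    from tendstoD[OF X(1) this] show ?thesis
    proof eventually_elim
      case (elim n)
      have "c < - \<bar>X n\<bar>" using elim by (auto simp: dist_real_def)
      then show ?case by (rule meijer_G20_12_line_aux[OF z X(2)])
    qed
  qed
  ultimately have "(\<lambda>n. ?V (X n)) \<longlonglongrightarrow> ?I \<alpha>" by (rule Lim_transform_eventually)
  moreover have "(\<lambda>n. ?V (X n)) \<longlonglongrightarrow> ?V \<alpha>" by (intro tendsto_intros bessel_K_tendsto X z) auto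
  ultimately show ?thesis by (rule LIMSEQ_unique)
qed

lemma meijer_G20_12:
  assumes z: "Re z > 0"
  shows "meijer_G 2 0 [1/2] [of_real \<alpha>, - of_real \<alpha>] (2 * z) = exp (- z) * bessel_K \<alpha> z / of_real (sqrt pi)"
proof -
  let ?L = "Ln (2 * z)"
  obtain \<epsilon> where eps: "\<epsilon> > 0" and l: "\<bar>Im ?L\<bar> + (pi / 2 + \<epsilon>) < pi" using growth_rate_margin[OF z] by blast
  interpret gamma_kernel "of_real \<alpha>" "- of_real \<alpha>" "\<lambda>\<zeta>. rGamma (1/2 - \<zeta>)" "{}" "pi / 2 + \<epsilon>" 0
    by (rule gamma_kernel_rGamma[OF eps]) auto
  define c where "c = - \<bar>\<alpha>\<bar> - 1"
  have c: "c < - \<bar>\<alpha>\<bar>" by (simp add: c_def)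
  have B: "meijer_poles_\<beta> 2 [of_real \<alpha>, - of_real \<alpha>] = B" by (simp add: meijer_poles_simps B_def)
  have f: "meijer_integrand 2 0 [1/2] [of_real \<alpha>, - of_real \<alpha>] l = f l" for l
  proof
    fix \<zeta> show "meijer_integrand 2 0 [1/2] [of_real \<alpha>, - of_real \<alpha>] l \<zeta> = f l \<zeta>"
      unfolding meijer_integrand_def f_def unfolding rGamma_inverse_Gamma by (simp add: numeral_2_eq_2 lessThan_Suc mult.commute inverse_eq_divide)
  qed
  show ?thesis unfolding meijer_G_def
  proof (rule meijer_G_Log_eqI, unfold meijer_poles_simps(1) B f)
    have cB: "c < Re b" if "b \<in> B" for b using ReB[OF that] c by (auto simp: min_def split: if_splits)
    show "\<exists>R g. barnes_contour {} B R g" using barnes_contour_right[of B 0 c] ImB cB by blast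
    fix R g assume bc: "barnes_contour {} B R g"
    have "barnes_integral R g (f ?L) = \<i> * (LINT t|lborel. f ?L (Complex c t))"
      using barnes_integral_left_line[OF l bc, of c] c by (simp add: abs_if split: if_splits)
    also have "(LINT t|lborel. f ?L (Complex c t)) = 2 * of_real pi * (exp (- z) * bessel_K \<alpha> z / of_real (sqrt pi))"
      unfolding f_def by (rule meijer_G20_12_line[OF z c])
    finally show "barnes_integral R g (f ?L) = 2 * of_real pi * \<i> * (exp (- z) * bessel_K \<alpha> z / of_real (sqrt pi))"
      by (simp only: mult_ac)
  qed
qed

section \<open>Two interlacing families of poles: the function G^{2,1}_{1,2}\<close>

lemma residue_Gamma_mult:
  assumes h: "h analytic_on {a}" and a: "s + a = - of_nat k"
  shows "residue (\<lambda>w. Gamma (s + w) * h w) a = (-1) ^ k / fact k * h a"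
proof -
  obtain S where S: "open S" "a \<in> S" "h holomorphic_on S"
    using h by (auto simp: analytic_on_holomorphic)
  \<comment> \<open>Different poles of Gamma(s + w) are at distance at least 1, so the unit ball
    around a contains no other pole.\<close>
  define U where "U = S \<inter> ball a 1"
  have U: "open U" "a \<in> U" using S by (auto simp: U_def)
  have "s + w \<notin> \<int>\<^sub>\<le>\<^sub>0" if "w \<in> U - {a}" for w
  proof
    assume "s + w \<in> \<int>\<^sub>\<le>\<^sub>0"
    then obtain j :: nat where j: "s + w = - of_nat j" by (elim nonpos_Ints_cases')
    have "w - a = (s + w) - (s + a)" by simp
    then have e: "w - a = of_int (int k - int j)" unfolding j a by simp
    have "norm (w - a) < 1" using that by (simp add: U_def dist_norm norm_minus_commute)
    then have "int k = int j" unfolding e norm_of_int by linarith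
    then show False using e that by simp
  qed
  then have "(\<lambda>w. Gamma (s + w) * h w) holomorphic_on U - {a}"
    by (intro holomorphic_intros holomorphic_on_subset[OF S(3)]) (auto simp: U_def)
  moreover have "((\<lambda>w. Gamma (s + w) * h w * (w - a)) \<longlongrightarrow> (-1) ^ k / fact k * h a) (at a)"
  proof -
    have "filterlim (\<lambda>w. s + w) (at (- of_nat k)) (at a)"
      unfolding filterlim_at
    proof
      show "\<forall>\<^sub>F x in at a. s + x \<in> UNIV \<and> s + x \<noteq> - of_nat k"
        using eventually_neq_at_within[of a a] by eventually_elim (simp flip: a)
      show "((\<lambda>w. s + w) \<longlongrightarrow> - of_nat k) (at a)"
        unfolding a[symmetric] by (intro tendsto_intros)
    qed
    from filterlim_compose[OF Gamma_residues this]
    have g: "((\<lambda>w. Gamma (s + w) * (s + w + of_nat k)) \<longlongrightarrow> (-1) ^ k / fact k) (at a)" .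
    have "isCont h a" using S holomorphic_on_imp_continuous_on continuous_on_eq_continuous_at by blast
    then have "(h \<longlongrightarrow> h a) (at a)" by (simp add: isCont_def)
    from tendsto_mult[OF g this]
    have "((\<lambda>w. Gamma (s + w) * (s + w + of_nat k) * h w) \<longlongrightarrow> (-1) ^ k / fact k * h a) (at a)" .
    moreover have "s + w + of_nat k = w - a" for w using a by (simp add: algebra_simps eq_neg_iff_add_eq_0)
    ultimately show ?thesis by (simp only: mult_ac)
  qed
  ultimately show ?thesis by (rule residue_simple'[OF U])
qed

text \<open>The poles of Gamma(s + \<zeta>) as a function of \<zeta>; they run from -s to the
  left.\<close>

definition left_lattice :: "complex \<Rightarrow> complex set" where
  "left_lattice s = {z. s + z \<in> \<int>\<^sub>\<le>\<^sub>0}"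

lemma left_lattice_altdef: "left_lattice s = uminus ` right_lattice s"
proof (rule set_eqI)
  fix z
  have "z \<in> left_lattice s \<longleftrightarrow> - z \<in> right_lattice s" by (simp add: left_lattice_def mem_right_lattice)
  also have "\<dots> \<longleftrightarrow> z \<in> uminus ` right_lattice s" by (metis image_iff minus_minus)
  finally show "z \<in> left_lattice s \<longleftrightarrow> z \<in> uminus ` right_lattice s" .
qed

lemma left_latticeE:
  assumes "z \<in> left_lattice s"
  obtains k :: nat where "s + z = - of_nat k" "z = - s - of_nat k"
proof -
  obtain k :: nat where k: "s + z = - of_nat k" using assms unfolding left_lattice_def by (auto elim!: nonpos_Ints_cases')
  have "z = (s + z) - s" by simp
  then have "z = - s - of_nat k" unfolding k by simp
  with k show ?thesis by (rule that)
qed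

lemma finite_left_lattice: "finite {z \<in> left_lattice s. \<bar>Re z\<bar> \<le> r}"
proof -
  have "{z \<in> left_lattice s. \<bar>Re z\<bar> \<le> r} = uminus ` {z \<in> right_lattice s. \<bar>Re z\<bar> \<le> r}"
    unfolding left_lattice_altdef by auto
  then show ?thesis using finite_right_lattice by simp
qed

text \<open>A common point would force |\<alpha>| = 1/2 + n for some natural n, a zero of cos(pi
  \<alpha>).\<close>

lemma left_right_lattice_disjoint:
  fixes \<alpha> :: real
  assumes "cos (\<alpha> * pi) \<noteq> 0"
  shows "left_lattice (1/2 - \<mu>) \<inter> (right_lattice (\<mu> + of_real \<alpha>) \<union> right_lattice (\<mu> - of_real \<alpha>)) = {}"
proof (rule ccontr)
  assume "\<not> ?thesis"
  then obtain z where z: "z \<in> left_lattice (1/2 - \<mu>)" "z \<in> right_lattice (\<mu> + of_real \<alpha>) \<or> z \<in> right_lattice (\<mu> - of_real \<alpha>)" by blast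
  obtain j :: nat where j: "z = - (1/2 - \<mu>) - of_nat j" using z(1) by (rule left_latticeE)
  obtain k :: nat where k: "z = \<mu> + of_real \<alpha> + of_nat k \<or> z = \<mu> - of_real \<alpha> + of_nat k"
    using z(2) by (auto simp: right_lattice_def)
  have "Re z = - (1/2 - Re \<mu>) - j" unfolding j by simp
  moreover from k have "Re z = Re \<mu> + \<alpha> + k \<or> Re z = Re \<mu> - \<alpha> + k"
    by (elim disjE) simp_all
  ultimately have "\<alpha> = - (1/2 + real (j + k)) \<or> \<alpha> = 1/2 + real (j + k)" by auto
  then have c: "cos (\<alpha> * pi) = cos ((1/2 + real (j + k)) * pi)"
    by (elim disjE) (simp_all only: mult_minus_left cos_minus)
  have "(1/2 + real n) * pi = pi / 2 + real n * pi" for n by (simp add: algebra_simps)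
  moreover have "cos (pi / 2 + real n * pi) = 0" for n
    by (simp add: cos_add sin_npi)
  ultimately have "cos (\<alpha> * pi) = 0" unfolding c by (simp only:)
  then show False using assms by simp
qed

text \<open>The rate is negative because the third Gamma factor decays too. A crude loss of 1/2 is
  affordable: |arg(2z)| < pi/2 is far below pi + (pi/2 - 1/2).\<close>

lemma gamma_kernel_Gamma:
  fixes \<alpha> :: real
  assumes "cos (\<alpha> * pi) \<noteq> 0"
  shows "gamma_kernel (\<mu> + of_real \<alpha>) (\<mu> - of_real \<alpha>) (\<lambda>\<zeta>. Gamma (1/2 - \<mu> + \<zeta>)) (left_lattice (1/2 - \<mu>)) (- (pi / 2 - 1/2)) (Im \<mu>)"
proof
  show "(\<lambda>\<zeta>. Gamma (1/2 - \<mu> + \<zeta>)) holomorphic_on - left_lattice (1/2 - \<mu>)"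
    by (intro holomorphic_intros) (auto simp: left_lattice_def)
  show "left_lattice (1/2 - \<mu>) \<inter> (right_lattice (\<mu> + of_real \<alpha>) \<union> right_lattice (\<mu> - of_real \<alpha>)) = {}"
    by (rule left_right_lattice_disjoint[OF assms])
  show "finite {a \<in> left_lattice (1/2 - \<mu>). \<bar>Re a\<bar> \<le> r}" for r by (rule finite_left_lattice)
  show "\<exists>u. \<forall>a\<in>left_lattice (1/2 - \<mu>). Re a \<le> u"
    by (intro exI[of _ "Re \<mu>"]) (auto elim!: left_latticeE)
  show "Im a = Im \<mu>" if "a \<in> left_lattice (1/2 - \<mu>)" for a using that by (auto elim!: left_latticeE)
  show "\<exists>C T. \<forall>\<zeta>. \<bar>Re \<zeta>\<bar> \<le> m \<and> T \<le> \<bar>Im \<zeta>\<bar> \<longrightarrow> norm (Gamma (1/2 - \<mu> + \<zeta>)) \<le> C * exp (- (pi / 2 - 1/2) * \<bar>Im \<zeta>\<bar>)" for m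
  proof -
    obtain C where C: "\<And>\<zeta>. \<bar>Re \<zeta>\<bar> \<le> m \<Longrightarrow> 1 + \<bar>Im (1/2 - \<mu>)\<bar> \<le> \<bar>Im \<zeta>\<bar> \<Longrightarrow> norm (Gamma (1/2 - \<mu> - \<zeta>)) \<le> C * exp (- (pi/2 - 1/2) * \<bar>Im \<zeta>\<bar>)"
      using norm_Gamma_reflected_strip[of "1/2" m "1/2 - \<mu>"] by auto
    have "norm (Gamma (1/2 - \<mu> + \<zeta>)) \<le> C * exp (- (pi / 2 - 1/2) * \<bar>Im \<zeta>\<bar>)"
      if "\<bar>Re \<zeta>\<bar> \<le> m" "1 + \<bar>Im (1/2 - \<mu>)\<bar> \<le> \<bar>Im \<zeta>\<bar>" for \<zeta>
      using C[of "- \<zeta>"] that by simp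
    then show ?thesis by blast
  qed
  show "\<exists>K N. \<forall>\<zeta>. N \<le> Re \<zeta> \<longrightarrow> norm (Gamma (1/2 - \<mu> + (\<zeta> + 1))) \<le> K * (1 + norm \<zeta>) * norm (Gamma (1/2 - \<mu> + \<zeta>))"
  proof (rule exI[of _ "1 + norm (1/2 - \<mu>)"], rule exI[of _ "Re \<mu>"], intro allI impI)
    fix \<zeta> assume "Re \<mu> \<le> Re \<zeta>"
    then have "1/2 - \<mu> + \<zeta> \<notin> \<int>\<^sub>\<le>\<^sub>0" by (intro Re_pos_imp_not_nonpos_Ints) simp
    from Gamma_plus1[OF this] have G: "Gamma (1/2 - \<mu> + (\<zeta> + 1)) = (1/2 - \<mu> + \<zeta>) * Gamma (1/2 - \<mu> + \<zeta>)" by (simp add: add.assoc)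
    have "norm (1/2 - \<mu> + \<zeta>) \<le> norm (1/2 - \<mu>) + norm \<zeta>" by (rule norm_triangle_ineq)
    also have "\<dots> \<le> (1 + norm (1/2 - \<mu>)) * (1 + norm \<zeta>)" by (simp add: algebra_simps)
    finally show "norm (Gamma (1/2 - \<mu> + (\<zeta> + 1))) \<le> (1 + norm (1/2 - \<mu>)) * (1 + norm \<zeta>) * norm (Gamma (1/2 - \<mu> + \<zeta>))"
      unfolding G norm_mult by (rule mult_right_mono) simp
  qed
qed auto

lemma cos_add_npi: "cos (x + real k * pi) = (-1) ^ k * cos x"
  by (induction k) (auto simp: distrib_right cos_add sin_add add.assoc[symmetric])

text \<open>The left poles have Re - Re \<mu> = -1/2 - k, where cos(pi x) vanishes; the right poles
  have \<alpha> + k or -\<alpha> + k, where its square is cos(pi \<alpha>)^2. Hence 2 cos(pi x)^2 -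
  cos(pi \<alpha>)^2 is negative at the former and positive at the latter, and its graph weaves
  between them. The end points c and d lie to the left of all right poles and to the right of all
  left poles.\<close>

lemma barnes_contour_weaving:
  fixes \<alpha> :: real
  assumes "cos (\<alpha> * pi) \<noteq> 0"
  shows "\<exists>R g. barnes_contour (left_lattice (1/2 - \<mu>)) (right_lattice (\<mu> + of_real \<alpha>) \<union> right_lattice (\<mu> - of_real \<alpha>)) R g"
proof (rule barnes_contour_exists[where h = "Im \<mu>" and c = "Re \<mu> - \<bar>\<alpha>\<bar> - 1" and d = "Re \<mu>"
      and \<phi> = "\<lambda>x. 2 * (cos ((x - Re \<mu>) * pi))\<^sup>2 - (cos (\<alpha> * pi))\<^sup>2"
      and \<phi>' = "\<lambda>x. - (4 * pi * cos ((x - Re \<mu>) * pi) * sin ((x - Re \<mu>) * pi))"])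
  show "Re \<mu> - \<bar>\<alpha>\<bar> - 1 < Re \<mu>" by simp
  show "((\<lambda>x. 2 * (cos ((x - Re \<mu>) * pi))\<^sup>2 - (cos (\<alpha> * pi))\<^sup>2) has_real_derivative - (4 * pi * cos ((x - Re \<mu>) * pi) * sin ((x - Re \<mu>) * pi))) (at x)" for x
    by (auto intro!: derivative_eq_intros)
  show "continuous_on UNIV (\<lambda>x. - (4 * pi * cos ((x - Re \<mu>) * pi) * sin ((x - Re \<mu>) * pi)))" by (intro continuous_intros)
  show "\<bar>2 * (cos ((x - Re \<mu>) * pi))\<^sup>2 - (cos (\<alpha> * pi))\<^sup>2\<bar> \<le> 2" for x
  proof -
    have "0 \<le> (cos y)\<^sup>2 \<and> (cos y)\<^sup>2 \<le> 1" for y :: real by (simp add: abs_square_le_1)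
    from this[of "(x - Re \<mu>) * pi"] this[of "\<alpha> * pi"] show ?thesis by linarith
  qed
  have pos: "(cos (\<alpha> * pi))\<^sup>2 > 0" using assms by simp
  show "Im a = Im \<mu> \<and> Re a < Re \<mu> \<and> (Re \<mu> - \<bar>\<alpha>\<bar> - 1 \<le> Re a \<longrightarrow> 2 * (cos ((Re a - Re \<mu>) * pi))\<^sup>2 - (cos (\<alpha> * pi))\<^sup>2 < 0)"
    if a: "a \<in> left_lattice (1/2 - \<mu>)" for a
  proof -
    obtain k :: nat where k: "a = - (1/2 - \<mu>) - of_nat k" using a by (rule left_latticeE)
    have "(Re a - Re \<mu>) * pi = - (pi / 2 + real k * pi)" by (simp add: k algebra_simps)
    then have "cos ((Re a - Re \<mu>) * pi) = 0" by (simp only: cos_minus cos_add_npi) simp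
    then show ?thesis using pos by (simp add: k)
  qed
  show "Im b = Im \<mu> \<and> Re \<mu> - \<bar>\<alpha>\<bar> - 1 < Re b \<and> (Re b \<le> Re \<mu> \<longrightarrow> 0 < 2 * (cos ((Re b - Re \<mu>) * pi))\<^sup>2 - (cos (\<alpha> * pi))\<^sup>2)"
    if b: "b \<in> right_lattice (\<mu> + of_real \<alpha>) \<union> right_lattice (\<mu> - of_real \<alpha>)" for b
  proof -
    obtain k :: nat and \<tau> :: real where k: "b = \<mu> + of_real \<tau> + of_nat k" "\<tau> = \<alpha> \<or> \<tau> = - \<alpha>"
    proof -
      from b consider k :: nat where "b = \<mu> + of_real \<alpha> + of_nat k" | k :: nat where "b = \<mu> + of_real (- \<alpha>) + of_nat k"
        by (auto simp: right_lattice_def)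
      then show ?thesis using that by cases blast+
    qed
    have "(Re b - Re \<mu>) * pi = \<tau> * pi + real k * pi" by (simp add: k algebra_simps)
    then have "(cos ((Re b - Re \<mu>) * pi))\<^sup>2 = (cos (\<tau> * pi))\<^sup>2"
      by (simp only: cos_add_npi) (simp add: power_mult_distrib flip: power_mult)
    also have "\<dots> = (cos (\<alpha> * pi))\<^sup>2" using k(2) by auto
    finally show ?thesis using pos k by auto
  qed
qed

text \<open>At a right pole the third factor is already the Gamma(a + 1/2 + k) of Kummer's series,
  here at z. Without a reflection no cosine arises to cancel that of sin(2 pi a), so cos(pi
  \<alpha>) stays in the denominator.\<close>

lemma meijer_G21_12_barnes_aux:
  assumes z: "Re z > 0" and \<alpha>: "2 * \<alpha> \<notin> \<int>"
    and bc: "barnes_contour (left_lattice (1/2 - \<mu>)) (right_lattice (\<mu> + of_real \<alpha>) \<union> right_lattice (\<mu> - of_real \<alpha>)) R g"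
  shows "barnes_integral R g (\<lambda>\<zeta>. Gamma (\<mu> + of_real \<alpha> - \<zeta>) * Gamma (\<mu> - of_real \<alpha> - \<zeta>) * Gamma (1/2 - \<mu> + \<zeta>) * exp (\<zeta> * Ln (2 * z)))
    = 2 * of_real pi * \<i> * (of_real (sqrt pi) / of_real (cos (\<alpha> * pi)) * exp (\<mu> * Ln (2 * z)) * exp z * bessel_K \<alpha> z)"
proof -
  let ?L = "Ln (2 * z)"
  have l: "\<bar>Im ?L\<bar> + (- (pi / 2 - 1/2)) < pi" using abs_Im_Ln_lt[of "2 * z"] z pi_gt3 by simp
  interpret gamma_kernel "\<mu> + of_real \<alpha>" "\<mu> - of_real \<alpha>" "\<lambda>\<zeta>. Gamma (1/2 - \<mu> + \<zeta>)" "left_lattice (1/2 - \<mu>)" "- (pi / 2 - 1/2)" "Im \<mu>"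
    by (rule gamma_kernel_Gamma) (rule not_Ints_of_double[OF \<alpha>])
  have bc': "barnes_contour (left_lattice (1/2 - \<mu>)) B R g" using bc by (simp only: B_def)
  have "\<mu> + of_real \<alpha> - (\<mu> - of_real \<alpha>) = (of_real (2 * \<alpha>) :: complex)" by simp
  then have dif: "\<mu> + of_real \<alpha> - (\<mu> - of_real \<alpha>) \<notin> (\<int> :: complex set)" using \<alpha> by (simp only: of_real_in_Ints_iff) simp
  have trm: "((\<lambda>k. (-1) ^ k / fact k * Gamma (- (2 * of_real a) - of_nat k) * Gamma (1/2 - \<mu> + (\<mu> + of_real a + of_nat k)) * exp ((\<mu> + of_real a + of_nat k) * ?L))
      has_sum - (of_real pi / of_real (2 * sin (a * pi) * cos (a * pi)) * exp (\<mu> * ?L)) * (of_real (sqrt pi) * exp (1 * z) * bessel_I a z)) (UNIV :: nat set)" if a: "2 * a \<notin> \<int>" for a :: real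
  proof -
    have a': "(2 * of_real a :: complex) \<notin> \<int>" using a by (metis of_real_in_Ints_iff of_real_mult of_real_numeral)
    have gen: "u / F * G * X * P = (u * G) * (X / F * P)" for u F G X P :: complex by simp
    have coef: "- (p / S) * r * (X / F * (M * P)) = - (p / S * M) * (X * r / F * (1 ^ k * P))" for p S r F X M P :: complex and k :: nat
      by (simp add: mult_ac)
    have "(-1) ^ k / fact k * Gamma (- (2 * of_real a) - of_nat k) * Gamma (1/2 - \<mu> + (\<mu> + of_real a + of_nat k)) * exp ((\<mu> + of_real a + of_nat k) * ?L) =
       - (of_real pi / of_real (2 * sin (a * pi) * cos (a * pi)) * exp (\<mu> * ?L)) *
       (Gamma (of_real a + 1/2 + of_nat k) * rGamma (2 * of_real a + 1 + of_nat k) / fact k * (1 ^ k * exp ((of_real a + of_nat k) * ?L)))" for k :: nat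
    proof -
      have e: "2 * of_real a + of_nat k + 1 = 2 * of_real a + 1 + (of_nat k :: complex)"
        "1/2 - \<mu> + (\<mu> + of_real a + of_nat k) = of_real a + 1/2 + of_nat k" by simp_all
      have x: "exp ((\<mu> + of_real a + of_nat k) * ?L) = exp (\<mu> * ?L) * exp ((of_real a + of_nat k) * ?L)"
        unfolding exp_add[symmetric] by (simp add: algebra_simps)
      show ?thesis
        unfolding gen Gamma_reflect_term[OF a'] sin_2pi_of_real e x coef[where k = k] ..
    qed
    note eq = this
    show ?thesis unfolding eq by (rule has_sum_cmult_right[OF kummer_bessel_I[OF z a disjI1[OF refl]]])
  qed
  have m\<alpha>: "2 * (- \<alpha>) \<notin> \<int>" by (rule not_Ints_of_double[OF \<alpha>])
  have "barnes_integral R g (f ?L) = 2 * of_real pi * \<i> *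
     (- (of_real pi / of_real (2 * sin (\<alpha> * pi) * cos (\<alpha> * pi)) * exp (\<mu> * ?L)) * (of_real (sqrt pi) * exp (1 * z) * bessel_I \<alpha> z) +
      - (of_real pi / of_real (2 * sin (- \<alpha> * pi) * cos (- \<alpha> * pi)) * exp (\<mu> * ?L)) * (of_real (sqrt pi) * exp (1 * z) * bessel_I (- \<alpha>) z))"
  proof (rule barnes_integral_series[OF l dif bc'])
    have e1: "\<mu> - of_real \<alpha> - (\<mu> + of_real \<alpha>) = (- (2 * of_real \<alpha>) :: complex)" by simp
    show "((\<lambda>k. (-1) ^ k / fact k * Gamma (\<mu> - of_real \<alpha> - (\<mu> + of_real \<alpha>) - of_nat k) * Gamma (1/2 - \<mu> + (\<mu> + of_real \<alpha> + of_nat k)) * exp ((\<mu> + of_real \<alpha> + of_nat k) * ?L))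
      has_sum - (of_real pi / of_real (2 * sin (\<alpha> * pi) * cos (\<alpha> * pi)) * exp (\<mu> * ?L)) * (of_real (sqrt pi) * exp (1 * z) * bessel_I \<alpha> z)) (UNIV :: nat set)"
      unfolding e1 by (rule trm[OF \<alpha>])
    have e2: "\<mu> + of_real \<alpha> - (\<mu> - of_real \<alpha>) = (- (2 * of_real (- \<alpha>)) :: complex)" "\<mu> - of_real \<alpha> = \<mu> + of_real (- \<alpha>)" by simp_all
    show "((\<lambda>k. (-1) ^ k / fact k * Gamma (\<mu> + of_real \<alpha> - (\<mu> - of_real \<alpha>) - of_nat k) * Gamma (1/2 - \<mu> + (\<mu> - of_real \<alpha> + of_nat k)) * exp ((\<mu> - of_real \<alpha> + of_nat k) * ?L))
      has_sum - (of_real pi / of_real (2 * sin (- \<alpha> * pi) * cos (- \<alpha> * pi)) * exp (\<mu> * ?L)) * (of_real (sqrt pi) * exp (1 * z) * bessel_I (- \<alpha>) z)) (UNIV :: nat set)"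
      unfolding e2(1) unfolding e2(2) by (rule trm[OF m\<alpha>])
  qed
  also have "sin (- \<alpha> * pi) = - sin (\<alpha> * pi)" by simp
  also have "cos (- \<alpha> * pi) = cos (\<alpha> * pi)" by simp
  also have "- (of_real pi / of_real (2 * S * D) * M) * (of_real (sqrt pi) * x * u) + - (of_real pi / of_real (2 * - S * D) * M) * (of_real (sqrt pi) * x * v) =
     of_real (sqrt pi) / of_real D * M * x * (of_real (pi / 2) * (v - u) / of_real S)" if "S \<noteq> 0" "D \<noteq> 0" for S D :: real and x u v M :: complex
    using that by (simp add: field_simps)
  also have "exp (1 * z) = exp z" by simp
  also have "of_real (pi / 2) * (bessel_I (- \<alpha>) z - bessel_I \<alpha> z) / of_real (sin (\<alpha> * pi)) = bessel_K \<alpha> z"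
    using not_Ints_of_double(1)[OF \<alpha>] by (simp only: bessel_K_def bessel_K_quotient_def if_False)
  finally show ?thesis using not_Ints_of_double(3,4)[OF \<alpha>] unfolding f_def by simp
qed

text \<open>For \<open>2\<alpha> \<in> \<int>\<close> the residues are those of double poles, and the value is obtained as a limit in \<open>\<alpha>\<close>.
  The contour integral is expressed by quantities which are obviously continuous in \<open>\<alpha>\<close>: the integral along a
  line on the left of all \<open>\<beta>\<close>-poles and finitely many residues at \<open>\<alpha>\<close>-poles.\<close>

lemma meijer_G21_12_line:
  assumes z: "Re z > 0" and \<alpha>: "cos (\<alpha> * pi) \<noteq> 0"
    and bc: "barnes_contour (left_lattice (1/2 - \<mu>)) (right_lattice (\<mu> + of_real \<alpha>) \<union> right_lattice (\<mu> - of_real \<alpha>)) R g"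
    and c: "c < Re \<mu> - \<bar>\<alpha>\<bar>" "\<And>a. a \<in> left_lattice (1/2 - \<mu>) \<Longrightarrow> Re a \<noteq> c"
  shows "barnes_integral R g (\<lambda>\<zeta>. Gamma (\<mu> + of_real \<alpha> - \<zeta>) * Gamma (\<mu> - of_real \<alpha> - \<zeta>) * Gamma (1/2 - \<mu> + \<zeta>) * exp (\<zeta> * Ln (2 * z))) =
    2 * of_real pi * \<i> * ((LINT t|lborel. Gamma (\<mu> + of_real \<alpha> - Complex c t) * Gamma (\<mu> - of_real \<alpha> - Complex c t) * Gamma (1/2 - \<mu> + Complex c t) * exp (Complex c t * Ln (2 * z))) / (2 * of_real pi) +
      (\<Sum>a | a \<in> left_lattice (1/2 - \<mu>) \<and> c < Re a.
         residue Gamma (1/2 - \<mu> + a) * (Gamma (\<mu> + of_real \<alpha> - a) * Gamma (\<mu> - of_real \<alpha> - a) * exp (a * Ln (2 * z)))))"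
proof -
  let ?L = "Ln (2 * z)"
  have l: "\<bar>Im ?L\<bar> + (- (pi / 2 - 1/2)) < pi" using abs_Im_Ln_lt[of "2 * z"] z pi_gt3 by simp
  interpret gamma_kernel "\<mu> + of_real \<alpha>" "\<mu> - of_real \<alpha>" "\<lambda>\<zeta>. Gamma (1/2 - \<mu> + \<zeta>)" "left_lattice (1/2 - \<mu>)" "- (pi / 2 - 1/2)" "Im \<mu>"
    by (rule gamma_kernel_Gamma[OF \<alpha>])
  have bc': "barnes_contour (left_lattice (1/2 - \<mu>)) B R g" using bc by (simp only: B_def)
  have res: "residue (f ?L) a = residue Gamma (1/2 - \<mu> + a) * (Gamma (\<mu> + of_real \<alpha> - a) * Gamma (\<mu> - of_real \<alpha> - a) * exp (a * ?L))"
    if a: "a \<in> left_lattice (1/2 - \<mu>)" for a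
  proof -
    obtain k :: nat where k: "1/2 - \<mu> + a = - of_nat k" using a by (rule left_latticeE)
    have "a \<notin> right_lattice (\<mu> + of_real \<alpha>)" "a \<notin> right_lattice (\<mu> - of_real \<alpha>)" using a Adisj by blast+
    then have np: "\<mu> + of_real \<alpha> - a \<notin> \<int>\<^sub>\<le>\<^sub>0" "\<mu> - of_real \<alpha> - a \<notin> \<int>\<^sub>\<le>\<^sub>0" by (simp_all add: mem_right_lattice)
    have G: "(\<lambda>w. Gamma (b - w)) analytic_on {a}" if "b - a \<notin> \<int>\<^sub>\<le>\<^sub>0" for b :: complex
      using analytic_on_compose_gen[of "\<lambda>w. b - w" "{a}" Gamma "- \<int>\<^sub>\<le>\<^sub>0"] that
      by (auto simp: o_def intro!: analytic_intros)
    have "(\<lambda>w. Gamma (\<mu> + of_real \<alpha> - w) * Gamma (\<mu> - of_real \<alpha> - w) * exp (w * ?L)) analytic_on {a}"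
      by (intro analytic_on_mult G np) (auto intro!: analytic_intros)
    from residue_Gamma_mult[OF this k]
    have "residue (f ?L) a = (-1) ^ k / fact k * (Gamma (\<mu> + of_real \<alpha> - a) * Gamma (\<mu> - of_real \<alpha> - a) * exp (a * ?L))"
      by (simp add: f_def[abs_def] mult_ac)
    \<comment> \<open>Written as \<open>residue Gamma\<close>, the coefficient is a function of the
      pole a alone, so the sum over poles needs no index k and its coefficients visibly do not
      involve \<alpha>.\<close>
    also have "(-1) ^ k / fact k = residue Gamma (1/2 - \<mu> + a)"
      using residue_Gamma_mult[of "\<lambda>_. 1" "1/2 - \<mu> + a" 0 k] k by simp
    finally show ?thesis .
  qed
  have "barnes_integral R g (f ?L) = \<i> * (LINT t|lborel. f ?L (Complex c t)) + 2 * of_real pi * \<i> * (\<Sum>a | a \<in> left_lattice (1/2 - \<mu>) \<and> c < Re a. residue (f ?L) a)"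
    using barnes_integral_left_line[OF l bc' _ _ c(2)] c(1) by (simp add: abs_if split: if_splits)
  also have "(\<Sum>a | a \<in> left_lattice (1/2 - \<mu>) \<and> c < Re a. residue (f ?L) a) =
      (\<Sum>a | a \<in> left_lattice (1/2 - \<mu>) \<and> c < Re a.
         residue Gamma (1/2 - \<mu> + a) * (Gamma (\<mu> + of_real \<alpha> - a) * Gamma (\<mu> - of_real \<alpha> - a) * exp (a * ?L)))"
    by (intro sum.cong refl) (simp add: res)
  also have "\<i> * X + 2 * of_real pi * \<i> * Y = 2 * of_real pi * \<i> * (X / (2 * of_real pi) + Y)" for X Y :: complex
    by (simp add: field_simps)
  finally show ?thesis unfolding f_def .
qed

lemma meijer_G21_12_barnes:
  assumes z: "Re z > 0" and \<alpha>: "cos (\<alpha> * pi) \<noteq> 0"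
    and bc: "barnes_contour (left_lattice (1/2 - \<mu>)) (right_lattice (\<mu> + of_real \<alpha>) \<union> right_lattice (\<mu> - of_real \<alpha>)) R g"
  shows "barnes_integral R g (\<lambda>\<zeta>. Gamma (\<mu> + of_real \<alpha> - \<zeta>) * Gamma (\<mu> - of_real \<alpha> - \<zeta>) * Gamma (1/2 - \<mu> + \<zeta>) * exp (\<zeta> * Ln (2 * z)))
    = 2 * of_real pi * \<i> * (of_real (sqrt pi) / of_real (cos (\<alpha> * pi)) * exp (\<mu> * Ln (2 * z)) * exp z * bessel_K \<alpha> z)"
proof -
  let ?L = "Ln (2 * z)"
  \<comment> \<open>An integral distance from Re \<mu> keeps the line off the left poles, whose
    distances are half-odd; m > |\<alpha>| puts it to the left of all right poles.\<close>
  define m where "m = nat \<lceil>\<bar>\<alpha>\<bar>\<rceil> + 1"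
  define c where "c = Re \<mu> - real m"
  have c: "c < Re \<mu> - \<bar>\<alpha>\<bar>" unfolding c_def m_def by linarith
  have cA: "Re a \<noteq> c" if a: "a \<in> left_lattice (1/2 - \<mu>)" for a
  proof
    assume e: "Re a = c"
    obtain k :: nat where "a = - (1/2 - \<mu>) - of_nat k" using a by (rule left_latticeE)
    then have "2 * real m = 2 * real k + 1" using e by (simp add: c_def)
    then have "2 * m = 2 * k + 1" by linarith
    then show False by presburger
  qed
  let ?A = "{a. a \<in> left_lattice (1/2 - \<mu>) \<and> c < Re a}"
  let ?I = "\<lambda>\<alpha>. (LINT t|lborel. Gamma (\<mu> + of_real \<alpha> - Complex c t) * Gamma (\<mu> - of_real \<alpha> - Complex c t) * Gamma (1/2 - \<mu> + Complex c t) * exp (Complex c t * ?L)) / (2 * of_real pi) +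
      (\<Sum>a\<in>?A. residue Gamma (1/2 - \<mu> + a) * (Gamma (\<mu> + of_real \<alpha> - a) * Gamma (\<mu> - of_real \<alpha> - a) * exp (a * ?L)))"
  let ?V = "\<lambda>\<alpha>. of_real (sqrt pi) / of_real (cos (\<alpha> * pi)) * exp (\<mu> * Ln (2 * z)) * exp z * bessel_K \<alpha> z"
  obtain X where X: "X \<longlonglongrightarrow> \<alpha>" "\<And>n. 2 * X n \<notin> \<int>" using sequence_avoiding_half_integers by blast
  have l: "\<bar>Im ?L\<bar> + (- (pi / 2 - 1/2)) < pi" using abs_Im_Ln_lt[of "2 * z"] z pi_gt3 by simp
  interpret gamma_kernel "\<mu> + of_real \<alpha>" "\<mu> - of_real \<alpha>" "\<lambda>\<zeta>. Gamma (1/2 - \<mu> + \<zeta>)" "left_lattice (1/2 - \<mu>)" "- (pi / 2 - 1/2)" "Im \<mu>"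
    by (rule gamma_kernel_Gamma[OF \<alpha>])
  obtain CE where CE: "\<And>t. norm (Gamma (1/2 - \<mu> + Complex c t)) \<le> CE * exp (- (pi / 2 - 1/2) * \<bar>t\<bar>)"
    using kernel_line_bound_E(2)[OF cA] by auto
  have "(\<lambda>n. ?I (X n)) \<longlonglongrightarrow> ?I \<alpha>"
  proof (intro tendsto_add tendsto_divide tendsto_sum tendsto_mult tendsto_const)
    show "(\<lambda>n. LINT t|lborel. Gamma (\<mu> + of_real (X n) - Complex c t) * Gamma (\<mu> - of_real (X n) - Complex c t) * Gamma (1/2 - \<mu> + Complex c t) * exp (Complex c t * ?L)) \<longlonglongrightarrow>
       (LINT t|lborel. Gamma (\<mu> + of_real \<alpha> - Complex c t) * Gamma (\<mu> - of_real \<alpha> - Complex c t) * Gamma (1/2 - \<mu> + Complex c t) * exp (Complex c t * ?L))"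
      by (rule kernel_line_tendsto[where h = "Im \<mu>", OF _ _ tendsto_const _ _ _ _ kernel_line_bound_E(1)[OF cA] CE l])
         (use c in \<open>auto intro!: tendsto_intros X\<close>)
    fix a assume "a \<in> ?A"
    then have "a \<notin> right_lattice (\<mu> + of_real \<alpha>)" "a \<notin> right_lattice (\<mu> - of_real \<alpha>)" using Adisj by blast+
    then have np: "\<mu> + of_real \<alpha> - a \<notin> \<int>\<^sub>\<le>\<^sub>0" "\<mu> - of_real \<alpha> - a \<notin> \<int>\<^sub>\<le>\<^sub>0" by (simp_all add: mem_right_lattice)
    show "(\<lambda>n. Gamma (\<mu> + of_real (X n) - a)) \<longlonglongrightarrow> Gamma (\<mu> + of_real \<alpha> - a)"
      by (intro tendsto_intros X np)
    show "(\<lambda>n. Gamma (\<mu> - of_real (X n) - a)) \<longlonglongrightarrow> Gamma (\<mu> - of_real \<alpha> - a)"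
      by (intro tendsto_intros X np)
  qed auto
  moreover have "\<forall>\<^sub>F n in sequentially. ?I (X n) = ?V (X n)"
  proof -
    have "0 < (Re \<mu> - \<bar>\<alpha>\<bar>) - c" using c by simp
    from tendstoD[OF X(1) this] show ?thesis
    proof eventually_elim
      case (elim n)
      have cn: "c < Re \<mu> - \<bar>X n\<bar>" using elim by (auto simp: dist_real_def)
      have cos: "cos (X n * pi) \<noteq> 0" by (rule not_Ints_of_double[OF X(2)])
      \<comment> \<open>The contour has to follow the moving poles and is chosen anew for each n;
        the line and the set of left poles beside it are the same for all n.\<close>
      obtain R' g' where bc': "barnes_contour (left_lattice (1/2 - \<mu>)) (right_lattice (\<mu> + of_real (X n)) \<union> right_lattice (\<mu> - of_real (X n))) R' g'"
        using barnes_contour_weaving[OF cos] by blast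
      have "2 * of_real pi * \<i> * ?I (X n) = 2 * of_real pi * \<i> * ?V (X n)"
        using meijer_G21_12_line[OF z cos bc' cn cA] meijer_G21_12_barnes_aux[OF z X(2) bc'] by (simp only:)
      then show ?case by (simp only: mult_cancel_left) simp
    qed
  qed
  ultimately have "(\<lambda>n. ?V (X n)) \<longlonglongrightarrow> ?I \<alpha>" by (rule Lim_transform_eventually)
  moreover have "(\<lambda>n. ?V (X n)) \<longlonglongrightarrow> ?V \<alpha>" using \<alpha> by (intro tendsto_intros bessel_K_tendsto X z) auto
  ultimately have "?I \<alpha> = ?V \<alpha>" by (rule LIMSEQ_unique)
  then show ?thesis using meijer_G21_12_line[OF z \<alpha> bc c cA] by (simp only:)
qed

lemma meijer_G21_12:
  assumes z: "Re z > 0" and \<alpha>: "cos (\<alpha> * pi) \<noteq> 0"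
  shows "meijer_G 2 1 [\<mu> + 1/2] [\<mu> + of_real \<alpha>, \<mu> - of_real \<alpha>] (2 * z) =
    of_real (sqrt pi) / of_real (cos (\<alpha> * pi)) * exp (\<mu> * Ln (2 * z)) * exp z * bessel_K \<alpha> z"
proof -
  have A: "meijer_poles_\<alpha> 1 [\<mu> + 1/2] = left_lattice (1/2 - \<mu>)"
  proof -
    have "1 - (\<mu> + 1/2) = 1/2 - \<mu>" by simp
    then show ?thesis by (auto simp: meijer_poles_\<alpha>_def left_lattice_def)
  qed
  have f: "meijer_integrand 2 1 [\<mu> + 1/2] [\<mu> + of_real \<alpha>, \<mu> - of_real \<alpha>] l =
     (\<lambda>\<zeta>. Gamma (\<mu> + of_real \<alpha> - \<zeta>) * Gamma (\<mu> - of_real \<alpha> - \<zeta>) * Gamma (1/2 - \<mu> + \<zeta>) * exp (\<zeta> * l))" for l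
  proof
    fix \<zeta>
    have "1 - (\<mu> + 1/2) + \<zeta> = 1/2 - \<mu> + \<zeta>" by simp
    then show "meijer_integrand 2 1 [\<mu> + 1/2] [\<mu> + of_real \<alpha>, \<mu> - of_real \<alpha>] l \<zeta> =
       Gamma (\<mu> + of_real \<alpha> - \<zeta>) * Gamma (\<mu> - of_real \<alpha> - \<zeta>) * Gamma (1/2 - \<mu> + \<zeta>) * exp (\<zeta> * l)"
      unfolding meijer_integrand_def by (simp add: numeral_2_eq_2 lessThan_Suc)
  qed
  show ?thesis unfolding meijer_G_def
    by (rule meijer_G_Log_eqI, unfold A meijer_poles_simps(2) f)
       (rule barnes_contour_weaving[OF \<alpha>], rule meijer_G21_12_barnes[OF z \<alpha>])
qed

section \<open>The extended Appell function\<close>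

lemma set_integrable_unit_interval:
  fixes f :: "real \<Rightarrow> complex"
  assumes "continuous_on {0<..<1} f" "\<And>t. 0 < t \<Longrightarrow> t < 1 \<Longrightarrow> norm (f t) \<le> M"
  shows "set_integrable lborel {0<..<1} f"
proof -
  have "set_integrable lborel {0<..<1::real} (\<lambda>_. M)" by (simp add: set_integrable_def)
  moreover have "set_borel_measurable lborel {0<..<1} f"
    using borel_measurable_continuous_on_indicator[OF _ assms(1)] by (simp add: set_borel_measurable_def)
  ultimately show ?thesis
    by (rule set_integrable_bound) (use assms(2) in \<open>auto intro!: AE_I2 order.trans[OF _ abs_ge_self]\<close>)
qed

lemma norm_bessel_weight:
  fixes t :: real and u v :: complex
  assumes "0 < t" "t < 1"
  shows "norm (of_real t powr u * (1 - of_real t) powr v) = t powr Re u * (1 - t) powr Re v"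
proof -
  have "(1 - of_real t :: complex) = of_real (1 - t)" by simp
  then show ?thesis using assms by (simp only: norm_mult) (simp add: norm_powr_real_powr)
qed

lemma Re_divide_unit_interval:
  assumes "Re p > 0" "0 < t" "t < (1::real)"
  shows "Re (p / of_real (t * (1 - t))) > 0" "p / of_real (t * (1 - t)) = p * of_real (1 / (t * (1 - t)))"
proof -
  show e: "p / of_real (t * (1 - t)) = p * of_real (1 / (t * (1 - t)))" by simp
  show "Re (p / of_real (t * (1 - t))) > 0" unfolding e using assms by simp
qed

lemma bessel_weight_bounded:
  fixes u v p :: complex
  assumes p: "Re p > 0"
  shows "\<exists>M. \<forall>t. 0 < t \<and> t < 1 \<longrightarrow>
    norm (of_real t powr u * (1 - of_real t) powr v * bessel_K \<alpha> (p / of_real (t * (1 - t)))) \<le> M"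
proof -
  \<comment> \<open>-2c exceeds |Re u| and |Re v|, so the total exponents of t and 1 - t are
    nonnegative; 2c < -|\<alpha>| is what the bound on K demands.\<close>
  define c where "c = - (\<bar>Re u\<bar> + \<bar>Re v\<bar> + \<bar>\<alpha>\<bar> + 1)"
  have c: "2 * c < - \<bar>\<alpha>\<bar>" by (simp add: c_def)
  obtain C where C: "\<And>r. r > 0 \<Longrightarrow> norm (bessel_K \<alpha> (p * of_real r)) \<le> C * r powr (2 * c)"
    using bessel_K_power_bound[OF p c] by blast
  have "norm (of_real t powr u * (1 - of_real t) powr v * bessel_K \<alpha> (p / of_real (t * (1 - t)))) \<le> \<bar>C\<bar>"
    if t: "0 < t" "t < 1" for t
  proof -
    have r: "1 / (t * (1 - t)) > 0" using t by simp
    have "(1 / (t * (1 - t))) powr (2 * c) = t powr (- 2 * c) * (1 - t) powr (- 2 * c)"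
      using t by (simp add: powr_divide powr_mult powr_minus_divide)
    with C[OF r] have K: "norm (bessel_K \<alpha> (p / of_real (t * (1 - t)))) \<le> C * (t powr (- 2 * c) * (1 - t) powr (- 2 * c))"
      unfolding Re_divide_unit_interval(2)[OF p t] by (simp only:)
    have "norm (of_real t powr u * (1 - of_real t) powr v * bessel_K \<alpha> (p / of_real (t * (1 - t)))) =
        t powr Re u * (1 - t) powr Re v * norm (bessel_K \<alpha> (p / of_real (t * (1 - t))))"
      unfolding norm_mult[of "_ * _" "bessel_K _ _"] norm_bessel_weight[OF t] ..
    also have "\<dots> \<le> t powr Re u * (1 - t) powr Re v * (C * (t powr (- 2 * c) * (1 - t) powr (- 2 * c)))"
      by (intro mult_left_mono K) simp
    also have "\<dots> = C * (t powr (Re u - 2 * c) * (1 - t) powr (Re v - 2 * c))"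
    proof -
      have "s powr (q - 2 * c) = s powr q * s powr (- 2 * c)" for s q :: real by (simp flip: powr_add)
      then show ?thesis by (simp only: mult_ac)
    qed
    also have "\<dots> \<le> \<bar>C\<bar> * (1 * 1)"
    proof (intro mult_mono)
      have "0 \<le> Re u - 2 * c" "0 \<le> Re v - 2 * c" by (simp_all add: c_def abs_if)
      then show "t powr (Re u - 2 * c) \<le> 1" "(1 - t) powr (Re v - 2 * c) \<le> 1" using t by (intro powr_le1; simp)+
    qed auto
    finally show ?thesis by simp
  qed
  then show ?thesis by blast
qed

lemma continuous_on_bessel_K_unit_interval:
  assumes p: "Re p > 0"
  shows "continuous_on {0<..<1} (\<lambda>t::real. bessel_K \<alpha> (p / of_real (t * (1 - t))))"
proof -
  have "isCont (\<lambda>t::real. bessel_K \<alpha> (p / of_real (t * (1 - t)))) t" if t: "0 < t" "t < 1" for t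
    unfolding isCont_def tendsto_at_iff_sequentially o_def
  proof (intro allI impI)
    fix X assume X: "X \<longlonglongrightarrow> t"
    show "(\<lambda>n. bessel_K \<alpha> (p / of_real (X n * (1 - X n)))) \<longlonglongrightarrow> bessel_K \<alpha> (p / of_real (t * (1 - t)))"
      using t by (intro bessel_K_tendsto tendsto_intros X Re_divide_unit_interval(1)[OF p t]) auto
  qed
  then show ?thesis by (auto intro!: continuous_at_imp_continuous_on)
qed

lemma continuous_on_powr_off_nonpos_Reals:
  fixes f :: "real \<Rightarrow> complex"
  assumes "continuous_on S f" "\<And>t. t \<in> S \<Longrightarrow> f t \<notin> \<real>\<^sub>\<le>\<^sub>0"
  shows "continuous_on S (\<lambda>t. f t powr a)"
proof -
  have "continuous_on S (\<lambda>t. exp (a * Ln (f t)))"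
    using assms by (intro continuous_on_exp continuous_on_mult continuous_on_const continuous_on_compose2[OF continuous_on_Ln[of "- \<real>\<^sub>\<le>\<^sub>0"] assms(1)]) auto
  moreover have "exp (a * Ln (f t)) = f t powr a" if "t \<in> S" for t
    using assms(2)[OF that] by (auto simp: powr_def)
  ultimately show ?thesis by (simp cong: continuous_on_cong)
qed

lemma continuous_on_bessel_weight:
  fixes u v p :: complex
  assumes p: "Re p > 0"
  shows "continuous_on {0<..<1} (\<lambda>t::real. of_real t powr u * (1 - of_real t) powr v * bessel_K \<alpha> (p / of_real (t * (1 - t))))"
  by (intro continuous_on_mult continuous_on_bessel_K_unit_interval[OF p] continuous_on_powr_off_nonpos_Reals
        continuous_on_diff continuous_on_const continuous_on_of_real continuous_on_id)
     (auto simp: complex_nonpos_Reals_iff)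

text \<open>The double series is enumerated by \<open>prod_decode\<close> so that
  \<open>sums_integral\<close> applies to it as a single series; absolute convergence makes the
  order immaterial.\<close>

lemma has_sum_product_nat:
  fixes a b :: "nat \<Rightarrow> complex"
  assumes "summable (\<lambda>n. norm (a n))" "summable (\<lambda>n. norm (b n))"
  shows "(\<lambda>k. case prod_decode k of (m, n) \<Rightarrow> a m * b n) sums (suminf a * suminf b)"
    and "summable (\<lambda>k. norm (case prod_decode k of (m, n) \<Rightarrow> a m * b n))"
proof -
  let ?g = "\<lambda>(m, n). a m * b n"
  have ab: "Infinite_Set_Sum.abs_summable_on a UNIV" "Infinite_Set_Sum.abs_summable_on b UNIV"
    using assms by (simp_all add: abs_summable_on_nat_iff')
  have "Infinite_Set_Sum.abs_summable_on ?g (UNIV \<times> UNIV)"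
    using ab by (intro abs_summable_on_product) auto
  then have g: "Infinite_Set_Sum.abs_summable_on ?g UNIV" by simp
  have "infsetsum ?g (UNIV \<times> UNIV) = infsetsum a UNIV * infsetsum b UNIV"
    using ab by (intro infsetsum_product) auto
  then have "infsetsum ?g UNIV = suminf a * suminf b" using ab by (simp add: infsetsum_nat')
  moreover have g': "(\<lambda>x. norm (?g x)) summable_on UNIV" using g by (simp add: abs_summable_equivalent)
  ultimately have "(?g has_sum (suminf a * suminf b)) UNIV"
    using infsetsum_infsum[OF g] has_sum_infsum[OF abs_summable_summable[OF g']] by simp
  then have "((\<lambda>k. ?g (prod_decode k)) has_sum (suminf a * suminf b)) UNIV"
    using has_sum_reindex_bij_betw[OF bij_prod_decode, of ?g] by simp
  from has_sum_imp_sums[OF this] show "(\<lambda>k. case prod_decode k of (m, n) \<Rightarrow> a m * b n) sums (suminf a * suminf b)" .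
  have "(\<lambda>k. norm (?g (prod_decode k))) summable_on UNIV"
    using summable_on_reindex_bij_betw[OF bij_prod_decode, of "\<lambda>x. norm (?g x)"] g' by simp
  then show "summable (\<lambda>k. norm (case prod_decode k of (m, n) \<Rightarrow> a m * b n))"
    by (subst (asm) summable_on_UNIV_nonneg_real_iff) auto
qed

lemma binomial_series_sums:
  fixes b w :: complex
  assumes "norm w < 1"
  shows "(\<lambda>n. pochhammer b n * w ^ n / fact n) sums (1 - w) powr (- b)"
    and "summable (\<lambda>n. norm (pochhammer b n * w ^ n / fact n))"
proof -
  have s: "(\<lambda>n. pochhammer b n / fact n * z ^ n) sums (1 - z) powr (- b)" if "norm z < 1" for z :: complex
  proof -
    have "(\<lambda>n. (- b gchoose n) * (- z) ^ n) sums (1 + - z) powr (- b)" using that by (intro gen_binomial_complex) simp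
    moreover have "(- b gchoose n) * (- z) ^ n = pochhammer b n / fact n * z ^ n" for n
    proof -
      have "(- b gchoose n) * (- z) ^ n = ((-1) ^ n * (-1) ^ n) * (pochhammer b n / fact n * z ^ n)"
        unfolding gbinomial_pochhammer power_minus[of z] by simp
      then show ?thesis by (simp flip: power_mult_distrib)
    qed
    ultimately show ?thesis by simp
  qed
  then show "(\<lambda>n. pochhammer b n * w ^ n / fact n) sums (1 - w) powr (- b)" using assms by simp
  \<comment> \<open>A radius strictly between |w| and 1: convergence at r gives absolute convergence
    at w.\<close>
  define r where "r = (1 + norm w) / 2"
  have r: "norm w < r" "r < 1" "r > 0" using assms norm_ge_zero[of w] by (simp_all add: r_def add_pos_nonneg)
  then have "summable (\<lambda>n. pochhammer b n / fact n * (of_real r :: complex) ^ n)"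
    using s[of "of_real r"] by (auto simp: sums_iff)
  from powser_insidea[OF this, of w] r show "summable (\<lambda>n. norm (pochhammer b n * w ^ n / fact n))" by simp
qed

text \<open>The segment from 1 to 1 - x meets the nonpositive real axis only if x is real and x >=
  1. The case x = 1 is excluded separately, since Arg 0 = 0 satisfies the bound on the
  argument.\<close>

lemma one_minus_notin_nonpos_Reals:
  fixes x :: complex and t :: real
  assumes x: "x \<noteq> 1" "\<bar>Arg (1 - x)\<bar> < pi" and t: "0 \<le> t" "t \<le> 1"
  shows "1 - x * of_real t \<notin> \<real>\<^sub>\<le>\<^sub>0"
proof
  assume "1 - x * of_real t \<in> \<real>\<^sub>\<le>\<^sub>0"
  then have re: "Re x * t \<ge> 1" and im: "Im x * t = 0" by (auto simp: complex_nonpos_Reals_iff)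
  then have t0: "t > 0" using t by (cases "t = 0") auto
  then have "Im x = 0" using im by simp
  moreover have "Re x \<ge> 1"
  proof (rule ccontr)
    assume "\<not> Re x \<ge> 1"
    then have "Re x * t < 1 * t" using t0 by (intro mult_strict_right_mono) auto
    then show False using re t by simp
  qed
  ultimately have "1 - x = of_real (1 - Re x)" "1 - Re x < 0"
    using x(1) by (auto simp: complex_eq_iff less_le)
  then have "Arg (1 - x) = pi" by (metis Arg_of_real)
  then show False using x(2) by simp
qed

section \<open>Termwise integration of the double series\<close>

locale appell_parameters =
  fixes p b1 b2 b3 c1 x y :: complex and \<nu> :: real
  assumes p: "Re p > 0"
    and x: "x \<noteq> 1" "\<bar>Arg (1 - x)\<bar> < pi" and y: "y \<noteq> 1" "\<bar>Arg (1 - y)\<bar> < pi"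
begin

definition weight :: "real \<Rightarrow> complex" where
  "weight t = of_real t powr (b1 - 3/2) * (1 - of_real t) powr (c1 - b1 - 3/2) * bessel_K (\<nu> + 1/2) (p / of_real (t * (1 - t)))"

definition F :: "real \<Rightarrow> complex" where
  "F t = of_real t powr (b1 - 3/2) * (1 - of_real t) powr (c1 - b1 - 3/2) *
        (1 - x * of_real t) powr (- b2) * (1 - y * of_real t) powr (- b3) *
        bessel_K (\<nu> + 1/2) (p / of_real (t * (1 - t)))"

lemma F_weight: "F t = weight t * ((1 - x * of_real t) powr (- b2) * (1 - y * of_real t) powr (- b3))"
  by (simp add: F_def weight_def mult_ac)

lemma set_integrable_F: "set_integrable lborel {0<..<1} F"
proof -
  let ?g = "\<lambda>t::real. (1 - x * of_real t) powr (- b2) * (1 - y * of_real t) powr (- b3)"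
  have cg: "continuous_on {0..1} ?g"
    by (intro continuous_on_mult continuous_on_powr_off_nonpos_Reals one_minus_notin_nonpos_Reals x y
        continuous_on_diff continuous_on_const continuous_on_of_real continuous_on_id) auto
  obtain Mg where Mg: "\<And>t. 0 \<le> t \<Longrightarrow> t \<le> 1 \<Longrightarrow> norm (?g t) \<le> Mg"
    using compact_imp_bounded[OF compact_continuous_image[OF cg compact_Icc]] by (fastforce simp: bounded_iff)
  obtain Mw where Mw: "\<And>t. 0 < t \<Longrightarrow> t < 1 \<Longrightarrow> norm (weight t) \<le> Mw"
    using bessel_weight_bounded[OF p] unfolding weight_def by blast
  show ?thesis
  proof (rule set_integrable_unit_interval)
    show "continuous_on {0<..<1} F"
      unfolding F_weight[abs_def] weight_def
      by (intro continuous_on_mult[OF continuous_on_bessel_weight[OF p] continuous_on_subset[OF cg]]) auto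
    show "norm (F t) \<le> Mw * Mg" if "0 < t" "t < 1" for t
      unfolding F_weight norm_mult[of "weight t"] using that order.trans[OF norm_ge_zero Mw[OF that]]
      by (intro mult_mono Mw Mg) auto
  qed
qed

text \<open>Expand both binomial factors in powers of t. The weight is bounded and t^(m + n) <= 1,
  so the products of the absolute coefficients majorise the terms. In each term t^(m + n) merges
  with the power of t, which gives the extended beta function with shifted first argument.\<close>

lemma series_eq_integral:
  assumes nx: "norm x < 1" and ny: "norm y < 1"
  shows "ext_appell_F1_series p \<nu> b1 b2 b3 c1 x y =
    Gamma c1 / (Gamma b1 * Gamma (c1 - b1)) * csqrt (2 * p / of_real pi) * (LINT t:{0<..<1}|lborel. F t)"
proof -
  define a where "a n = pochhammer b2 n * x ^ n / fact n" for n
  define b where "b n = pochhammer b3 n * y ^ n / fact n" for n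
  have sa: "summable (\<lambda>n. norm (a n))" and sb: "summable (\<lambda>n. norm (b n))"
    unfolding a_def b_def using binomial_series_sums(2) nx ny by blast+
  note sab = has_sum_product_nat(2)[OF sa sb]
  obtain M where M: "\<And>t. 0 < t \<Longrightarrow> t < 1 \<Longrightarrow> norm (weight t) \<le> M"
    using bessel_weight_bounded[OF p] unfolding weight_def by blast
  have M0: "M \<ge> 0" using order.trans[OF norm_ge_zero M[of "1/2"]] by simp
  define f where "f k t = (case prod_decode k of (m, n) \<Rightarrow> weight t * of_real t ^ (m + n) * (a m * b n))" for k t
  define e where "e k = norm (case prod_decode k of (m, n) \<Rightarrow> a m * b n)" for k
  have fb: "norm (f k t) \<le> M * e k" if t: "0 < t" "t < 1" for k t
  proof -
    obtain m n where mn: "prod_decode k = (m, n)" by fastforce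
    have "norm (weight t * of_real t ^ (m + n)) \<le> M * 1"
      unfolding norm_mult norm_power using t M0 by (intro mult_mono M power_le_one) auto
    then show ?thesis unfolding f_def e_def mn prod.case norm_mult[of "weight t * _"] by (intro mult_right_mono) auto
  qed
  have fi: "set_integrable lborel {0<..<1} (f k)" for k
  proof (rule set_integrable_unit_interval[OF _ fb])
    show "continuous_on {0<..<1} (f k)"
      unfolding f_def weight_def case_prod_beta
      by (intro continuous_on_mult[OF continuous_on_mult[OF continuous_on_bessel_weight[OF p]]] continuous_intros)
  qed
  let ?f = "\<lambda>k t. indicat_real {0<..<1} t *\<^sub>R f k t"
  have fi': "integrable lborel (?f k)" for k using fi by (simp add: set_integrable_def)
  have sum_e: "summable (\<lambda>k. M * e k)" using sab unfolding e_def by (rule summable_mult)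
  have nb: "norm (?f k t) \<le> M * e k" for k t
    using fb[of t k] M0 by (auto simp: indicator_def e_def)
  have li: "(LINT t|lborel. norm (?f k t)) \<le> M * e k" for k
  proof -
    have "(LINT t|lborel. norm (?f k t)) \<le> (LINT t|lborel. indicat_real {0<..<1::real} t * (M * e k))"
    proof (rule Bochner_Integration.integral_mono[OF integrable_norm[OF fi'[of k]]])
      have "set_integrable lborel {0<..<1::real} (\<lambda>_. M * e k)" by (simp add: set_integrable_def)
      then show "integrable lborel (\<lambda>t. indicat_real {0<..<1::real} t * (M * e k))" by (simp only: set_integrable_def real_scaleR_def)
      show "norm (?f k t) \<le> indicat_real {0<..<1} t * (M * e k)" for t using fb[of t k] by (simp add: indicator_def)
    qed
    also have "\<dots> = M * e k" by simp
    finally show ?thesis .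
  qed
  have sli: "summable (\<lambda>k. LINT t|lborel. norm (?f k t))"
    by (rule summable_comparison_test'[OF sum_e, of 0]) (use li in simp)
  have "(\<lambda>k. integral\<^sup>L lborel (?f k)) sums (LINT t|lborel. (\<Sum>k. ?f k t))"
    by (rule sums_integral[OF fi' AE_I2 sli]) (rule summable_comparison_test'[OF sum_e, of 0], use nb in simp)
  also have "(\<lambda>t. \<Sum>k. ?f k t) = (\<lambda>t. indicat_real {0<..<1} t *\<^sub>R F t)"
  proof
    fix t
    show "(\<Sum>k. ?f k t) = indicat_real {0<..<1} t *\<^sub>R F t"
    proof (cases "t \<in> {0<..<1}")
      case True
      then have nt: "norm (x * of_real t) < 1" "norm (y * of_real t) < 1"
        using nx ny mult_strict_mono[of "norm x" 1 t 1] mult_strict_mono[of "norm y" 1 t 1] by (auto simp: norm_mult)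
      let ?a = "\<lambda>n. pochhammer b2 n * (x * of_real t) ^ n / fact n"
      let ?b = "\<lambda>n. pochhammer b3 n * (y * of_real t) ^ n / fact n"
      have "(\<lambda>k. case prod_decode k of (m, n) \<Rightarrow> ?a m * ?b n) sums (suminf ?a * suminf ?b)"
        by (intro has_sum_product_nat binomial_series_sums nt)
      then have "(\<lambda>k. weight t * (case prod_decode k of (m, n) \<Rightarrow> ?a m * ?b n)) sums (weight t * (suminf ?a * suminf ?b))"
        by (rule sums_mult)
      also have "(\<lambda>k. weight t * (case prod_decode k of (m, n) \<Rightarrow> ?a m * ?b n)) = (\<lambda>k. f k t)"
        by (auto simp: f_def a_def b_def power_mult_distrib power_add case_prod_beta)
      also have "weight t * (suminf ?a * suminf ?b) = F t"
        using binomial_series_sums(1)[OF nt(1), of b2] binomial_series_sums(1)[OF nt(2), of b3] by (simp add: sums_iff F_weight)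
      finally show ?thesis using True by (simp add: sums_iff)
    qed simp
  qed
  finally have sums: "(\<lambda>k. integral\<^sup>L lborel (?f k)) sums (LINT t:{0<..<1}|lborel. F t)"
    by (simp add: set_lebesgue_integral_def)
  have "summable (\<lambda>k. norm (integral\<^sup>L lborel (?f k)))"
  proof (rule summable_comparison_test'[OF sli, of 0])
    show "norm (norm (integral\<^sup>L lborel (?f k))) \<le> (LINT t|lborel. norm (?f k t))" for k
      unfolding real_norm_def abs_norm_cancel by (rule integral_norm_bound)
  qed
  from norm_summable_imp_has_sum[OF this sums]
  have hs: "((\<lambda>k. integral\<^sup>L lborel (?f k)) has_sum (LINT t:{0<..<1}|lborel. F t)) UNIV" .
  define T where "T = (\<lambda>(m, n). pochhammer b2 m * pochhammer b3 n * ext_beta p \<nu> (b1 + of_nat m + of_nat n) (c1 - b1) /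
        Beta b1 (c1 - b1) * (x ^ m / fact m) * (y ^ n / fact n))"
  define K where "K = Gamma c1 / (Gamma b1 * Gamma (c1 - b1)) * csqrt (2 * p / of_real pi)"
  have T: "T (prod_decode k) = K * integral\<^sup>L lborel (?f k)" for k
  proof -
    obtain m n where mn: "prod_decode k = (m, n)" by fastforce
    have "(LINT t:{0<..<1}|lborel. of_real t powr (b1 + of_nat m + of_nat n - 3/2) * (1 - of_real t) powr (c1 - b1 - 3/2) *
        bessel_K (\<nu> + 1/2) (p / of_real (t * (1 - t)))) = (LINT t:{0<..<1}|lborel. weight t * of_real t ^ (m + n))"
    proof (rule set_lebesgue_integral_cong, simp, intro allI impI)
      fix t :: real assume t: "t \<in> {0<..<1}"
      have "b1 + of_nat m + of_nat n - 3/2 = (b1 - 3/2) + of_nat (m + n)" by simp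
      then have "of_real t powr (b1 + of_nat m + of_nat n - 3/2) = of_real t powr (b1 - 3/2) * of_real t powr (of_nat (m + n) :: complex)"
        by (simp only: powr_add)
      also have "of_real t powr (of_nat (m + n) :: complex) = of_real t ^ (m + n)" using t by (intro powr_nat') auto
      finally show "of_real t powr (b1 + of_nat m + of_nat n - 3/2) * (1 - of_real t) powr (c1 - b1 - 3/2) *
        bessel_K (\<nu> + 1/2) (p / of_real (t * (1 - t))) = weight t * of_real t ^ (m + n)"
        by (simp only: weight_def mult_ac)
    qed
    then have eb: "ext_beta p \<nu> (b1 + of_nat m + of_nat n) (c1 - b1) = csqrt (2 * p / of_real pi) * (LINT t:{0<..<1}|lborel. weight t * of_real t ^ (m + n))"
      by (simp only: ext_beta_def)
    have "integral\<^sup>L lborel (?f k) = (LINT t:{0<..<1}|lborel. weight t * of_real t ^ (m + n) * (a m * b n))"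
      unfolding set_lebesgue_integral_def f_def mn prod.case ..
    also have "\<dots> = (LINT t:{0<..<1}|lborel. weight t * of_real t ^ (m + n)) * (a m * b n)"
      by (rule set_integral_mult_left)
    finally show ?thesis unfolding T_def mn prod.case eb
      by (simp add: K_def Beta_def a_def b_def mult_ac)
  qed
  have "((\<lambda>k. T (prod_decode k)) has_sum (K * (LINT t:{0<..<1}|lborel. F t))) UNIV"
    unfolding T by (rule has_sum_cmult_right[OF hs])
  then have "(T has_sum (K * (LINT t:{0<..<1}|lborel. F t))) UNIV"
    using has_sum_reindex_bij_betw[OF bij_prod_decode, of T] by simp
  then have "infsum T UNIV = K * (LINT t:{0<..<1}|lborel. F t)" by (rule infsumI)
  then show ?thesis by (simp add: ext_appell_F1_series_def T_def K_def)
qed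

lemma ext_appell_F1_eq:
  "ext_appell_F1 p \<nu> b1 b2 b3 c1 x y =
    Gamma c1 / (Gamma b1 * Gamma (c1 - b1)) * csqrt (2 * p / of_real pi) * (LINT t:{0<..<1}|lborel. F t)"
proof (cases "norm x < 1 \<and> norm y < 1")
  case True
  then show ?thesis unfolding ext_appell_F1_def using series_eq_integral by simp
next
  case False
  then show ?thesis unfolding ext_appell_F1_def by (simp only: if_False ext_appell_F1_integral_def F_def)
qed

end

section \<open>From the G-functions to the Euler integrand\<close>

context appell_parameters
begin

text \<open>The common pattern of the five claims: k is the constant in the evaluation of the
  G-function, and the prefactor D undoes it.\<close>

lemma ext_appell_F1_multiple:
  assumes "\<And>t. 0 < t \<Longrightarrow> t < 1 \<Longrightarrow> f t = k * F t"
    and "Gamma c1 / (Gamma b1 * Gamma (c1 - b1)) * csqrt (2 * p / of_real pi) = D * k"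
  shows "set_integrable lborel {0<..<1} f \<and> ext_appell_F1 p \<nu> b1 b2 b3 c1 x y = D * (LINT t:{0<..<1}|lborel. f t)"
proof
  have "set_integrable lborel {0<..<1} (\<lambda>t. k * F t)" using set_integrable_F by simp
  moreover have "set_integrable lborel {0<..<1} f = set_integrable lborel {0<..<1} (\<lambda>t. k * F t)"
    using assms(1) by (intro set_integrable_cong) auto
  ultimately show "set_integrable lborel {0<..<1} f" by simp
  have "(LINT t:{0<..<1}|lborel. f t) = (LINT t:{0<..<1}|lborel. k * F t)"
    using assms(1) by (intro set_lebesgue_integral_cong) auto
  then show "ext_appell_F1 p \<nu> b1 b2 b3 c1 x y = D * (LINT t:{0<..<1}|lborel. f t)"
    unfolding ext_appell_F1_eq assms(2) by simp
qed

lemma powr_shift_unit_interval: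
  fixes \<mu> :: complex and t :: real
  assumes t: "0 < t" "t < 1"
  shows "of_real t powr (b1 + \<mu> - 3/2) * (1 - of_real t) powr (c1 - b1 + \<mu> - 3/2) =
    exp (\<mu> * of_real (ln (t * (1 - t)))) * (of_real t powr (b1 - 3/2) * (1 - of_real t) powr (c1 - b1 - 3/2))"
proof -
  have e: "(1 - of_real t :: complex) = of_real (1 - t)" by simp
  have p: "of_real s powr w = exp (w * of_real (ln s))" if "s > 0" for s :: real and w :: complex
    using that by (simp add: powr_def Ln_of_real)
  have l: "ln (t * (1 - t)) = ln t + ln (1 - t)" using t by (simp add: ln_mult)
  have p1: "of_real (1 - t) powr w = exp (w * of_real (ln (1 - t)))" for w :: complex by (rule p) (use t in simp)
  show ?thesis unfolding e p[OF t(1)] p1 l exp_add[symmetric] of_real_add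
    by (rule arg_cong[where f = exp]) (simp add: algebra_simps)
qed

lemma Ln_argument:
  assumes t: "0 < t" "t < (1::real)"
  shows "Ln (p / of_real (t * (1 - t))) = Ln p - of_real (ln (t * (1 - t)))"
proof -
  have "ln (1 / (t * (1 - t))) = - ln (t * (1 - t))" using t by (simp add: ln_div)
  then show ?thesis unfolding Re_divide_unit_interval(2)[OF p t] using Ln_scale[of "1 / (t * (1 - t))" p] p t by simp
qed

text \<open>The factor (t (1 - t))^\<mu> in front cancels the t-dependence of the power z^\<mu>
  produced by the G-function and leaves p^\<mu>. As t (1 - t) > 0, the logarithms split without
  branch corrections.\<close>

lemma F_shift:
  fixes \<mu> :: complex and t :: real
  assumes t: "0 < t" "t < 1"
  shows "of_real t powr (b1 + \<mu> - 3/2) * (1 - of_real t) powr (c1 - b1 + \<mu> - 3/2) *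
      (1 - x * of_real t) powr (- b2) * (1 - y * of_real t) powr (- b3) *
      (M * (exp (\<mu> * Ln (p / of_real (t * (1 - t)))) * bessel_K (\<nu> + 1/2) (p / of_real (t * (1 - t))))) =
    M * exp (\<mu> * Ln p) * F t"
proof -
  have "exp (\<mu> * of_real (ln (t * (1 - t)))) * exp (\<mu> * Ln (p / of_real (t * (1 - t)))) = exp (\<mu> * Ln p)"
    unfolding Ln_argument[OF t] exp_add[symmetric] by (simp add: algebra_simps)
  note E = this
  show ?thesis unfolding powr_shift_unit_interval[OF t] F_def E[symmetric] by (simp only: mult_ac)
qed

end

lemma exp_of_real_ln: "a > 0 \<Longrightarrow> exp (complex_of_real (ln a)) = of_real a"
  by (simp add: exp_of_real)

lemma csqrt_eq_exp: "z \<noteq> 0 \<Longrightarrow> csqrt z = exp (Ln z / 2)"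
  by (simp add: csqrt_exp_Ln)

text \<open>Integrability is asserted with each formula because a Lebesgue integral that does not
  converge has the default value 0. For natural \<nu> no separating contour for G^{2,1} exists,
  hence the condition in (ii) and (iv). In (v) the argument is passed through its logarithm, since
  four times the angle of p may exceed pi. The factor 1 / sqrt(pi) in (iii), absent from the
  informal formula, is forced: G^{2,0}_{0,2}(z^2/4) equals 2 (z/2)^\<mu> K(z), and nothing there
  cancels the sqrt(pi) of sqrt(2p/pi).\<close>

theorem theorem1:
  fixes p b1 b2 b3 c1 x y \<mu> C :: complex and \<nu> :: real
  assumes "Re p > 0" and "\<nu> \<ge> 0"
    and "Re b1 > 0" and "Re c1 > Re b1"
    and "x \<noteq> 1" and "\<bar>Arg (1 - x)\<bar> < pi"
    and "y \<noteq> 1" and "\<bar>Arg (1 - y)\<bar> < pi"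
    and C: "C = Gamma c1 / (Gamma b1 * Gamma (c1 - b1))"
  shows
    "(let f = (\<lambda>t::real.
          of_real t powr (b1 - 3/2) * (1 - of_real t) powr (c1 - b1 - 3/2) *
          (1 - x * of_real t) powr (- b2) * (1 - y * of_real t) powr (- b3) *
          exp (p / of_real (t * (1 - t))) *
          meijer_G 2 0 [1/2] [of_real \<nu> + 1/2, - of_real \<nu> - 1/2] (2 * p / of_real (t * (1 - t))))
      in set_integrable lborel {0<..<1} f \<and>
         ext_appell_F1 p \<nu> b1 b2 b3 c1 x y =
           C * csqrt (2 * p) * (LINT t:{0<..<1}|lborel. f t))
     \<and>
     (\<nu> \<notin> \<nat> \<longrightarrow>
     (let f = (\<lambda>t::real.
          of_real t powr (b1 - 3/2) * (1 - of_real t) powr (c1 - b1 - 3/2) *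
          (1 - x * of_real t) powr (- b2) * (1 - y * of_real t) powr (- b3) *
          exp (- p / of_real (t * (1 - t))) *
          meijer_G 2 1 [1/2] [of_real \<nu> + 1/2, - of_real \<nu> - 1/2] (2 * p / of_real (t * (1 - t))))
      in set_integrable lborel {0<..<1} f \<and>
         ext_appell_F1 p \<nu> b1 b2 b3 c1 x y =
           C * csqrt (2 * p) * of_real (cos (pi * (\<nu> + 1/2)) / pi) *
           (LINT t:{0<..<1}|lborel. f t)))
     \<and>
     (let f = (\<lambda>t::real.
          of_real t powr (b1 + \<mu> - 3/2) * (1 - of_real t) powr (c1 - b1 + \<mu> - 3/2) *
          (1 - x * of_real t) powr (- b2) * (1 - y * of_real t) powr (- b3) *
          meijer_G 2 0 [] [(2*\<mu> + 2 * of_real \<nu> + 1)/4, (2*\<mu> - 2 * of_real \<nu> - 1)/4]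
            (p\<^sup>2 / of_real (4 * t\<^sup>2 * (1 - t)\<^sup>2)))
      in set_integrable lborel {0<..<1} f \<and>
         ext_appell_F1 p \<nu> b1 b2 b3 c1 x y =
           C * (2 powr (\<mu> - 1/2) * p powr (- \<mu> + 1/2) / of_real (sqrt pi)) *
           (LINT t:{0<..<1}|lborel. f t))
     \<and>
     (\<nu> \<notin> \<nat> \<longrightarrow>
     (let f = (\<lambda>t::real.
          of_real t powr (b1 + \<mu> - 3/2) * (1 - of_real t) powr (c1 - b1 + \<mu> - 3/2) *
          (1 - x * of_real t) powr (- b2) * (1 - y * of_real t) powr (- b3) *
          exp (- p / of_real (t * (1 - t))) *
          meijer_G 2 1 [(2*\<mu> + 1)/2] [(2*\<mu> + 2 * of_real \<nu> + 1)/2, (2*\<mu> - 2 * of_real \<nu> - 1)/2]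
            (2 * p / of_real (t * (1 - t))))
      in set_integrable lborel {0<..<1} f \<and>
         ext_appell_F1 p \<nu> b1 b2 b3 c1 x y =
           C * (2 * p) powr (- \<mu> + 1/2) * of_real (cos (pi * (\<nu> + 1/2)) / pi) *
           (LINT t:{0<..<1}|lborel. f t)))
     \<and>
     (let f = (\<lambda>t::real.
          of_real t powr (b1 + \<mu> - 3/2) * (1 - of_real t) powr (c1 - b1 + \<mu> - 3/2) *
          (1 - x * of_real t) powr (- b2) * (1 - y * of_real t) powr (- b3) *
          meijer_G_Log 4 0 []
            [(2*\<mu> + 2 * of_real \<nu> + 1)/8, (2*\<mu> + 2 * of_real \<nu> + 5)/8,
             (2*\<mu> - 2 * of_real \<nu> - 1)/8, (2*\<mu> - 2 * of_real \<nu> + 3)/8]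
            (4 * Ln (p / of_real (4 * t * (1 - t)))))
      in set_integrable lborel {0<..<1} f \<and>
         ext_appell_F1 p \<nu> b1 b2 b3 c1 x y =
           C * (p powr (- \<mu> + 1/2) * 2 powr (2*\<mu> - 3/2) / of_real (pi powr (3/2))) *
           (LINT t:{0<..<1}|lborel. f t))"
proof -
  interpret appell_parameters p b1 b2 b3 c1 x y \<nu> by unfold_locales (rule assms)+
  define \<alpha> where "\<alpha> = \<nu> + 1/2"
  let ?z = "\<lambda>t::real. p / of_real (t * (1 - t))"
  have p0: "p \<noteq> 0" using \<open>Re p > 0\<close> by auto
  have z: "Re (?z t) > 0" if "0 < t" "t < 1" for t using Re_divide_unit_interval(1)[OF \<open>Re p > 0\<close> that] .
  \<comment> \<open>All constants become exponentials in Ln p, ln 2 and ln pi, so that identities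
    between principal powers reduce to linear identities between exponents.\<close>
  have spi: "complex_of_real (sqrt pi) = exp (of_real (ln pi / 2))" "complex_of_real pi = exp (of_real (ln pi))"
    using exp_of_real_ln[of "sqrt pi"] exp_of_real_ln[of pi] by (simp_all add: ln_sqrt)
  have c2p: "csqrt (2 * p) = exp ((Ln p + of_real (ln 2)) / 2)"
    using csqrt_eq_exp[of "2 * p"] p0 Ln_double[OF \<open>Re p > 0\<close>] by simp
  have c2pi: "csqrt (2 * p / of_real pi) = exp ((Ln p + of_real (ln 2) - of_real (ln pi)) / 2)"
  proof -
    have "2 * p / of_real pi = p * of_real (2 / pi)" by simp
    moreover have "ln (2 / pi) = ln 2 - ln pi" by (simp add: ln_div)
    moreover have "Ln (p * of_real (2 / pi)) = Ln p + of_real (ln (2 / pi))" using \<open>Re p > 0\<close> by (intro Ln_scale) auto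
    ultimately have "Ln (2 * p / of_real pi) = Ln p + of_real (ln 2) - of_real (ln pi)"
      by (simp only: of_real_diff add_diff_eq)
    then show ?thesis using csqrt_eq_exp[of "2 * p / of_real pi"] p0 by simp
  qed
  have cos0: "cos (\<alpha> * pi) \<noteq> 0" if "\<nu> \<notin> \<nat>"
  proof
    assume "cos (\<alpha> * pi) = 0"
    then have "sin (\<nu> * pi) = 0" by (simp add: \<alpha>_def distrib_right cos_add)
    then obtain n :: int where "\<nu> = of_int n" by (auto simp: sin_zero_iff_int2)
    then show False using that \<open>\<nu> \<ge> 0\<close> by (metis Nats_altdef2 Ints_of_int mem_Collect_eq)
  qed
  have l1: "[of_real \<nu> + 1/2, - of_real \<nu> - 1/2] = [of_real \<alpha>, - of_real \<alpha> :: complex]" by (simp add: \<alpha>_def)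
  have l2: "[(2*\<mu> + 1)/2] = [\<mu> + 1/2]"
    "[(2*\<mu> + 2 * of_real \<nu> + 1)/2, (2*\<mu> - 2 * of_real \<nu> - 1)/2] = [\<mu> + of_real \<alpha>, \<mu> - of_real \<alpha>]" by (simp_all add: \<alpha>_def field_simps)
  have l3: "[(2*\<mu> + 2 * of_real \<nu> + 1)/4, (2*\<mu> - 2 * of_real \<nu> - 1)/4] = [(\<mu> + of_real \<alpha>) / 2, (\<mu> - of_real \<alpha>) / 2]" by (simp add: \<alpha>_def field_simps)
  have l5: "[(2*\<mu> + 2 * of_real \<nu> + 1)/8, (2*\<mu> + 2 * of_real \<nu> + 5)/8, (2*\<mu> - 2 * of_real \<nu> - 1)/8, (2*\<mu> - 2 * of_real \<nu> + 3)/8] =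
     [(\<mu> + of_real \<alpha>) / 4, (\<mu> + of_real \<alpha>) / 4 + 1/2, (\<mu> - of_real \<alpha>) / 4, (\<mu> - of_real \<alpha>) / 4 + 1/2]" by (simp add: \<alpha>_def field_simps)
  have arg: "2 * p / of_real (t * (1 - t)) = 2 * ?z t" for t by simp
  have ee: "exp (?z t) * exp (- ?z t) = 1" "exp (- ?z t) * exp (?z t) = 1" for t by (simp_all flip: exp_add)
  have G3: "meijer_G 2 0 [] [(\<mu> + of_real \<alpha>) / 2, (\<mu> - of_real \<alpha>) / 2] (p\<^sup>2 / of_real (4 * t\<^sup>2 * (1 - t)\<^sup>2)) =
      2 * exp (- \<mu> * of_real (ln 2)) * (exp (\<mu> * Ln (?z t)) * bessel_K \<alpha> (?z t))" if t: "0 < t" "t < 1" for t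
  proof -
    have "p\<^sup>2 / of_real (4 * t\<^sup>2 * (1 - t)\<^sup>2) = (?z t / 2) ^ 2" by (simp add: power2_eq_square)
    \<comment> \<open>Re z > 0 gives |2 Arg(z/2)| < pi, so the principal branch at z^2/4 is the
      branch with logarithm 2 Ln(z/2).\<close>
    moreover have "\<bar>real 2 * Arg (?z t / 2)\<bar> < pi"
    proof -
      have A: "\<bar>2 * Arg w\<bar> < pi" if "Re w > 0" for w
      proof -
        have "w \<noteq> 0" using that by auto
        then show ?thesis using abs_Im_Ln_lt[OF that] by (simp add: Arg_eq_Im_Ln)
      qed
      have "Re (?z t / 2) = Re (?z t) / 2" by (rule Re_divide_numeral)
      then have "Re (?z t / 2) > 0" using z[OF t] by (simp only: half_gt_zero)
      from A[OF this] show ?thesis by (simp only: of_nat_numeral)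
    qed
    ultimately have "meijer_G 2 0 [] [(\<mu> + of_real \<alpha>) / 2, (\<mu> - of_real \<alpha>) / 2] (p\<^sup>2 / of_real (4 * t\<^sup>2 * (1 - t)\<^sup>2)) =
        meijer_G_Log 2 0 [] [(\<mu> + of_real \<alpha>) / 2, (\<mu> - of_real \<alpha>) / 2] (of_nat 2 * Ln (?z t / 2))"
      using z[OF t] by (subst meijer_G_Log_power) auto
    also have "\<dots> = 2 * exp (\<mu> * Ln (?z t / 2)) * bessel_K \<alpha> (?z t)" using meijer_G20_02[OF z[OF t], of \<mu> \<alpha>] by simp
    also have "exp (\<mu> * Ln (?z t / 2)) = exp (- \<mu> * of_real (ln 2)) * exp (\<mu> * Ln (?z t))"
      unfolding Ln_half[OF z[OF t]] exp_add[symmetric] by (simp add: algebra_simps)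
    finally show ?thesis by (simp only: mult.assoc)
  qed
  have G2: "exp (- p / of_real (t * (1 - t))) * meijer_G 2 1 [m + 1/2] [m + of_real \<alpha>, m - of_real \<alpha>] (2 * p / of_real (t * (1 - t))) =
      of_real (sqrt pi) / of_real (cos (\<alpha> * pi)) * exp (m * of_real (ln 2)) * (exp (m * Ln (?z t)) * bessel_K \<alpha> (?z t))"
    if t: "0 < t" "t < 1" and "\<nu> \<notin> \<nat>" for t m
  proof -
    have "- p / of_real (t * (1 - t)) = - ?z t" by simp
    then have "exp (- p / of_real (t * (1 - t))) * meijer_G 2 1 [m + 1/2] [m + of_real \<alpha>, m - of_real \<alpha>] (2 * p / of_real (t * (1 - t))) =
       (exp (- ?z t) * exp (?z t)) * (of_real (sqrt pi) / of_real (cos (\<alpha> * pi)) * exp (m * Ln (2 * ?z t)) * bessel_K \<alpha> (?z t))"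
      unfolding arg meijer_G21_12[OF z[OF t] cos0[OF that(3)]] by (simp only: mult_ac)
    also have "exp (m * Ln (2 * ?z t)) = exp (m * of_real (ln 2)) * exp (m * Ln (?z t))"
      unfolding Ln_double[OF z[OF t]] exp_add[symmetric] by (simp add: algebra_simps)
    finally show ?thesis unfolding ee by (simp only: mult_1_left mult.assoc)
  qed
  have G5: "meijer_G_Log 4 0 [] [(\<mu> + of_real \<alpha>) / 4, (\<mu> + of_real \<alpha>) / 4 + 1/2, (\<mu> - of_real \<alpha>) / 4, (\<mu> - of_real \<alpha>) / 4 + 1/2]
        (4 * Ln (p / of_real (4 * t * (1 - t)))) =
      of_real pi * exp ((2 - 2 * \<mu>) * of_real (ln 2)) * (exp (\<mu> * Ln (?z t)) * bessel_K \<alpha> (?z t))" if t: "0 < t" "t < 1" for t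
  proof -
    have "p / of_real (4 * t * (1 - t)) = ?z t / 4" by simp
    moreover have "exp ((2 - \<mu>) * of_real (ln 2)) * exp (\<mu> * Ln (?z t / 2)) = exp ((2 - 2 * \<mu>) * of_real (ln 2)) * exp (\<mu> * Ln (?z t))"
      unfolding Ln_half[OF z[OF t]] exp_add[symmetric] by (simp add: algebra_simps)
    ultimately show ?thesis using meijer_G40_04[OF z[OF t], of \<mu> \<alpha>] by (simp only: mult.assoc)
  qed
  have cospi: "cos (pi * (\<nu> + 1/2)) = cos (\<alpha> * pi)" by (simp add: \<alpha>_def mult.commute)
  have q: "csqrt (2 * p / of_real pi) = csqrt (2 * p) * (1 / of_real (sqrt pi))"
    unfolding c2p c2pi spi(1) by (simp add: exp_diff diff_divide_distrib)
  have r: "of_real (cos (\<alpha> * pi) / pi) * (of_real (sqrt pi) / of_real (cos (\<alpha> * pi))) = (1 / of_real (sqrt pi) :: complex)" if "\<nu> \<notin> \<nat>"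
  proof -
    have "cos (\<alpha> * pi) / pi * (sqrt pi / cos (\<alpha> * pi)) = 1 / sqrt pi" using cos0[OF that] by (simp add: real_div_sqrt field_simps)
    then show ?thesis by (metis of_real_1 of_real_divide of_real_mult)
  qed
  have pw: "p powr w = exp (w * Ln p)" "2 powr w = exp (w * of_real (ln 2))" "(2 * p) powr w = exp (w * (Ln p + of_real (ln 2)))" for w
    using p0 Ln_double[OF \<open>Re p > 0\<close>] Ln_of_real[of 2] by (simp_all add: powr_def)
  have two: "2 * X = exp (of_real (ln 2)) * X" for X :: complex using exp_of_real_ln[of 2] by simp
  have pi32: "complex_of_real (pi powr (3/2)) = exp (3/2 * of_real (ln pi))"
  proof -
    have "complex_of_real (exp (3/2 * ln pi)) = exp (of_real (3/2 * ln pi))" by (rule exp_of_real[symmetric])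
    then show ?thesis by (simp add: powr_def)
  qed
  note shift = F_shift[folded \<alpha>_def]
  show ?thesis
    unfolding Let_def l1 l2 l3 l5 C cospi
  proof (rule conjI[OF ext_appell_F1_multiple[where k = "1 / of_real (sqrt pi)"]
        conjI[OF impI[OF ext_appell_F1_multiple[where k = "of_real (sqrt pi) / of_real (cos (\<alpha> * pi))"]]
        conjI[OF ext_appell_F1_multiple[where k = "2 * exp (- \<mu> * of_real (ln 2)) * exp (\<mu> * Ln p)"]
        conjI[OF impI[OF ext_appell_F1_multiple[where k = "of_real (sqrt pi) / of_real (cos (\<alpha> * pi)) * exp (\<mu> * of_real (ln 2)) * exp (\<mu> * Ln p)"]]
        ext_appell_F1_multiple[where k = "of_real pi * exp ((2 - 2 * \<mu>) * of_real (ln 2)) * exp (\<mu> * Ln p)"]]]]], goal_cases)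
    case (1 t)
    have "exp (p / of_real (t * (1 - t))) * meijer_G 2 0 [1/2] [of_real \<alpha>, - of_real \<alpha>] (2 * p / of_real (t * (1 - t))) =
       1 / of_real (sqrt pi) * (exp (?z t) * exp (- ?z t)) * bessel_K \<alpha> (?z t)"
      unfolding arg meijer_G20_12[OF z[OF 1]] by simp
    then show ?case unfolding ee F_def \<alpha>_def by (simp add: mult.assoc)
  next
    case 2
    show ?case unfolding q by (simp only: mult.assoc)
  next
    case (3 t)
    \<comment> \<open>Formula (ii) has the shape of (iv) with \<mu> = 0.\<close>
    then show ?case using G2[of t 0] shift[of t 0 "of_real (sqrt pi) / of_real (cos (\<alpha> * pi))"] by (simp add: mult.assoc)
  next
    case 4
    show ?case unfolding q mult.assoc r[OF 4] ..
  next
    case (5 t)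
    show ?case unfolding G3[OF 5] by (rule shift[OF 5])
  next
    case 6
    \<comment> \<open>Here 2 * 2^(-\<mu>) p^\<mu> is the constant of the G-function, and the product
      with the prefactor is sqrt(2p/pi) exactly because of the division by sqrt(pi).\<close>
    have "2 powr (\<mu> - 1/2) * p powr (- \<mu> + 1/2) / of_real (sqrt pi) * (2 * exp (- \<mu> * of_real (ln 2)) * exp (\<mu> * Ln p)) = csqrt (2 * p / of_real pi)"
      unfolding c2pi unfolding pw spi(1) mult.assoc two exp_add[symmetric] exp_diff[symmetric]
      by (rule arg_cong[where f = exp]) (simp add: field_simps)
    then show ?case by (simp only: mult.assoc)
  next
    case (7 t)
    show ?case unfolding mult.assoc[of _ "exp (- p / of_real (t * (1 - t)))"] G2[OF 7(2,3,1)] by (rule shift[OF 7(2,3)])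
  next
    case 8
    have E: "(2 * p) powr (- \<mu> + 1/2) * (exp (\<mu> * of_real (ln 2)) * exp (\<mu> * Ln p)) = csqrt (2 * p)"
      unfolding c2p pw exp_add[symmetric] by (rule arg_cong[where f = exp]) (simp add: field_simps)
    show ?case unfolding q r[OF 8, symmetric] E[symmetric] by (simp only: mult_ac)
  next
    case (9 t)
    show ?case unfolding G5[OF 9] by (rule shift[OF 9])
  next
    case 10
    have "p powr (- \<mu> + 1/2) * 2 powr (2 * \<mu> - 3/2) / of_real (pi powr (3/2)) * (of_real pi * exp ((2 - 2 * \<mu>) * of_real (ln 2)) * exp (\<mu> * Ln p)) = csqrt (2 * p / of_real pi)"
      unfolding c2pi unfolding pw spi(2) pi32 exp_add[symmetric] exp_diff[symmetric]
      by (rule arg_cong[where f = exp]) (simp add: field_simps)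
    then show ?case by (simp only: mult.assoc)
  qed
qed

end
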